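(* Let $\lambda>0$, $\beta>0$, $L_1>0$, $L_2>0$, $l=\lfloor\beta\rfloor$. Assume: (F) the probability density $f$ belongs to $\mathcal{H}(\beta,L_1)\cap\mathcal{N}(\beta,L_2)$, the function $t\mapsto |t|^\beta\phi_f(t)$ is integrable, and the derivatives $f',\ldots,f^{(l)}$ are integrable; (W) $w$ is a bounded symmetric kernel of order $l$; its characteristic function $\phi_w$ has support in $[-1,1]$ and is continuously differentiable; $\int_{-\infty}^\infty |u|^\beta|w(u)|\,du<\infty$; and $\lim_{|u|\to\infty}|u\,w(u)|=0$; (H) the bandwidth is $h=h_n=Cn^{-\gamma}$ for constants $C>0$ and $0<\gamma<1$; (M) the truncating sequence is $M_n=n^\alpha$ for some $\alpha>0$. Suppose in addition that $nh^{1+4\beta}\to0$ as $n\to\infty$, and let $x\in\mathbb{R}$ be such that $g(x)\neq0$. Then, as $n\to\infty$, $$\frac{\hat f_{nh}(x)-\mathrm{E}[\hat f_{nh}(x)]}{\sqrt{\mathrm{Var}[\hat f_{nh}(x)]}}\longrightarrow N(0,1)\quad\text{in distribution},$$ where $N(0,1)$ is the standard normal distribution.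
   Context: Model. Let $\lambda>0$ be known, let $N=N(\lambda)$ be Poisson with parameter $\lambda$, and let $Y_1,Y_2,\ldots$ be i.i.d. with density $f$, independent of $N$. Put $X=\sum_{j=1}^{N}Y_j$. Independent copies $X_1,X_2,\ldots$ of $X$ are observed until the first (random) time $T_n$ at which exactly $n$ nonzero observations have been obtained; these nonzero observations are denoted $Z_1,\ldots,Z_n$. They are i.i.d. with density $g$, the (continuous version of the) density of $X$ given $N>0$. For an integrable function $v$, $\phi_v(t)=\int_{-\infty}^\infty e^{itx}v(x)\,dx$. One has $\phi_g(t)=(e^{\lambda\phi_f(t)}-1)/(e^\lambda-1)$. Function classes. With $l=\lfloor\beta\rfloor$ the integer part of $\beta$ (and $f^{(0)}=f$): $f\in\mathcal{H}(\beta,L_1)$ means that the derivatives of $f$ up to order $l$ exist and $|f^{(l)}(x+t)-f^{(l)}(x)|\le L_1|t|^{\beta-l}$ for all $x,t$; $f\in\mathcal{N}(\beta,L_2)$ means that the derivatives of $f$ up to order $l$ exist and $\left[\int_{-\infty}^\infty (f^{(l)}(x+t)-f^{(l)}(x))^2dx\right]^{1/2}\le L_2|t|^{\beta-l}$ for all $t$. Kernel of order $l$: a function $w:\mathbb{R}\to\mathbb{R}$ such that $u^jw(u)$, $j=0,\ldots,l$, are integrable, $\int w(u)\,du=1$ and $\int u^jw(u)\,du=0$ for $j=1,\ldots,l-1$. Estimator. Let $\phi_{\mathrm{emp}}(t)=\frac1n\sum_{j=1}^n e^{itZ_j}$. For a continuous nonvanishing $\psi:\mathbb{R}\to\mathbb{C}$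 with $\psi(0)>0$, the distinguished logarithm $\mathrm{Log}(\psi(t))$ is the unique continuous function of $t$ with $\exp(\mathrm{Log}(\psi(t)))=\psi(t)$ and $\mathrm{Log}(\psi(0))=\log\psi(0)\in\mathbb{R}$. On the event that $t\mapsto (e^\lambda-1)\phi_{\mathrm{emp}}(t)\phi_w(ht)+1$ does not vanish on $\mathbb{R}$, put $$f_{nh}(x)=\frac{1}{2\pi\lambda}\int_{-1/h}^{1/h}e^{-itx}\,\mathrm{Log}\big((e^\lambda-1)\phi_{\mathrm{emp}}(t)\phi_w(ht)+1\big)\,dt,$$ and put $f_{nh}(x)=0$ otherwise ($f_{nh}(x)$ is real-valued). The estimator is $\hat f_{nh}(x)=(M_n\wedge f_{nh}(x))\vee(-M_n)$. *)

theory Defs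
  imports "HOL-Probability.Probability"
begin

definition compound_sum :: "('a \<Rightarrow> nat) \<Rightarrow> (nat \<Rightarrow> 'a \<Rightarrow> real) \<Rightarrow> 'a \<Rightarrow> real" where
  "compound_sum N Y \<omega> = (\<Sum>j<N \<omega>. Y j \<omega>)"

text \<open>The \<^term>\<open>k\<close>-th nonzero observation, counting from \<open>k = 0\<close>. If the observation sequence
  has only finitely many nonzero terms (a null event in the model) the value for large
  \<^term>\<open>k\<close> is irrelevant.\<close>

definition nonzero_obs :: "(nat \<Rightarrow> 'a \<Rightarrow> real) \<Rightarrow> nat \<Rightarrow> 'a \<Rightarrow> real" where
  "nonzero_obs X k \<omega> = X (enumerate {i. X i \<omega> \<noteq> 0} k) \<omega>"

definition fourier :: "(real \<Rightarrow> real) \<Rightarrow> real \<Rightarrow> complex" where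
  "fourier v t = (LINT x|lborel. iexp (t * x) * complex_of_real (v x))"

definition has_derivs_upto :: "nat \<Rightarrow> (real \<Rightarrow> real) \<Rightarrow> bool" where
  "has_derivs_upto l f \<longleftrightarrow> (\<forall>k<l. \<forall>x. (deriv ^^ k) f differentiable (at x))"

text \<open>For integer \<open>\<beta>\<close> the exponent \<open>\<beta> - l\<close> is \<open>0\<close> and \<open>0 powr 0 = 0\<close>; this concerns only
  \<open>t = 0\<close>, where the left-hand sides below vanish anyway.\<close>

definition holder_class :: "real \<Rightarrow> real \<Rightarrow> (real \<Rightarrow> real) set" where
  "holder_class \<beta> L =
     {f. let l = nat \<lfloor>\<beta>\<rfloor> in
         has_derivs_upto l f \<and>
         (\<forall>x t. \<bar>(deriv ^^ l) f (x + t) - (deriv ^^ l) f x\<bar> \<le> L * \<bar>t\<bar> powr (\<beta> - real l))}"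

text \<open>The integrability clause says that the integral is finite; otherwise the Bochner
  integral would silently be \<open>0\<close>.\<close>

definition nikolskii_class :: "real \<Rightarrow> real \<Rightarrow> (real \<Rightarrow> real) set" where
  "nikolskii_class \<beta> L =
     {f. let l = nat \<lfloor>\<beta>\<rfloor> in
         has_derivs_upto l f \<and>
         (\<forall>t. integrable lborel (\<lambda>x. ((deriv ^^ l) f (x + t) - (deriv ^^ l) f x)\<^sup>2) \<and>
              sqrt (LINT x|lborel. ((deriv ^^ l) f (x + t) - (deriv ^^ l) f x)\<^sup>2)
                \<le> L * \<bar>t\<bar> powr (\<beta> - real l))}"

definition kernel_of_order :: "nat \<Rightarrow> (real \<Rightarrow> real) \<Rightarrow> bool" where
  "kernel_of_order l w \<longleftrightarrow>
     (\<forall>j\<in>{0..l}. integrable lborel (\<lambda>u. u ^ j * w u)) \<and>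
     (LINT u|lborel. w u) = 1 \<and>
     (\<forall>j\<in>{1..<l}. (LINT u|lborel. u ^ j * w u) = 0)"

definition emp_cf :: "nat \<Rightarrow> (nat \<Rightarrow> real) \<Rightarrow> real \<Rightarrow> complex" where
  "emp_cf n z t = (1 / of_nat n) * (\<Sum>j<n. iexp (t * z j))"

text \<open>Only meaningful for continuous nonvanishing \<open>\<psi>\<close> with \<open>\<psi> 0\<close> a positive real, for which
  there is exactly one such function.\<close>

definition distinguished_log :: "(real \<Rightarrow> complex) \<Rightarrow> real \<Rightarrow> complex" where
  "distinguished_log \<psi> =
     (THE L. continuous_on UNIV L \<and> (\<forall>t. exp (L t) = \<psi> t) \<and> L 0 = complex_of_real (ln (Re (\<psi> 0))))"

definition log_arg :: "real \<Rightarrow> (real \<Rightarrow> real) \<Rightarrow> real \<Rightarrow> nat \<Rightarrow> (nat \<Rightarrow> real) \<Rightarrow> real \<Rightarrow> complex" where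
  "log_arg lam w h n z t = complex_of_real (exp lam - 1) * emp_cf n z t * fourier w (h * t) + 1"

text \<open>The complex expression under \<^const>\<open>Re\<close> is real for symmetric \<open>w\<close>, so \<^const>\<open>Re\<close>
  only adjusts the type.\<close>

definition f_nh :: "real \<Rightarrow> (real \<Rightarrow> real) \<Rightarrow> real \<Rightarrow> nat \<Rightarrow> (nat \<Rightarrow> real) \<Rightarrow> real \<Rightarrow> real" where
  "f_nh lam w h n z x =
     (if \<forall>t. log_arg lam w h n z t \<noteq> 0
      then Re (complex_of_real (1 / (2 * pi * lam)) *
               (LINT t:{- (1 / h)..1 / h}|lborel.
                  iexp (- (t * x)) * distinguished_log (log_arg lam w h n z) t))
      else 0)"

definition f_hat ::
  "real \<Rightarrow> (real \<Rightarrow> real) \<Rightarrow> real \<Rightarrow> real \<Rightarrow> nat \<Rightarrow> (nat \<Rightarrow> real) \<Rightarrow> real \<Rightarrow> real" where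
  "f_hat lam w h M n z x = max (min M (f_nh lam w h n z x)) (- M)"

end

theory Submission
  imports Defs "HOL-Real_Asymp.Real_Asymp"
begin

text \<open>
  Since the statistic is centred at its own expectation, the logarithm is linearized around the mean
  \<open>\<psi>\<^sub>0(t) = (e\<^sup>\<lambda> - 1) \<phi>\<^sub>g(t) \<phi>\<^sub>w(ht) + 1\<close> of its argument rather than around \<open>e\<close> to the power
  \<open>\<lambda> \<phi>\<^sub>f(t)\<close>, so that no bias has to be estimated. On the event that
  \<open>|\<phi>\<^sub>e\<^sub>m\<^sub>p - \<phi>\<^sub>g|\<close> is small on \<open>[-1/h, 1/h]\<close>, \<open>f\<^sub>n\<^sub>h(x)\<close> is a bounded constant, plus the centred mean \<open>T\<close> of
  the \<open>n\<close> independent variables \<open>K(Z\<^sub>j)\<close>, plus a remainder of order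
  \<open>\<integral>|\<phi>\<^sub>e\<^sub>m\<^sub>p - \<phi>\<^sub>g|\<^sup>2\<close>. The function \<open>K(y)\<close> differs from a constant multiple of
  \<open>h\<^sup>-\<^sup>1 k((y - x)/h)\<close> by a bounded function, where \<open>k \<noteq> 0\<close> is a cosine transform of \<open>\<phi>\<^sub>w\<close>; hence
  \<open>T\<close> has variance of exact order \<open>1/(nh)\<close>. The remainder has second moment \<open>O(1/(nh)\<^sup>2)\<close>, and the complement
  of the event has exponentially small probability (Hoeffding's inequality on a grid of fixed mesh),
  which beats the polynomial truncation level. The summands of the normalized \<open>T\<close> are
  \<open>O((nh)\<close> to the power \<open>-1/2)\<close>, so characteristic functions give the central limit theorem.
\<close>

section \<open>Moments and weak convergence of row-wise independent sums\<close>

text \<open>Since the statistic is divided by its true standard deviation, a remainder that is small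
  in probability is not enough: its second moment must be of smaller order than the variance 1/(nh)
  of the linear term. This is why fourth moments of the empirical characteristic function appear,
  and why the probability of the bad event is weighed against the square of the truncation level.

  The branch of the logarithm is the second obstacle. The principal logarithm cannot be applied to
  \<open>E\<close>, which may wind around 0, but \<open>lam * fourier f\<close> already is a
  continuous logarithm of \<open>E\<close>. Only the ratios of \<open>\<psi>0\<close> to
  \<open>E\<close> and of \<open>log_arg\<close> to \<open>\<psi>0\<close> need one, and both stay
  within 1/4 of 1, away from the branch cut. For the first ratio this is uniform in \<open>t\<close>
  because \<open>fourier g\<close> vanishes at infinity while \<open>fourier w (h * t)\<close> is
  near 1 on bounded sets.

  Integrability of \<open>fourier g\<close>, inherited from \<open>fourier f\<close>, keeps the
  variance of one summand at order 1/h instead of 1/h squared.\<close>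

lemma exp_le_quadratic:
  fixes x b :: real
  assumes "\<bar>x\<bar> \<le> b"
  shows "exp x \<le> 1 + x + x\<^sup>2 * exp b"
proof -
  obtain s where s: "\<bar>s\<bar> \<le> \<bar>x\<bar>" "exp x = (\<Sum>m<2. x ^ m / fact m) + exp s / fact 2 * x ^ 2"
    using Maclaurin_exp_le[of x 2] by auto
  have "exp x = 1 + x + exp s / 2 * x\<^sup>2"
    using s(2) by (simp add: numeral_2_eq_2)
  moreover have "exp s \<le> exp b" using s(1) assms by auto
  then have "exp s / 2 \<le> exp b" using exp_gt_zero[of s] by linarith
  then have "exp s / 2 * x\<^sup>2 \<le> exp b * x\<^sup>2" by (intro mult_right_mono) auto
  ultimately show ?thesis by (simp add: mult.commute)
qed

text \<open>The constant 24 is 4!: the quartic term of the exponential series of \<open>|x|\<close>.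
  This converts exponential moments into fourth moments.\<close>

lemma power4_le_exp:
  fixes x :: real
  shows "x ^ 4 \<le> 24 * (exp x + exp (- x))"
proof -
  have *: "y ^ 4 \<le> 24 * exp y" if "y \<ge> 0" for y :: real
  proof -
    obtain s where s: "\<bar>s\<bar> \<le> \<bar>y\<bar>" "exp y = (\<Sum>m<5. y ^ m / fact m) + exp s / fact 5 * y ^ 5"
      using Maclaurin_exp_le[of y 5] by auto
    have "exp y \<ge> y ^ 4 / fact 4"
    proof -
      have "y ^ 4 / fact 4 \<le> (\<Sum>m<5. y ^ m / fact m)"
        using member_le_sum[of 4 "{..<5::nat}" "\<lambda>m. y ^ m / fact m"] that by simp
      moreover have "0 \<le> exp s / fact 5 * y ^ 5" using that by simp
      ultimately show ?thesis using s(2) by linarith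
    qed
    then show ?thesis by (simp add: fact_numeral)
  qed
  show ?thesis
  proof (cases "x \<ge> 0")
    case True
    then show ?thesis using *[OF True] exp_gt_zero[of "-x"] by (smt (verit))
  next
    case False
    then have "(- x) ^ 4 \<le> 24 * exp (- x)" by (intro *) simp
    then show ?thesis using exp_gt_zero[of x] by (simp add: distrib_left add_increasing)
  qed
qed

text \<open>Centring kills the linear term of \<open>exp_le_quadratic\<close>, so each factor is at
  most 1 plus its variance times \<open>exp b\<close>. After multiplication only the total variance
  and the uniform bound survive, not the number of summands.\<close>

lemma (in prob_space) exp_sum_indep_le:
  fixes \<xi> :: "'i \<Rightarrow> 'a \<Rightarrow> real"
  assumes fin: "finite I" and indep: "indep_vars (\<lambda>_. borel) \<xi> I"
    and bnd: "\<And>i \<omega>. i \<in> I \<Longrightarrow> \<omega> \<in> space M \<Longrightarrow> \<bar>\<xi> i \<omega>\<bar> \<le> b"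
    and mean: "\<And>i. i \<in> I \<Longrightarrow> expectation (\<xi> i) = 0"
    and var: "(\<Sum>i\<in>I. expectation (\<lambda>\<omega>. (\<xi> i \<omega>)\<^sup>2)) \<le> v"
  shows "integrable M (\<lambda>\<omega>. exp (\<Sum>i\<in>I. \<xi> i \<omega>))"
    and "expectation (\<lambda>\<omega>. exp (\<Sum>i\<in>I. \<xi> i \<omega>)) \<le> exp (v * exp b)"
proof -
  have rv[measurable]: "i \<in> I \<Longrightarrow> \<xi> i \<in> borel_measurable M" for i
    using indep unfolding indep_vars_def by auto
  have int1: "integrable M (\<xi> i)" if "i \<in> I" for i
    by (rule integrable_const_bound[where B=b]) (use bnd that in auto)
  have int2: "integrable M (\<lambda>\<omega>. (\<xi> i \<omega>)\<^sup>2)" if "i \<in> I" for i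
    by (rule integrable_const_bound[where B="b^2"])
       (use bnd[OF that] that in \<open>auto intro!: AE_I2 simp: abs_le_square_iff[symmetric] intro: order_trans[OF _ abs_ge_self]\<close>)
  have inte: "integrable M (\<lambda>\<omega>. exp (\<xi> i \<omega>))" if "i \<in> I" for i
    by (rule integrable_const_bound[where B="exp b"])
       (use bnd[OF that] that in \<open>auto intro!: AE_I2 dest: abs_le_D1\<close>)
  have indepe: "indep_vars (\<lambda>_. borel) (\<lambda>i \<omega>. exp (\<xi> i \<omega>)) I"
    using indep_vars_compose2[OF indep, of "\<lambda>_. exp" "\<lambda>_. borel"] by simp
  have one: "expectation (\<lambda>\<omega>. exp (\<xi> i \<omega>)) \<le> exp (expectation (\<lambda>\<omega>. (\<xi> i \<omega>)\<^sup>2) * exp b)"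
    if i: "i \<in> I" for i
  proof -
    have "expectation (\<lambda>\<omega>. exp (\<xi> i \<omega>)) \<le> expectation (\<lambda>\<omega>. 1 + \<xi> i \<omega> + (\<xi> i \<omega>)\<^sup>2 * exp b)"
      by (rule integral_mono)
         (use inte[OF i] int1[OF i] int2[OF i] bnd[OF i] in \<open>auto intro!: exp_le_quadratic\<close>)
    also have "\<dots> = 1 + expectation (\<lambda>\<omega>. (\<xi> i \<omega>)\<^sup>2) * exp b"
      using int1[OF i] int2[OF i] mean[OF i] by (simp add: prob_space)
    also have "\<dots> \<le> exp (expectation (\<lambda>\<omega>. (\<xi> i \<omega>)\<^sup>2) * exp b)"
      by (rule exp_ge_add_one_self)
    finally show ?thesis .
  qed
  show "integrable M (\<lambda>\<omega>. exp (\<Sum>i\<in>I. \<xi> i \<omega>))"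
    unfolding exp_sum[OF fin] by (rule indep_vars_integrable[OF fin indepe inte])
  have "expectation (\<lambda>\<omega>. exp (\<Sum>i\<in>I. \<xi> i \<omega>)) = (\<Prod>i\<in>I. expectation (\<lambda>\<omega>. exp (\<xi> i \<omega>)))"
    unfolding exp_sum[OF fin] by (rule indep_vars_lebesgue_integral[OF fin indepe inte])
  also have "\<dots> \<le> (\<Prod>i\<in>I. exp (expectation (\<lambda>\<omega>. (\<xi> i \<omega>)\<^sup>2) * exp b))"
    by (intro prod_mono) (auto intro: one)
  also have "\<dots> = exp ((\<Sum>i\<in>I. expectation (\<lambda>\<omega>. (\<xi> i \<omega>)\<^sup>2)) * exp b)"
    by (simp add: exp_sum[OF fin] sum_distrib_right)
  also have "\<dots> \<le> exp (v * exp b)"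
    using var by simp
  finally show "expectation (\<lambda>\<omega>. exp (\<Sum>i\<in>I. \<xi> i \<omega>)) \<le> exp (v * exp b)" .
qed

text \<open>The exponential bound is used for the sum and for its negative, whence 48 = 2 *
  24.\<close>

lemma (in prob_space) fourth_moment_sum_indep_le:
  fixes \<xi> :: "'i \<Rightarrow> 'a \<Rightarrow> real"
  assumes fin: "finite I" and indep: "indep_vars (\<lambda>_. borel) \<xi> I"
    and bnd: "\<And>i \<omega>. i \<in> I \<Longrightarrow> \<omega> \<in> space M \<Longrightarrow> \<bar>\<xi> i \<omega>\<bar> \<le> b"
    and mean: "\<And>i. i \<in> I \<Longrightarrow> expectation (\<xi> i) = 0"
    and var: "(\<Sum>i\<in>I. expectation (\<lambda>\<omega>. (\<xi> i \<omega>)\<^sup>2)) \<le> v"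
  shows "expectation (\<lambda>\<omega>. (\<Sum>i\<in>I. \<xi> i \<omega>) ^ 4) \<le> 48 * exp (v * exp b)"
proof -
  have neg: "indep_vars (\<lambda>_. borel) (\<lambda>i \<omega>. - \<xi> i \<omega>) I"
    using indep_vars_compose2[OF indep, of "\<lambda>_ x. - x" "\<lambda>_. borel"] by simp
  note p = exp_sum_indep_le[OF fin indep bnd mean var]
  note m = exp_sum_indep_le[OF fin neg, of b v]
  have m1: "integrable M (\<lambda>\<omega>. exp (- (\<Sum>i\<in>I. \<xi> i \<omega>)))"
    and m2: "expectation (\<lambda>\<omega>. exp (- (\<Sum>i\<in>I. \<xi> i \<omega>))) \<le> exp (v * exp b)"
    using m bnd mean var by (simp_all add: sum_negf)
  have "expectation (\<lambda>\<omega>. (\<Sum>i\<in>I. \<xi> i \<omega>) ^ 4)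
      \<le> expectation (\<lambda>\<omega>. 24 * (exp (\<Sum>i\<in>I. \<xi> i \<omega>) + exp (- (\<Sum>i\<in>I. \<xi> i \<omega>))))"
    by (rule integral_mono') (use p(1) m1 power4_le_exp in \<open>auto simp del: distrib_left_numeral\<close>)
  also have "\<dots> \<le> 24 * (exp (v * exp b) + exp (v * exp b))"
    using p m1 m2 by simp
  finally show ?thesis by simp
qed

text \<open>Lindeberg replacement: the product of the \<open>n\<close> characteristic functions is
  compared factor by factor with the second-order Taylor polynomial 1 - t^2/(2n). Each exchange
  costs a third absolute moment, which for summands bounded by \<open>\<delta>\<close> is at most
  \<open>\<delta>/n\<close>.\<close>

lemma (in prob_space) char_sum_iid_approx:
  fixes \<xi> :: "nat \<Rightarrow> 'a \<Rightarrow> real"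
  assumes indep: "indep_vars (\<lambda>_. borel) \<xi> {..<n}"
    and bnd: "\<And>i \<omega>. i < n \<Longrightarrow> \<omega> \<in> space M \<Longrightarrow> \<bar>\<xi> i \<omega>\<bar> \<le> \<delta>"
    and mean: "\<And>i. i < n \<Longrightarrow> expectation (\<xi> i) = 0"
    and var: "\<And>i. i < n \<Longrightarrow> expectation (\<lambda>\<omega>. (\<xi> i \<omega>)\<^sup>2) = 1 / n"
    and n: "n \<ge> t\<^sup>2 / 4" "n \<ge> 1"
  shows "cmod (char (distr M borel (\<lambda>\<omega>. \<Sum>i<n. \<xi> i \<omega>)) t - complex_of_real ((1 + (- (t\<^sup>2) / 2) / n) ^ n))
     \<le> \<bar>t\<bar> ^ 3 * \<delta> / 6"
proof -
  have rv[measurable]: "i < n \<Longrightarrow> \<xi> i \<in> borel_measurable M" for i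
    using indep unfolding indep_vars_def by auto
  have int1: "integrable M (\<xi> i)" if "i < n" for i
    by (rule integrable_const_bound[where B=\<delta>]) (use bnd that in auto)
  have int2: "integrable M (\<lambda>\<omega>. (\<xi> i \<omega>)\<^sup>2)" if "i < n" for i
    by (rule integrable_const_bound[where B="\<delta>^2"])
       (use bnd[OF that] that in \<open>auto intro!: AE_I2 simp: abs_le_square_iff[symmetric] intro: order_trans[OF _ abs_ge_self]\<close>)
  let ?w = "complex_of_real (1 + (- (t\<^sup>2) / 2) / n)"
  let ?z = "\<lambda>i. char (distr M borel (\<xi> i)) t"
  have one: "cmod (?z i - ?w) \<le> \<bar>t\<bar> ^ 3 * \<delta> / (6 * n)" if i: "i < n" for i
  proof -
    have v: "variance (\<xi> i) = 1 / n" using var[OF i] mean[OF i] by simp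
    have "cmod (?z i - (1 - t\<^sup>2 * (1 / n) / 2)) \<le>
      (t\<^sup>2 / 6) * expectation (\<lambda>x. min (6 * (\<xi> i x)\<^sup>2) (\<bar>t\<bar> * \<bar>\<xi> i x\<bar> ^ 3))"
      by (rule char_approx3'[OF rv[OF i] int1[OF i] int2[OF i] mean[OF i] v refl])
    \<comment> \<open>The cubic branch of the minimum suffices, because the third absolute power is
      at most \<open>\<delta>\<close> times the square.\<close>
    also have "expectation (\<lambda>x. min (6 * (\<xi> i x)\<^sup>2) (\<bar>t\<bar> * \<bar>\<xi> i x\<bar> ^ 3))
       \<le> expectation (\<lambda>x. \<bar>t\<bar> * \<delta> * (\<xi> i x)\<^sup>2)"
    proof (rule integral_mono')
      show "integrable M (\<lambda>x. \<bar>t\<bar> * \<delta> * (\<xi> i x)\<^sup>2)" using int2[OF i] by simp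
      fix x assume x: "x \<in> space M"
      show "min (6 * (\<xi> i x)\<^sup>2) (\<bar>t\<bar> * \<bar>\<xi> i x\<bar> ^ 3) \<le> \<bar>t\<bar> * \<delta> * (\<xi> i x)\<^sup>2"
      proof -
        have "\<bar>\<xi> i x\<bar> ^ 3 = \<bar>\<xi> i x\<bar> * (\<xi> i x)\<^sup>2" by (simp add: power3_eq_cube power2_eq_square)
        also have "\<dots> \<le> \<delta> * (\<xi> i x)\<^sup>2" using bnd[OF i x] by (intro mult_right_mono) auto
        finally have "\<bar>t\<bar> * \<bar>\<xi> i x\<bar> ^ 3 \<le> \<bar>t\<bar> * (\<delta> * (\<xi> i x)\<^sup>2)" by (intro mult_left_mono) auto
        then show ?thesis by (simp add: mult.assoc)
      qed
      show "0 \<le> \<bar>t\<bar> * \<delta> * (\<xi> i x)\<^sup>2" using bnd[OF i x] by auto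
    qed
    also have "\<dots> = \<bar>t\<bar> * \<delta> / n" using var[OF i] by simp
    also have "(t\<^sup>2 / 6) * (\<bar>t\<bar> * \<delta> / n) = \<bar>t\<bar> ^ 3 * \<delta> / (6 * n)"
      by (simp add: power3_eq_cube power2_eq_square field_simps)
    finally have "cmod (?z i - (1 - t\<^sup>2 * (1 / n) / 2)) \<le> \<bar>t\<bar> ^ 3 * \<delta> / (6 * n)"
      by (simp add: mult_left_mono)
    then show ?thesis by (simp add: mult.commute)
  qed
  \<comment> \<open>\<open>n \<ge> t\<^sup>2 / 4\<close> says exactly that 1 - t^2/(2n) is at least
    -1; comparing products requires factors of modulus at most 1.\<close>
  have wle: "cmod ?w \<le> 1"
    unfolding norm_of_real using n by (intro abs_leI) (auto simp: divide_le_eq field_simps)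
  have zle: "cmod (?z i) \<le> 1" if i: "i < n" for i
  proof -
    interpret rd: real_distribution "distr M borel (\<xi> i)" by (rule real_distribution_distr[OF rv[OF i]])
    show ?thesis by (rule rd.cmod_char_le_1)
  qed
  have "char (distr M borel (\<lambda>\<omega>. \<Sum>i<n. \<xi> i \<omega>)) t = (\<Prod>i<n. ?z i)"
    by (rule char_distr_sum[OF indep])
  then have "cmod (char (distr M borel (\<lambda>\<omega>. \<Sum>i<n. \<xi> i \<omega>)) t - (\<Prod>i<n. ?w))
     \<le> (\<Sum>i<n. cmod (?z i - ?w))"
    using norm_prod_diff[of "{..<n}" ?z "\<lambda>_. ?w"] zle wle by auto
  also have "\<dots> \<le> (\<Sum>i<n. \<bar>t\<bar> ^ 3 * \<delta> / (6 * n))"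
    by (intro sum_mono one) auto
  also have "\<dots> = \<bar>t\<bar> ^ 3 * \<delta> / 6" using n by simp
  finally show ?thesis by (simp add: prod_constant)
qed

text \<open>The summands may change from row to row; the uniform bound \<open>\<delta>\<close>
  tending to 0 plays the part of Lindeberg's condition.\<close>

lemma (in prob_space) char_sum_iid_tendsto:
  fixes \<xi> :: "nat \<Rightarrow> nat \<Rightarrow> 'a \<Rightarrow> real"
  assumes "\<forall>\<^sub>F n in sequentially. indep_vars (\<lambda>_. borel) (\<xi> n) {..<n}
     \<and> (\<forall>i<n. (\<forall>\<omega>\<in>space M. \<bar>\<xi> n i \<omega>\<bar> \<le> \<delta> n) \<and> expectation (\<xi> n i) = 0
           \<and> expectation (\<lambda>\<omega>. (\<xi> n i \<omega>)\<^sup>2) = 1 / n)"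
    and \<delta>: "\<delta> \<longlonglongrightarrow> 0"
  shows "(\<lambda>n. char (distr M borel (\<lambda>\<omega>. \<Sum>i<n. \<xi> n i \<omega>)) t) \<longlonglongrightarrow> complex_of_real (exp (- (t\<^sup>2) / 2))"
proof -
  have "\<forall>\<^sub>F n in sequentially. real n \<ge> t\<^sup>2 / 4"
    by (rule eventually_sequentiallyI[of "nat \<lceil>t\<^sup>2 / 4\<rceil>"]) linarith
  then have ev: "\<forall>\<^sub>F n in sequentially.
      cmod (char (distr M borel (\<lambda>\<omega>. \<Sum>i<n. \<xi> n i \<omega>)) t - complex_of_real ((1 + (- (t\<^sup>2) / 2) / n) ^ n))
     \<le> \<bar>t\<bar> ^ 3 * \<delta> n / 6"
    using assms(1) eventually_ge_at_top[of 1]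
  proof eventually_elim
    case (elim n)
    then show ?case by (intro char_sum_iid_approx) auto
  qed
  have lim: "(\<lambda>n. \<bar>t\<bar> ^ 3 * \<delta> n / 6) \<longlonglongrightarrow> 0"
    using \<delta> by (auto intro!: tendsto_eq_intros)
  have "(\<lambda>n. complex_of_real ((1 + (-(t^2) / 2) / n)^n)) \<longlonglongrightarrow> complex_of_real (exp (-(t^2) / 2))"
    by (rule isCont_tendsto_compose [OF _ tendsto_exp_limit_sequentially]) auto
  then show ?thesis
    by (rule Lim_transform) (use Lim_null_comparison [OF ev lim] in simp)
qed

section \<open>Quadratic-mean inequalities and standardization by the true mean and variance\<close>

lemma cmod_iexp_diff_le: "cmod (iexp a - iexp b) \<le> \<bar>a - b\<bar>"
proof -
  have "iexp a - iexp b = iexp b * (iexp (a - b) - 1)"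
    by (simp add: right_diff_distrib' flip: exp_add)
  then have "cmod (iexp a - iexp b) = cmod (iexp (a - b) - 1)"
    by (simp add: norm_mult)
  also have "\<dots> \<le> \<bar>a - b\<bar>"
    using iexp_approx1[of "a - b" 0] by simp
  finally show ?thesis .
qed

text \<open>This is nonnegativity of the variance of \<open>|X|\<close>.\<close>

lemma (in prob_space) expectation_abs_le_sqrt:
  fixes X :: "'a \<Rightarrow> real"
  assumes [measurable]: "X \<in> borel_measurable M" and "integrable M (\<lambda>\<omega>. (X \<omega>)\<^sup>2)"
  shows "expectation (\<lambda>\<omega>. \<bar>X \<omega>\<bar>) \<le> sqrt (expectation (\<lambda>\<omega>. (X \<omega>)\<^sup>2))"
proof -
  have i: "integrable M X" by (rule square_integrable_imp_integrable[OF assms])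
  have "0 \<le> variance (\<lambda>\<omega>. \<bar>X \<omega>\<bar>)" by simp
  also have "variance (\<lambda>\<omega>. \<bar>X \<omega>\<bar>) = expectation (\<lambda>\<omega>. (X \<omega>)\<^sup>2) - (expectation (\<lambda>\<omega>. \<bar>X \<omega>\<bar>))\<^sup>2"
    using i assms by (subst variance_eq) auto
  finally show ?thesis
    by (intro real_le_rsqrt) simp
qed

lemma integrable_mult_square_integrable:
  fixes f g :: "'a \<Rightarrow> real"
  assumes [measurable]: "f \<in> borel_measurable M" "g \<in> borel_measurable M"
    and "integrable M (\<lambda>x. (f x)\<^sup>2)" "integrable M (\<lambda>x. (g x)\<^sup>2)"
  shows "integrable M (\<lambda>x. f x * g x)"
proof (rule Bochner_Integration.integrable_bound)
  show "integrable M (\<lambda>x. (f x)\<^sup>2 + (g x)\<^sup>2)" using assms by auto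
  have "\<bar>a * b\<bar> \<le> a\<^sup>2 + b\<^sup>2" for a b :: real
    using sum_squares_bound[of "\<bar>a\<bar>" "\<bar>b\<bar>"] abs_ge_zero[of "a * b"] unfolding abs_mult power2_abs by linarith
  then show "AE x in M. norm (f x * g x) \<le> norm ((f x)\<^sup>2 + (g x)\<^sup>2)" by auto
qed auto

text \<open>Cauchy-Schwarz for a normalized \<open>X\<close>: the second moment of
  \<open>Y - p * X\<close> is nonnegative at the minimizing \<open>p\<close>, which is the
  expectation of the product.\<close>

lemma (in prob_space) expectation_mult_le_sqrt:
  fixes X Y :: "'a \<Rightarrow> real"
  assumes [measurable]: "X \<in> borel_measurable M" "Y \<in> borel_measurable M"
    and i: "integrable M (\<lambda>\<omega>. (X \<omega>)\<^sup>2)" "integrable M (\<lambda>\<omega>. (Y \<omega>)\<^sup>2)"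
    and one: "expectation (\<lambda>\<omega>. (X \<omega>)\<^sup>2) = 1"
  shows "\<bar>expectation (\<lambda>\<omega>. X \<omega> * Y \<omega>)\<bar> \<le> sqrt (expectation (\<lambda>\<omega>. (Y \<omega>)\<^sup>2))"
proof -
  define p where "p = expectation (\<lambda>\<omega>. X \<omega> * Y \<omega>)"
  have iXY: "integrable M (\<lambda>\<omega>. X \<omega> * Y \<omega>)"
    by (rule integrable_mult_square_integrable) (use i in auto)
  have "0 \<le> expectation (\<lambda>\<omega>. (Y \<omega> - p * X \<omega>)\<^sup>2)" by simp
  also have "\<dots> = expectation (\<lambda>\<omega>. (Y \<omega>)\<^sup>2 - 2 * p * (X \<omega> * Y \<omega>) + p\<^sup>2 * (X \<omega>)\<^sup>2)"
    by (simp add: power2_diff power_mult_distrib algebra_simps)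
  also have "\<dots> = expectation (\<lambda>\<omega>. (Y \<omega>)\<^sup>2) - p\<^sup>2"
    using iXY i one by (simp add: p_def power2_eq_square)
  finally show ?thesis unfolding p_def[symmetric]
    by (intro real_le_rsqrt) simp
qed

text \<open>Slutsky's lemma in quadratic mean, which also controls the variance used for standardizing.\<close>

lemma (in prob_space) standardized_weak_conv:
  fixes A F :: "nat \<Rightarrow> 'a \<Rightarrow> real" and c \<sigma> :: "nat \<Rightarrow> real"
  assumes A_meas[measurable]: "\<And>n. A n \<in> borel_measurable M"
    and F_meas[measurable]: "\<And>n. F n \<in> borel_measurable M"
    and A_int: "\<forall>\<^sub>F n in sequentially. integrable M (\<lambda>\<omega>. (A n \<omega>)\<^sup>2)
        \<and> expectation (A n) = 0 \<and> expectation (\<lambda>\<omega>. (A n \<omega>)\<^sup>2) = 1"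
    and A_char: "\<And>t. (\<lambda>n. char (distr M borel (A n)) t) \<longlonglongrightarrow> complex_of_real (exp (- (t\<^sup>2) / 2))"
    and F_int: "\<forall>\<^sub>F n in sequentially. integrable M (\<lambda>\<omega>. (F n \<omega>)\<^sup>2)"
    and \<sigma>: "\<forall>\<^sub>F n in sequentially. \<sigma> n > 0"
    and D: "(\<lambda>n. expectation (\<lambda>\<omega>. (F n \<omega> - c n - \<sigma> n * A n \<omega>)\<^sup>2) / (\<sigma> n)\<^sup>2) \<longlonglongrightarrow> 0"
  shows "weak_conv_m (\<lambda>n. distr M borel (\<lambda>\<omega>. (F n \<omega> - expectation (F n)) / sqrt (variance (F n))))
     std_normal_distribution"
proof -
  \<comment> \<open>\<open>B n\<close> is the approximation error in units of
    \<open>\<sigma> n\<close>. Centring \<open>F n\<close> at its own expectation removes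
    \<open>c n\<close> and the mean \<open>m n\<close>, so only the centred error \<open>B'\<close>
    remains.\<close>
  define B where "B n \<omega> = (F n \<omega> - c n) / \<sigma> n - A n \<omega>" for n \<omega>
  define m where "m n = expectation (B n)" for n
  define B' where "B' n \<omega> = B n \<omega> - m n" for n \<omega>
  define e where "e n = expectation (\<lambda>\<omega>. (B' n \<omega>)\<^sup>2)" for n
  \<comment> \<open>The true standard deviation of \<open>F n\<close> measured in units of
    \<open>\<sigma> n\<close>; the point is that this ratio tends to 1.\<close>
  define \<tau> where "\<tau> n = sqrt (variance (F n)) / \<sigma> n" for n
  define W where "W n \<omega> = (F n \<omega> - expectation (F n)) / sqrt (variance (F n))" for n \<omega>
  have [measurable]: "B n \<in> borel_measurable M" "B' n \<in> borel_measurable M"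
      "W n \<in> borel_measurable M" for n
    unfolding B_def B'_def W_def by measurable
  have main: "\<forall>\<^sub>F n in sequentially. 0 \<le> e n
      \<and> e n \<le> expectation (\<lambda>\<omega>. (F n \<omega> - c n - \<sigma> n * A n \<omega>)\<^sup>2) / (\<sigma> n)\<^sup>2
      \<and> integrable M (\<lambda>\<omega>. (B' n \<omega>)\<^sup>2)
      \<and> (\<forall>\<omega>. F n \<omega> - expectation (F n) = \<sigma> n * (A n \<omega> + B' n \<omega>))
      \<and> \<bar>(\<tau> n)\<^sup>2 - 1 - e n\<bar> \<le> 2 * sqrt (e n)"
    using A_int F_int \<sigma>
  proof eventually_elim
    case (elim n)
    have iA: "integrable M (A n)" by (rule square_integrable_imp_integrable) (use elim in auto)
    have iF: "integrable M (F n)" by (rule square_integrable_imp_integrable) (use elim in auto)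
    have iAF: "integrable M (\<lambda>\<omega>. A n \<omega> * F n \<omega>)"
      by (rule integrable_mult_square_integrable) (use elim in auto)
    have iB: "integrable M (B n)" unfolding B_def using iA iF elim by auto
    have B2: "(B n \<omega>)\<^sup>2 = (F n \<omega>)\<^sup>2 / (\<sigma> n)\<^sup>2 - 2 * c n * F n \<omega> / (\<sigma> n)\<^sup>2 + (c n)\<^sup>2 / (\<sigma> n)\<^sup>2
        - 2 / \<sigma> n * (A n \<omega> * F n \<omega>) + 2 * c n / \<sigma> n * A n \<omega> + (A n \<omega>)\<^sup>2" for \<omega>
      using elim unfolding B_def by (simp add: power2_eq_square field_simps)
    have iB2: "integrable M (\<lambda>\<omega>. (B n \<omega>)\<^sup>2)" unfolding B2 using elim iA iF iAF by auto
    have iB'2: "integrable M (\<lambda>\<omega>. (B' n \<omega>)\<^sup>2)"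
      unfolding B'_def power2_diff using iB iB2 by auto
    have e0: "0 \<le> e n" unfolding e_def by simp
    have BD: "(B n \<omega>)\<^sup>2 = (F n \<omega> - c n - \<sigma> n * A n \<omega>)\<^sup>2 / (\<sigma> n)\<^sup>2" for \<omega>
      using elim unfolding B_def by (simp add: power2_eq_square field_simps)
    have "e n = variance (B n)" unfolding e_def B'_def m_def ..
    also have "\<dots> \<le> expectation (\<lambda>\<omega>. (B n \<omega>)\<^sup>2)"
      using iB iB2 by (subst variance_eq) auto
    finally have eD: "e n \<le> expectation (\<lambda>\<omega>. (F n \<omega> - c n - \<sigma> n * A n \<omega>)\<^sup>2) / (\<sigma> n)\<^sup>2"
      by (simp add: BD)
    have Feq: "F n \<omega> = c n + \<sigma> n * (A n \<omega> + B n \<omega>)" for \<omega>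
      using elim unfolding B_def by (simp add: field_simps)
    have "expectation (F n) = expectation (\<lambda>\<omega>. c n + \<sigma> n * (A n \<omega> + B n \<omega>))"
      by (intro Bochner_Integration.integral_cong refl Feq)
    also have "\<dots> = c n + \<sigma> n * m n"
      using iA iB elim by (simp add: prob_space m_def)
    finally have EF: "expectation (F n) = c n + \<sigma> n * m n" .
    have dec: "\<forall>\<omega>. F n \<omega> - expectation (F n) = \<sigma> n * (A n \<omega> + B' n \<omega>)"
      unfolding EF B'_def using Feq by (auto simp: algebra_simps)
    have iAB: "integrable M (\<lambda>\<omega>. A n \<omega> * B' n \<omega>)"
      by (rule integrable_mult_square_integrable) (use elim iB'2 in auto)
    \<comment> \<open>In units of \<open>\<sigma> n\<close> the variance differs from 1 by
      \<open>e n\<close> and twice the cross term, which Cauchy-Schwarz bounds by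
      \<open>sqrt (e n)\<close> because \<open>A n\<close> has unit second moment.\<close>
    have "variance (F n) = expectation (\<lambda>\<omega>. (\<sigma> n)\<^sup>2 * ((A n \<omega>)\<^sup>2 + 2 * (A n \<omega> * B' n \<omega>) + (B' n \<omega>)\<^sup>2))"
      using dec by (intro Bochner_Integration.integral_cong refl) (simp add: power_mult_distrib power2_sum)
    also have "\<dots> = (\<sigma> n)\<^sup>2 * (1 + 2 * expectation (\<lambda>\<omega>. A n \<omega> * B' n \<omega>) + e n)"
      using elim iB'2 iAB by (simp add: e_def)
    finally have V: "variance (F n) = (\<sigma> n)\<^sup>2 * (1 + 2 * expectation (\<lambda>\<omega>. A n \<omega> * B' n \<omega>) + e n)" .
    have "(\<tau> n)\<^sup>2 = variance (F n) / (\<sigma> n)\<^sup>2"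
      unfolding \<tau>_def power_divide by (subst real_sqrt_pow2) auto
    then have t2: "(\<tau> n)\<^sup>2 = 1 + 2 * expectation (\<lambda>\<omega>. A n \<omega> * B' n \<omega>) + e n"
      unfolding V using elim by simp
    have "\<bar>expectation (\<lambda>\<omega>. A n \<omega> * B' n \<omega>)\<bar> \<le> sqrt (e n)"
      unfolding e_def by (rule expectation_mult_le_sqrt) (use elim iB'2 in auto)
    then show ?case using e0 eD iB'2 dec t2 by (auto simp: abs_le_iff)
  qed
  have e: "e \<longlonglongrightarrow> 0"
    by (rule tendsto_sandwich[OF _ _ tendsto_const D]) (use main in \<open>auto elim: eventually_mono\<close>)
  have "(\<lambda>n. (\<tau> n)\<^sup>2 - 1 - e n) \<longlonglongrightarrow> 0"
  proof (rule Lim_null_comparison)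
    show "\<forall>\<^sub>F n in sequentially. norm ((\<tau> n)\<^sup>2 - 1 - e n) \<le> 2 * sqrt (e n)"
      using main by (auto elim: eventually_mono)
    show "(\<lambda>n. 2 * sqrt (e n)) \<longlonglongrightarrow> 0" using tendsto_mult_right_zero[OF tendsto_real_sqrt[OF e, simplified], of 2] by simp
  qed
  from tendsto_add[OF this e] have "(\<lambda>n. (\<tau> n)\<^sup>2 - 1) \<longlonglongrightarrow> 0" by simp
  then have "(\<lambda>n. (\<tau> n)\<^sup>2) \<longlonglongrightarrow> 1" by (simp add: LIM_zero_iff)
  from tendsto_real_sqrt[OF this] have "(\<lambda>n. \<bar>\<tau> n\<bar>) \<longlonglongrightarrow> 1" by simp
  moreover have t0: "\<forall>\<^sub>F n in sequentially. \<tau> n \<ge> 0"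
    using \<sigma> by eventually_elim (auto simp: \<tau>_def)
  ultimately have \<tau>: "\<tau> \<longlonglongrightarrow> 1"
    by (auto elim!: Lim_transform_eventually eventually_mono)
  \<comment> \<open>The standardized statistic is \<open>(A n + B' n) / \<tau> n\<close>. As
    \<open>iexp\<close> is Lipschitz, the difference of the characteristic functions is controlled
    by the first absolute moments of \<open>A n\<close> and \<open>B' n\<close>, which are at most 1
    and \<open>sqrt (e n)\<close>.\<close>
  have diff: "\<forall>\<^sub>F n in sequentially. cmod (char (distr M borel (W n)) t - char (distr M borel (A n)) t)
     \<le> \<bar>t\<bar> * (\<bar>1 / \<tau> n - 1\<bar> + sqrt (e n) / \<tau> n)" for t
    using main A_int \<sigma> order_tendstoD(1)[OF \<tau> zero_less_one]
  proof eventually_elim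
    case (elim n)
    have iA: "integrable M (A n)" by (rule square_integrable_imp_integrable) (use elim in auto)
    have iB: "integrable M (B' n)" by (rule square_integrable_imp_integrable) (use elim in auto)
    have "W n \<omega> = (A n \<omega> + B' n \<omega>) / \<tau> n" for \<omega>
      using elim unfolding W_def \<tau>_def by (simp add: field_simps)
    then have WA: "W n \<omega> - A n \<omega> = (1 / \<tau> n - 1) * A n \<omega> + B' n \<omega> / \<tau> n" for \<omega>
      by (simp add: add_divide_distrib left_diff_distrib)
    have "cmod (char (distr M borel (W n)) t - char (distr M borel (A n)) t)
       = cmod (CLINT \<omega>|M. iexp (t * W n \<omega>) - iexp (t * A n \<omega>))"
      unfolding char_def
      by (subst (1 2) integral_distr, simp, simp, simp, simp)
         (subst Bochner_Integration.integral_diff, auto intro!: integrable_const_bound[where B=1])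
    also have "\<dots> \<le> expectation (\<lambda>\<omega>. \<bar>t\<bar> * (\<bar>1 / \<tau> n - 1\<bar> * \<bar>A n \<omega>\<bar> + \<bar>B' n \<omega>\<bar> / \<tau> n))"
    proof (rule order_trans[OF integral_norm_bound], rule integral_mono')
      show "integrable M (\<lambda>\<omega>. \<bar>t\<bar> * (\<bar>1 / \<tau> n - 1\<bar> * \<bar>A n \<omega>\<bar> + \<bar>B' n \<omega>\<bar> / \<tau> n))"
        using iA iB by auto
      fix \<omega>
      have "cmod (iexp (t * W n \<omega>) - iexp (t * A n \<omega>)) \<le> \<bar>t\<bar> * \<bar>W n \<omega> - A n \<omega>\<bar>"
        using cmod_iexp_diff_le[of "t * W n \<omega>" "t * A n \<omega>"]
        by (simp add: abs_mult flip: right_diff_distrib)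
      also have "\<bar>W n \<omega> - A n \<omega>\<bar> \<le> \<bar>1 / \<tau> n - 1\<bar> * \<bar>A n \<omega>\<bar> + \<bar>B' n \<omega>\<bar> / \<tau> n"
        unfolding WA using elim by (intro order_trans[OF abs_triangle_ineq]) (auto simp: abs_mult)
      finally show "cmod (iexp (t * W n \<omega>) - iexp (t * A n \<omega>))
         \<le> \<bar>t\<bar> * (\<bar>1 / \<tau> n - 1\<bar> * \<bar>A n \<omega>\<bar> + \<bar>B' n \<omega>\<bar> / \<tau> n)"
        by (simp add: mult_left_mono)
      show "0 \<le> \<bar>t\<bar> * (\<bar>1 / \<tau> n - 1\<bar> * \<bar>A n \<omega>\<bar> + \<bar>B' n \<omega>\<bar> / \<tau> n)"
        using elim by auto
    qed
    also have "\<dots> = \<bar>t\<bar> * (\<bar>1 / \<tau> n - 1\<bar> * expectation (\<lambda>\<omega>. \<bar>A n \<omega>\<bar>) + expectation (\<lambda>\<omega>. \<bar>B' n \<omega>\<bar>) / \<tau> n)"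
      using iA iB by simp
    also have "\<dots> \<le> \<bar>t\<bar> * (\<bar>1 / \<tau> n - 1\<bar> * 1 + sqrt (e n) / \<tau> n)"
      using expectation_abs_le_sqrt[of "A n"] expectation_abs_le_sqrt[of "B' n"] elim
      by (intro mult_left_mono add_mono divide_right_mono) (auto simp: e_def)
    finally show ?case by simp
  qed
  have lim: "(\<lambda>n. \<bar>t\<bar> * (\<bar>1 / \<tau> n - 1\<bar> + sqrt (e n) / \<tau> n)) \<longlonglongrightarrow> 0" for t
    by (rule tendsto_eq_intros refl \<tau> e | simp)+
  show ?thesis
  proof (rule levy_continuity)
    fix t
    have "(\<lambda>n. char (distr M borel (W n)) t) \<longlonglongrightarrow> complex_of_real (exp (- (t\<^sup>2) / 2))"
      by (rule Lim_transform[OF A_char[of t]]) (rule Lim_null_comparison[OF diff lim])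
    then show "(\<lambda>n. char (distr M borel (\<lambda>\<omega>. (F n \<omega> - expectation (F n)) / sqrt (variance (F n)))) t)
       \<longlonglongrightarrow> char std_normal_distribution t"
      unfolding W_def char_std_normal_distribution by simp
  qed (auto intro!: real_dist_normal_dist)
qed

text \<open>In the induction the new summand is centred and independent of the previous sum, so the
  cross term vanishes.\<close>

lemma (in prob_space) second_moment_sum_indep:
  fixes \<xi> :: "'i \<Rightarrow> 'a \<Rightarrow> real"
  assumes "finite I" "indep_vars (\<lambda>_. borel) \<xi> I"
    and "\<And>i \<omega>. i \<in> I \<Longrightarrow> \<omega> \<in> space M \<Longrightarrow> \<bar>\<xi> i \<omega>\<bar> \<le> b"
    and "\<And>i. i \<in> I \<Longrightarrow> expectation (\<xi> i) = 0"
  shows "expectation (\<lambda>\<omega>. (\<Sum>i\<in>I. \<xi> i \<omega>)\<^sup>2) = (\<Sum>i\<in>I. expectation (\<lambda>\<omega>. (\<xi> i \<omega>)\<^sup>2))"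
  using assms
proof (induction I rule: finite_induct)
  case (insert i I)
  have [measurable]: "j \<in> insert i I \<Longrightarrow> \<xi> j \<in> borel_measurable M" for j
    using insert.prems(1) unfolding indep_vars_def by auto
  have bS: "\<bar>\<Sum>j\<in>I. \<xi> j \<omega>\<bar> \<le> card I * b" if "\<omega> \<in> space M" for \<omega>
    using insert.prems(2) that by (intro order_trans[OF sum_abs sum_bounded_above]) auto
  have Sm: "(\<lambda>\<omega>. \<Sum>j\<in>I. \<xi> j \<omega>) \<in> borel_measurable M" by (intro borel_measurable_sum) auto
  have intS: "integrable M (\<lambda>\<omega>. \<Sum>j\<in>I. \<xi> j \<omega>)"
    by (rule integrable_const_bound[where B="card I * b"]) (use bS Sm in auto)
  have inti: "integrable M (\<xi> i)"
    by (rule integrable_const_bound[where B=b]) (use insert.prems(2)[of i] in auto)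
  have intS2: "integrable M (\<lambda>\<omega>. (\<Sum>j\<in>I. \<xi> j \<omega>)\<^sup>2)"
    by (rule integrable_const_bound[where B="(card I * b)\<^sup>2"])
       (use order_trans[OF bS abs_ge_self] Sm in \<open>auto intro!: AE_I2 simp del: abs_mult simp: abs_le_square_iff[symmetric]\<close>)
  have inti2: "integrable M (\<lambda>\<omega>. (\<xi> i \<omega>)\<^sup>2)"
    by (rule integrable_const_bound[where B="b\<^sup>2"])
       (use order_trans[OF insert.prems(2)[of i] abs_ge_self] in \<open>auto intro!: AE_I2 simp: abs_le_square_iff[symmetric]\<close>)
  have iv: "indep_var borel (\<xi> i) borel (\<lambda>\<omega>. \<Sum>j\<in>I. \<xi> j \<omega>)"
    by (rule indep_vars_sum) (use insert in auto)
  have cross: "expectation (\<lambda>\<omega>. \<xi> i \<omega> * (\<Sum>j\<in>I. \<xi> j \<omega>)) = 0"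
    using indep_var_lebesgue_integral[OF iv inti intS] insert.prems(3)[of i] by simp
  have intc: "integrable M (\<lambda>\<omega>. \<xi> i \<omega> * (\<Sum>j\<in>I. \<xi> j \<omega>))"
    by (rule indep_var_integrable[OF iv inti intS])
  have "expectation (\<lambda>\<omega>. (\<Sum>j\<in>insert i I. \<xi> j \<omega>)\<^sup>2)
     = expectation (\<lambda>\<omega>. (\<xi> i \<omega>)\<^sup>2 + (\<Sum>j\<in>I. \<xi> j \<omega>)\<^sup>2 + 2 * (\<xi> i \<omega> * (\<Sum>j\<in>I. \<xi> j \<omega>)))"
    using insert.hyps by (simp add: power2_sum mult.assoc)
  also have "\<dots> = expectation (\<lambda>\<omega>. (\<xi> i \<omega>)\<^sup>2) + expectation (\<lambda>\<omega>. (\<Sum>j\<in>I. \<xi> j \<omega>)\<^sup>2)"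
    using inti2 intS2 intc cross by simp
  also have "expectation (\<lambda>\<omega>. (\<Sum>j\<in>I. \<xi> j \<omega>)\<^sup>2) = (\<Sum>i\<in>I. expectation (\<lambda>\<omega>. (\<xi> i \<omega>)\<^sup>2))"
    by (rule insert.IH) (use insert.prems in \<open>auto intro: indep_vars_subset\<close>)
  finally show ?case using insert.hyps by simp
qed simp

section \<open>The nonzero observations\<close>

text \<open>\<open>enumerate S (Suc k)\<close> is \<open>enumerate\<close> at \<open>k\<close> of
  \<open>S\<close> without its least element, so the induction has to range over all measurable
  random sets \<open>S\<close>.\<close>

lemma measurable_enumerate:
  fixes S :: "'a \<Rightarrow> nat set"
  assumes "\<And>i. Measurable.pred M (\<lambda>\<omega>. i \<in> S \<omega>)"
  shows "(\<lambda>\<omega>. enumerate (S \<omega>) k) \<in> measurable M (count_space UNIV)"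
  using assms
proof (induction k arbitrary: S)
  case 0
  then show ?case unfolding enumerate_0 by (intro measurable_Least) simp
next
  case (Suc k)
  have [measurable]: "Measurable.pred M (\<lambda>\<omega>. i \<in> S \<omega>)" for i by fact
  have [measurable]: "(\<lambda>\<omega>. LEAST n. n \<in> S \<omega>) \<in> measurable M (count_space UNIV)"
    by (intro measurable_Least) simp
  have "Measurable.pred M (\<lambda>\<omega>. i \<in> S \<omega> \<and> i \<noteq> (LEAST n. n \<in> S \<omega>))" for i
    by measurable
  then show ?case unfolding enumerate_Suc by (intro Suc.IH) simp
qed

lemma measurable_nonzero_obs:
  assumes [measurable]: "\<And>i. X i \<in> borel_measurable M"
  shows "nonzero_obs X k \<in> borel_measurable M"
proof -
  have [measurable]: "(\<lambda>\<omega>. enumerate {i. X i \<omega> \<noteq> 0} k) \<in> measurable M (count_space UNIV)"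
    by (rule measurable_enumerate) simp
  have "(\<lambda>\<omega>. X (enumerate {i. X i \<omega> \<noteq> 0} k) \<omega>) \<in> borel_measurable M"
    by (rule measurable_compose_countable[where g="\<lambda>\<omega>. enumerate {i. X i \<omega> \<noteq> 0} k"]) auto
  then show ?thesis unfolding nonzero_obs_def[abs_def] .
qed

text \<open>Whether the first elements of \<open>T\<close> are the list \<open>J\<close> depends
  only on membership of the finitely many indices up to \<open>last J\<close>. This turns a
  statement about random positions into a finite intersection of events for independent
  variables.\<close>

lemma enumerate_eq_nth_iff:
  fixes T :: "nat set"
  assumes T: "infinite T" and J: "sorted_wrt (<) J" "J \<noteq> []"
  shows "(\<forall>k<length J. enumerate T k = J ! k) \<longleftrightarrow> T \<inter> {..last J} = set J"
proof -
  define L where "L = map (enumerate T) [0..<length J]"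
  have lenL: "length L = length J" by (simp add: L_def)
  have sL: "sorted_wrt (<) L"
    unfolding L_def by (auto simp: sorted_wrt_iff_nth_less enumerate_mono_iff[OF T])
  have Lne: "L \<noteq> []" using lenL J by auto
  have lastL: "last L = enumerate T (length J - 1)"
    using J by (simp add: L_def last_conv_nth)
  have segL: "T \<inter> {..last L} = set L"
  proof (intro equalityI subsetI)
    fix i assume i: "i \<in> T \<inter> {..last L}"
    then obtain k where k: "i = enumerate T k" using range_enumerate[OF T] by blast
    with i have "k \<le> length J - 1" unfolding lastL by (simp add: T)
    then have "k < length J" using J by (cases J) auto
    then show "i \<in> set L" unfolding L_def k by simp
  next
    fix i assume "i \<in> set L"
    then obtain k where k: "k < length J" "i = enumerate T k" unfolding L_def by auto
    then show "i \<in> T \<inter> {..last L}" unfolding lastL using T by (simp add: enumerate_in_set)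
  qed
  have eq: "(\<forall>k<length J. enumerate T k = J ! k) \<longleftrightarrow> L = J"
  proof
    assume "\<forall>k<length J. enumerate T k = J ! k"
    then show "L = J" by (intro nth_equalityI) (simp_all add: L_def)
  next
    assume H: "L = J"
    show "\<forall>k<length J. enumerate T k = J ! k"
    proof (intro allI impI)
      fix k assume "k < length J"
      then have "L ! k = enumerate T k" unfolding L_def by simp
      then show "enumerate T k = J ! k" unfolding H by simp
    qed
  qed
  have dJ: "sorted J" "distinct J" and dL: "sorted L" "distinct L"
    using J sL by (auto simp: strict_sorted_iff)
  show ?thesis
  proof
    assume "\<forall>k<length J. enumerate T k = J ! k"
    then have "L = J" using eq by simp
    then show "T \<inter> {..last J} = set J" using segL by simp
  next
    assume segJ: "T \<inter> {..last J} = set J"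
    have "card (set J) = card (set L)" using dJ dL lenL by (simp add: distinct_card)
    \<comment> \<open>Both sets are initial segments of \<open>T\<close>, hence nested; equal
      cardinality makes them equal.\<close>
    moreover have "set J \<subseteq> set L \<or> set L \<subseteq> set J"
    proof (cases "last L \<le> last J")
      case True
      then have "T \<inter> {..last L} \<subseteq> T \<inter> {..last J}" by auto
      then show ?thesis unfolding segL segJ by simp
    next
      case False
      then have "T \<inter> {..last J} \<subseteq> T \<inter> {..last L}" by auto
      then show ?thesis unfolding segL segJ by simp
    qed
    ultimately have "set J = set L" by (auto dest: card_subset_eq[rotated])
    then have "L = J" by (intro sorted_distinct_set_unique dJ dL) auto
    then show "\<forall>k<length J. enumerate T k = J ! k" using eq by simp
  qed
qed

lemma set_subset_atMost_last:
  fixes J :: "'a::linorder list"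
  shows "sorted J \<Longrightarrow> set J \<subseteq> {..last J}"
proof (induction J)
  case (Cons a J)
  show ?case
  proof (cases "J = []")
    case False
    then have "a \<le> last J" using Cons.prems last_in_set[of J] by simp
    then show ?thesis using Cons False by simp
  qed simp
qed simp

text \<open>If all observations from \<open>m\<close> on vanish, then so do any \<open>k\<close>
  consecutive ones, an event of probability \<open>measure \<mu> {0} ^ k\<close>, and
  \<open>k\<close> is arbitrary.\<close>

lemma (in prob_space) AE_infinite_nonzero:
  fixes X :: "nat \<Rightarrow> 'a \<Rightarrow> real"
  assumes indep: "indep_vars (\<lambda>_. borel) X UNIV"
    and dist: "\<And>i. distr M borel (X i) = \<mu>"
    and q: "measure \<mu> {0} < 1"
  shows "AE \<omega> in M. infinite {i. X i \<omega> \<noteq> 0}"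
proof -
  have rv[measurable]: "X i \<in> borel_measurable M" for i
    using indep unfolding indep_vars_def by auto
  have pq: "prob (X i -` {0} \<inter> space M) = measure \<mu> {0}" for i
    unfolding dist[of i, symmetric] by (subst measure_distr) auto
  have "AE \<omega> in M. \<not> (\<forall>i\<ge>m. X i \<omega> = 0)" for m
  proof -
    let ?E = "{\<omega>\<in>space M. \<forall>i\<ge>m. X i \<omega> = 0}"
    have [measurable]: "?E \<in> events" by measurable
    have "prob ?E \<le> measure \<mu> {0} ^ k" if "k > 0" for k
    proof -
      have "prob ?E \<le> prob (\<Inter>i\<in>{m..<m+k}. X i -` {0} \<inter> space M)"
        using that by (intro finite_measure_mono) (auto intro!: sets.finite_INT)
      also have "\<dots> = (\<Prod>i\<in>{m..<m+k}. prob (X i -` {0} \<inter> space M))"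
        using that by (intro indep_varsD[OF indep]) auto
      finally show ?thesis by (simp add: pq)
    qed
    then have "\<forall>\<^sub>F k in sequentially. prob ?E \<le> measure \<mu> {0} ^ k"
      by (intro eventually_sequentiallyI[of 1]) auto
    moreover have "(\<lambda>k. measure \<mu> {0} ^ k) \<longlonglongrightarrow> 0" using q by (intro LIMSEQ_realpow_zero) auto
    ultimately have "prob ?E \<le> 0"
      by (intro tendsto_lowerbound[where f="\<lambda>k. measure \<mu> {0} ^ k" and F=sequentially]) auto
    then have "prob ?E = 0" by (simp add: order_antisym)
    then have "?E \<in> null_sets M" by (simp add: emeasure_eq_measure null_setsI)
    then show ?thesis by (rule AE_I') auto
  qed
  then have "AE \<omega> in M. \<forall>m. \<not> (\<forall>i\<ge>m. X i \<omega> = 0)" by (simp add: AE_all_countable)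
  then show ?thesis
    by eventually_elim (auto simp: infinite_nat_iff_unbounded_le)
qed

text \<open>The event is split according to the list \<open>J\<close> of the positions of the first
  \<open>n\<close> nonzero observations. Each piece has as probability the product of the
  \<open>\<mu> (A k - {0})\<close> times a power of \<open>\<mu> {0}\<close> that depends on
  \<open>J\<close> alone. The sum of these powers is thus a constant common to all \<open>A\<close>;
  it is found by normalization, not by summing the series.\<close>

lemma (in prob_space) prob_nonzero_obs:
  fixes X :: "nat \<Rightarrow> 'a \<Rightarrow> real"
  assumes indep: "indep_vars (\<lambda>_. borel) X UNIV"
    and dist: "\<And>i. distr M borel (X i) = \<mu>"
    and q: "measure \<mu> {0} < 1"
    and A: "\<And>k. k < n \<Longrightarrow> A k \<in> sets borel" and n: "n > 0"
  shows "prob {\<omega>\<in>space M. \<forall>k<n. nonzero_obs X k \<omega> \<in> A k}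
     = (\<Prod>k<n. measure \<mu> (A k - {0}) / (1 - measure \<mu> {0}))"
proof -
  have rv[measurable]: "X i \<in> borel_measurable M" for i
    using indep unfolding indep_vars_def by auto
  have rvZ[measurable]: "nonzero_obs X k \<in> borel_measurable M" for k
    by (rule measurable_nonzero_obs) simp
  have pX: "prob (X i -` B \<inter> space M) = measure \<mu> B" if "B \<in> sets borel" for i B
    unfolding dist[of i, symmetric] using that by (subst measure_distr) auto
  interpret \<mu>: prob_space \<mu> unfolding dist[of 0, symmetric] by (rule prob_space_distr) simp
  have sets\<mu>: "sets \<mu> = sets borel" unfolding dist[of 0, symmetric] by simp
  have space\<mu>: "space \<mu> = UNIV" unfolding dist[of 0, symmetric] by simp
  define q where "q = measure \<mu> {0}"
  define T where "T \<omega> = {i. X i \<omega> \<noteq> 0}" for \<omega>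
  define I where "I = {J :: nat list. sorted_wrt (<) J \<and> length J = n}"
  \<comment> \<open>The exponent counts the zeros observed before the last position in
    \<open>J\<close>.\<close>
  define C where "C = (\<integral>\<^sup>+J. ennreal (q ^ (card ({..last J} - set J))) \<partial>count_space I)"
  have inf: "AE \<omega> in M. infinite (T \<omega>)"
    unfolding T_def by (rule AE_infinite_nonzero[OF indep dist assms(3)])
  have main: "emeasure M {\<omega>\<in>space M. \<forall>k<n. nonzero_obs X k \<omega> \<in> A k}
       = ennreal (\<Prod>k<n. measure \<mu> (A k - {0})) * C"
    if A[measurable]: "\<And>k. k < n \<Longrightarrow> A k \<in> sets borel" for A
  proof -
    \<comment> \<open>The set prescribed for \<open>X i\<close> when the nonzero positions are
      \<open>J\<close>: at the \<open>k\<close>-th entry of \<open>J\<close> it is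
      \<open>A k\<close> without 0, at all other indices it is \<open>{0}\<close>.\<close>
    define B where "B J i = (if i \<in> set J then A (inv_into {..<n} ((!) J) i) - {0} else {0})" for J :: "nat list" and i
    define E where "E J = (\<Inter>i\<in>{..last J}. X i -` B J i \<inter> space M)" for J
    have bij: "bij_betw ((!) J) {..<n} (set J)" if "J \<in> I" for J
      using that by (intro bij_betw_nth) (auto simp: I_def strict_sorted_iff)
    have Bnth: "B J (J ! k) = A k - {0}" if "J \<in> I" "k < n" for J k
      using bij_betw_imp_inj_on[OF bij[OF that(1)]] that
      by (auto simp: B_def I_def inv_into_f_f)
    have Bm: "B J i \<in> sets borel" if J: "J \<in> I" for J i
    proof (cases "i \<in> set J")
      case True
      then obtain k where "k < n" "i = J ! k" using J by (auto simp: in_set_conv_nth I_def)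
      then show ?thesis using Bnth[OF J] A by auto
    qed (simp add: B_def)
    have Em[measurable]: "E J \<in> events" if "J \<in> I" for J
      unfolding E_def using Bm[OF that] by (intro sets.finite_INT) auto
    have PE: "emeasure M (E J) = ennreal (\<Prod>k<n. measure \<mu> (A k - {0})) * ennreal (q ^ (card ({..last J} - set J)))"
      if J: "J \<in> I" for J
    proof -
      have sub: "set J \<subseteq> {..last J}"
        using J by (intro set_subset_atMost_last) (simp add: I_def strict_sorted_iff)
      have "prob (E J) = (\<Prod>i\<in>{..last J}. prob (X i -` B J i \<inter> space M))"
        unfolding E_def by (rule indep_varsD[OF indep]) (use Bm[OF J] in auto)
      also have "\<dots> = (\<Prod>i\<in>{..last J}. measure \<mu> (B J i))" using Bm[OF J] by (simp add: pX)
      also have "\<dots> = (\<Prod>i\<in>{..last J} - set J. measure \<mu> (B J i)) * (\<Prod>i\<in>set J. measure \<mu> (B J i))"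
        by (rule prod.subset_diff[OF sub]) simp
      also have "(\<Prod>i\<in>{..last J} - set J. measure \<mu> (B J i)) = q ^ card ({..last J} - set J)"
        by (simp add: B_def q_def)
      also have "(\<Prod>i\<in>set J. measure \<mu> (B J i)) = (\<Prod>k<n. measure \<mu> (B J (J ! k)))"
        by (rule prod.reindex_bij_betw[OF bij[OF J], symmetric])
      also have "\<dots> = (\<Prod>k<n. measure \<mu> (A k - {0}))" using Bnth[OF J] by simp
      finally show ?thesis
        by (simp add: emeasure_eq_measure ennreal_mult[symmetric] prod_nonneg q_def mult.commute)
    qed
    have Eiff: "\<omega> \<in> E J \<longleftrightarrow> (\<forall>k<n. enumerate (T \<omega>) k = J ! k \<and> X (J ! k) \<omega> \<in> A k)"
      if J: "J \<in> I" and \<omega>: "\<omega> \<in> space M" "infinite (T \<omega>)" for J \<omega>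
    proof -
      have Jne: "J \<noteq> []" using J n by (auto simp: I_def)
      have len: "length J = n" using J by (simp add: I_def)
      have sub: "set J \<subseteq> {..last J}"
        using J by (intro set_subset_atMost_last) (simp add: I_def strict_sorted_iff)
      have "\<omega> \<in> E J \<longleftrightarrow> (\<forall>i\<le>last J. X i \<omega> \<in> B J i)" unfolding E_def using \<omega> by auto
      also have "\<dots> \<longleftrightarrow> T \<omega> \<inter> {..last J} = set J \<and> (\<forall>k<n. X (J ! k) \<omega> \<in> A k)"
      proof safe
        assume H: "\<forall>i\<le>last J. X i \<omega> \<in> B J i"
        { fix i assume "i \<in> T \<omega>" "i \<le> last J" then show "i \<in> set J"
            using H[rule_format, of i] by (auto simp: B_def T_def split: if_splits) }
        { fix i assume i: "i \<in> set J"
          then show "i \<in> T \<omega>"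
            using H[rule_format, of i] sub by (auto simp: B_def T_def split: if_splits) }
        { fix i assume i: "i \<in> set J" then show "i \<le> last J" using sub by auto }
        { fix k assume k: "k < n"
          then have "J ! k \<le> last J" using set_mp[OF sub nth_mem[of k J]] len by simp
          then show "X (J ! k) \<omega> \<in> A k" using H Bnth[OF J k] by auto }
      next
        fix i assume H: "T \<omega> \<inter> {..last J} = set J" "\<forall>k<n. X (J ! k) \<omega> \<in> A k" and i: "i \<le> last J"
        show "X i \<omega> \<in> B J i"
        proof (cases "i \<in> set J")
          case True
          then obtain k where k: "k < n" "i = J ! k" using len by (auto simp: in_set_conv_nth)
          have "i \<in> T \<omega>" using True H by auto
          then show ?thesis using k Bnth[OF J, of k] H by (auto simp: T_def)
        next
          case False
          then have "i \<notin> T \<omega>" using H i by auto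
          then show ?thesis using False by (simp add: B_def T_def)
        qed
      qed
      also have "T \<omega> \<inter> {..last J} = set J \<longleftrightarrow> (\<forall>k<n. enumerate (T \<omega>) k = J ! k)"
        using enumerate_eq_nth_iff[OF \<omega>(2), of J] J Jne len by (simp add: I_def)
      finally show ?thesis by auto
    qed
    \<comment> \<open>The pieces are cut down to outcomes with infinitely many nonzero terms. There
      \<open>enumerate\<close> really lists the positions, so different lists give disjoint events;
      the part cut away is null.\<close>
    define E' where "E' J = {\<omega>\<in>E J. infinite (T \<omega>)}" for J
    have [measurable]: "(\<lambda>\<omega>. i \<in> T \<omega>) \<in> measurable M (count_space UNIV)" for i unfolding T_def by simp
    have Tm[measurable]: "Measurable.pred M (\<lambda>\<omega>. infinite (T \<omega>))"
      unfolding infinite_nat_iff_unbounded_le by measurable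
    have E's: "E' J \<in> events" if "J \<in> I" for J
    proof -
      have "E' J = E J \<inter> {\<omega>\<in>space M. infinite (T \<omega>)}"
        unfolding E'_def E_def by auto
      moreover have "{\<omega>\<in>space M. infinite (T \<omega>)} \<in> events" by measurable
      ultimately show ?thesis using Em[OF that] by simp
    qed
    have EE': "emeasure M (E' J) = emeasure M (E J)" if "J \<in> I" for J
      using inf by (intro emeasure_eq_AE Em E's that) (auto simp: E'_def)
    have mem: "map (enumerate (T \<omega>)) [0..<n] \<in> I" if "infinite (T \<omega>)" for \<omega>
      unfolding I_def using that by (auto simp: sorted_wrt_iff_nth_less)
    have "emeasure M {\<omega>\<in>space M. \<forall>k<n. nonzero_obs X k \<omega> \<in> A k} = emeasure M (\<Union>J\<in>I. E' J)"
    proof (rule emeasure_eq_AE)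
      show "AE \<omega> in M. \<omega> \<in> {\<omega>\<in>space M. \<forall>k<n. nonzero_obs X k \<omega> \<in> A k} \<longleftrightarrow> \<omega> \<in> (\<Union>J\<in>I. E' J)"
        using inf AE_space
      proof eventually_elim
        case (elim \<omega>)
        show ?case
        proof
          assume "\<omega> \<in> {\<omega>\<in>space M. \<forall>k<n. nonzero_obs X k \<omega> \<in> A k}"
          then have "\<omega> \<in> E (map (enumerate (T \<omega>)) [0..<n])"
            using Eiff[OF mem[OF elim(1)] elim(2) elim(1)] by (auto simp: nonzero_obs_def T_def)
          then show "\<omega> \<in> (\<Union>J\<in>I. E' J)" using mem elim by (auto simp: E'_def)
        next
          assume "\<omega> \<in> (\<Union>J\<in>I. E' J)"
          then obtain J where "J \<in> I" "\<omega> \<in> E J" by (auto simp: E'_def)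
          then show "\<omega> \<in> {\<omega>\<in>space M. \<forall>k<n. nonzero_obs X k \<omega> \<in> A k}"
            using Eiff[OF _ elim(2) elim(1), of J] elim by (auto simp: nonzero_obs_def T_def)
        qed
      qed
      show "(\<Union>J\<in>I. E' J) \<in> events" using E's by (intro sets.countable_UN'') auto
    qed measurable
    also have "\<dots> = (\<integral>\<^sup>+J. emeasure M (E' J) \<partial>count_space I)"
    proof (rule emeasure_UN_countable)
      show "disjoint_family_on E' I"
        unfolding disjoint_family_on_def
      proof (intro ballI impI)
        fix J K assume JK: "J \<in> I" "K \<in> I" "J \<noteq> K"
        show "E' J \<inter> E' K = {}"
        proof (rule ccontr)
          assume "E' J \<inter> E' K \<noteq> {}"
          then obtain \<omega> where \<omega>: "\<omega> \<in> E J" "\<omega> \<in> E K" "infinite (T \<omega>)" by (auto simp: E'_def)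
          have "\<omega> \<in> space M" using \<omega> unfolding E_def by auto
          then have "J = K" using Eiff[OF JK(1) _ \<omega>(3)] Eiff[OF JK(2) _ \<omega>(3)] \<omega> JK
            by (intro nth_equalityI) (auto simp: I_def)
          then show False using JK by simp
        qed
      qed
    qed (use E's in auto)
    also have "\<dots> = (\<integral>\<^sup>+J. ennreal (\<Prod>k<n. measure \<mu> (A k - {0})) *
        ennreal (q ^ (card ({..last J} - set J))) \<partial>count_space I)"
      by (intro nn_integral_cong) (simp add: EE' PE)
    also have "\<dots> = ennreal (\<Prod>k<n. measure \<mu> (A k - {0})) * C"
      unfolding C_def by (rule nn_integral_cmult) simp
    finally show ?thesis .
  qed
  have compl: "measure \<mu> (UNIV - {0}) = 1 - q"
    using \<mu>.prob_compl[of "{0}"] by (simp add: q_def sets\<mu> space\<mu>)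
  \<comment> \<open>With every \<open>A k\<close> equal to the whole line the event is certain,
    which determines \<open>C\<close>.\<close>
  have "1 = ennreal ((1 - q) ^ n) * C"
    using main[of "\<lambda>_. UNIV"] by (simp add: compl emeasure_space_1)
  moreover have q1: "q < 1" using assms(3) by (simp add: q_def)
  ultimately have C: "C = ennreal (1 / (1 - q) ^ n)"
    by (cases C) (auto simp: ennreal_mult'[symmetric] ennreal_mult_top field_simps
        simp flip: ennreal_1)
  have "emeasure M {\<omega>\<in>space M. \<forall>k<n. nonzero_obs X k \<omega> \<in> A k}
     = ennreal (\<Prod>k<n. measure \<mu> (A k - {0}) / (1 - q))"
    using main[of A, OF assms(4)] C q1
    by (simp add: ennreal_mult[symmetric] prod_nonneg prod_dividef)
  then show ?thesis
    unfolding q_def[symmetric] using q1 by (simp add: emeasure_eq_measure prod_nonneg)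
qed

text \<open>Both claims come from the product formula for an arbitrary finite index set; a single
  index gives the marginal law, namely \<open>\<mu>\<close> conditioned on being nonzero.\<close>

lemma (in prob_space) nonzero_obs_iid:
  fixes X :: "nat \<Rightarrow> 'a \<Rightarrow> real"
  assumes indep: "indep_vars (\<lambda>_. borel) X UNIV"
    and dist: "\<And>i. distr M borel (X i) = \<mu>"
    and q: "measure \<mu> {0} < 1"
  shows "indep_vars (\<lambda>_. borel) (nonzero_obs X) UNIV"
    and "A \<in> sets borel \<Longrightarrow>
      measure (distr M borel (nonzero_obs X k)) A = measure \<mu> (A - {0}) / (1 - measure \<mu> {0})"
proof -
  have rv[measurable]: "X i \<in> borel_measurable M" for i
    using indep unfolding indep_vars_def by auto
  have rvZ[measurable]: "nonzero_obs X k \<in> borel_measurable M" for k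
    by (rule measurable_nonzero_obs) simp
  interpret \<mu>: prob_space \<mu> unfolding dist[of 0, symmetric] by (rule prob_space_distr) simp
  have sets\<mu>: "sets \<mu> = sets borel" unfolding dist[of 0, symmetric] by simp
  have space\<mu>: "space \<mu> = UNIV" unfolding dist[of 0, symmetric] by simp
  have one: "measure \<mu> (UNIV - {0}) / (1 - measure \<mu> {0}) = 1"
    using \<mu>.prob_compl[of "{0}"] q by (simp add: sets\<mu> space\<mu>)
  have joint: "prob (\<Inter>k\<in>J. nonzero_obs X k -` A k \<inter> space M)
      = (\<Prod>k\<in>J. measure \<mu> (A k - {0}) / (1 - measure \<mu> {0}))"
    if J: "finite J" "J \<noteq> {}" and A: "\<And>k. k \<in> J \<Longrightarrow> A k \<in> sets borel" for J A
  proof -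
    define n where "n = Suc (Max J)"
    \<comment> \<open>Indices below \<open>n\<close> outside \<open>J\<close> are padded with the
      whole line, whose factor in the product is 1.\<close>
    define B where "B k = (if k \<in> J then A k else UNIV)" for k
    have JL: "J \<subseteq> {..<n}" using J by (auto simp: n_def less_Suc_eq_le)
    have "(\<Inter>k\<in>J. nonzero_obs X k -` A k \<inter> space M) = {\<omega>\<in>space M. \<forall>k<n. nonzero_obs X k \<omega> \<in> B k}"
      using J JL by (auto simp: B_def)
    also have "prob \<dots> = (\<Prod>k<n. measure \<mu> (B k - {0}) / (1 - measure \<mu> {0}))"
      by (rule prob_nonzero_obs[OF indep dist q]) (use A in \<open>auto simp: B_def n_def\<close>)
    also have "\<dots> = (\<Prod>k\<in>J. measure \<mu> (B k - {0}) / (1 - measure \<mu> {0}))"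
      by (rule prod.mono_neutral_right) (use JL one in \<open>auto simp: B_def\<close>)
    finally show ?thesis by (simp add: B_def)
  qed
  show "measure (distr M borel (nonzero_obs X k)) A = measure \<mu> (A - {0}) / (1 - measure \<mu> {0})"
    if "A \<in> sets borel" for A k
    using joint[of "{k}" "\<lambda>_. A"] that by (simp add: measure_distr)
  show "indep_vars (\<lambda>_. borel) (nonzero_obs X) UNIV"
    unfolding indep_vars_def2
  proof (intro conjI ballI indep_setsI)
    fix A J assume J: "J \<noteq> {}" "J \<subseteq> (UNIV :: nat set)" "finite J"
      and A: "\<forall>j\<in>J. A j \<in> {nonzero_obs X j -` A \<inter> space M |A. A \<in> sets borel}"
    then have "\<forall>j\<in>J. \<exists>B. A j = nonzero_obs X j -` B \<inter> space M \<and> B \<in> sets borel" by auto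
    from bchoice[OF this] obtain B where B: "\<And>j. j \<in> J \<Longrightarrow> A j = nonzero_obs X j -` B j \<inter> space M"
       "\<And>j. j \<in> J \<Longrightarrow> B j \<in> sets borel" by auto
    have "prob (\<Inter>j\<in>J. A j) = prob (\<Inter>k\<in>J. nonzero_obs X k -` B k \<inter> space M)"
      using B by (intro arg_cong[where f=prob]) auto
    also have "\<dots> = (\<Prod>k\<in>J. measure \<mu> (B k - {0}) / (1 - measure \<mu> {0}))"
      using J B by (intro joint) auto
    also have "\<dots> = (\<Prod>k\<in>J. prob (A k))"
      using joint[of "{_}" B] B by (intro prod.cong) (auto simp: )
    finally show "prob (\<Inter>j\<in>J. A j) = (\<Prod>j\<in>J. prob (A j))" .
  qed auto
qed

section \<open>Distinguished logarithms and Fourier transforms\<close>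

lemma fourier_eq_integral_density:
  assumes [measurable]: "v \<in> borel_measurable borel" and "\<And>y. v y \<ge> 0"
  shows "fourier v t = (CLINT y|density lborel (\<lambda>y. ennreal (v y)). iexp (t * y))"
  unfolding fourier_def using assms(2)
  by (subst integral_density) (auto simp: scaleR_conv_of_real mult.commute)

lemma cmod_exp_minus_one_le: "cmod (exp z - 1) \<le> cmod z * exp (cmod z)"
proof -
  have "cmod (exp z - 1) \<le> exp \<bar>Re z\<bar> * cmod z"
    using Taylor_exp[of z 0] by simp
  also have "\<dots> \<le> exp (cmod z) * cmod z"
    by (intro mult_right_mono) (auto simp: abs_Re_le_cmod)
  finally show ?thesis by (simp add: mult.commute)
qed

text \<open>Fubini in the only form needed below: against a probability measure, a majorant
  depending on \<open>t\<close> alone is integrable on the product.\<close>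

lemma (in prob_space) integral_swap_dominated:
  fixes F :: "'b::euclidean_space \<Rightarrow> 'a \<Rightarrow> 'c::{banach, second_countable_topology}"
  assumes F[measurable]: "(\<lambda>p. F (fst p) (snd p)) \<in> borel_measurable (lborel \<Otimes>\<^sub>M M)"
    and b: "integrable lborel b" and le: "\<And>t \<omega>. \<omega> \<in> space M \<Longrightarrow> norm (F t \<omega>) \<le> b t"
  shows "(\<integral>\<omega>. (\<integral>t. F t \<omega> \<partial>lborel) \<partial>M) = (\<integral>t. (\<integral>\<omega>. F t \<omega> \<partial>M) \<partial>lborel)"
    and "integrable lborel (\<lambda>t. \<integral>\<omega>. F t \<omega> \<partial>M)"
    and "integrable M (\<lambda>\<omega>. \<integral>t. F t \<omega> \<partial>lborel)"
proof -
  interpret pair_sigma_finite lborel M ..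
  have Fm: "F t \<in> borel_measurable M" for t
    using measurable_compose[OF measurable_Pair1'[of t lborel M] F] by simp
  have i2: "integrable M (F t)" for t
    using le Fm by (intro integrable_const_bound[where B="b t"]) auto
  have "integrable (lborel \<Otimes>\<^sub>M M) (\<lambda>p. F (fst p) (snd p))"
  proof (rule Fubini_integrable[OF F])
    show "integrable lborel (\<lambda>t. LINT \<omega>|M. norm (F (fst (t, \<omega>)) (snd (t, \<omega>))))"
    proof (rule Bochner_Integration.integrable_bound[OF b])
      show "AE t in lborel. norm (LINT \<omega>|M. norm (F (fst (t, \<omega>)) (snd (t, \<omega>)))) \<le> norm (b t)"
      proof (rule AE_I2)
        fix t
        have "(LINT \<omega>|M. norm (F t \<omega>)) \<le> (LINT \<omega>|M. b t)"
          by (rule integral_mono) (use le i2 in auto)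
        then show "norm (LINT \<omega>|M. norm (F (fst (t, \<omega>)) (snd (t, \<omega>)))) \<le> norm (b t)"
          by (simp add: prob_space)
      qed
    qed measurable
    show "AE t in lborel. integrable M (\<lambda>\<omega>. F (fst (t, \<omega>)) (snd (t, \<omega>)))" using i2 by simp
  qed
  then have int: "integrable (lborel \<Otimes>\<^sub>M M) (case_prod F)" by (simp add: case_prod_beta')
  show "(\<integral>\<omega>. (\<integral>t. F t \<omega> \<partial>lborel) \<partial>M) = (\<integral>t. (\<integral>\<omega>. F t \<omega> \<partial>M) \<partial>lborel)"
    by (rule Fubini_integral[OF int])
  show "integrable lborel (\<lambda>t. \<integral>\<omega>. F t \<omega> \<partial>M)"
    using integrable_fst'[OF int] by simp
  show "integrable M (\<lambda>\<omega>. \<integral>t. F t \<omega> \<partial>lborel)"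
    using integrable_snd[OF int] by simp
qed

text \<open>The difference of two continuous logarithms takes values in the multiples of 2 pi i, a
  discrete set, so on the connected line it is constant.\<close>

lemma continuous_log_unique:
  fixes L L' :: "real \<Rightarrow> complex"
  assumes "continuous_on UNIV L" "continuous_on UNIV L'"
    and "\<And>t. exp (L t) = exp (L' t)" and "L 0 = L' 0"
  shows "L = L'"
proof -
  have "(\<lambda>t. L t - L' t) constant_on UNIV"
  proof (rule continuous_discrete_range_constant)
    show "continuous_on UNIV (\<lambda>t. L t - L' t)" by (intro continuous_intros assms)
    show "\<exists>e>0. \<forall>y. y \<in> UNIV \<and> L y - L' y \<noteq> L x - L' x \<longrightarrow> e \<le> norm (L y - L' y - (L x - L' x))" for x
    proof (intro exI[of _ "2 * pi"] conjI allI impI)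
      fix y assume *: "y \<in> UNIV \<and> L y - L' y \<noteq> L x - L' x"
      have "exp (L y - L' y) = exp (L x - L' x)" by (simp add: exp_diff assms)
      then have "\<not> \<bar>Im (L y - L' y) - Im (L x - L' x)\<bar> < 2 * pi"
        using exp_complex_eqI * by blast
      moreover have "\<bar>Im (L y - L' y - (L x - L' x))\<bar> \<le> norm (L y - L' y - (L x - L' x))"
        by (rule abs_Im_le_cmod)
      ultimately show "2 * pi \<le> norm (L y - L' y - (L x - L' x))" by (simp only: minus_complex.simps(2))
    qed simp
  qed simp
  then obtain c where c: "\<And>t. L t - L' t = c" unfolding constant_on_def by auto
  then have "c = 0" using c[of 0] assms(4) by simp
  then show ?thesis using c by auto
qed

lemma distinguished_log_eqI:
  assumes "continuous_on UNIV L" "\<And>t. exp (L t) = \<psi> t" "L 0 = complex_of_real (ln (Re (\<psi> 0)))"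
  shows "distinguished_log \<psi> = L"
  unfolding distinguished_log_def
  by (rule the_equality) (use assms in \<open>auto intro!: continuous_log_unique\<close>)

text \<open>Integrating the logarithmic derivative gives an explicit formula for an object defined
  by a description operator, so that its measurable dependence on parameters can be seen. Rescaling
  to the fixed interval [0,1] avoids separate treatment of negative \<open>t\<close>.\<close>

lemma distinguished_log_eq_integral:
  fixes \<psi> \<psi>' :: "real \<Rightarrow> complex"
  assumes der: "\<And>t. (\<psi> has_vector_derivative \<psi>' t) (at t)" and cont: "continuous_on UNIV \<psi>'"
    and nz: "\<And>t. \<psi> t \<noteq> 0" and r: "\<psi> 0 = complex_of_real r" "r > 0"
  shows "distinguished_log \<psi> t = of_real (ln r) + (LINT s:{0..1}|lborel. t *\<^sub>R (\<psi>' (t * s) / \<psi> (t * s)))"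
proof -
  have c\<psi>: "continuous_on UNIV \<psi>"
    using der by (meson continuous_at_imp_continuous_on has_vector_derivative_continuous)
  have cq: "continuous_on UNIV (\<lambda>t. \<psi>' t / \<psi> t)"
    by (intro continuous_intros cont c\<psi>) (use nz in auto)
  obtain G where G: "\<And>t. (G has_vector_derivative (\<psi>' t / \<psi> t)) (at t)"
    using einterval_antiderivative[of "-\<infinity>" "\<infinity>" "\<lambda>t. \<psi>' t / \<psi> t"] cq
    by (auto simp: continuous_on_eq_continuous_at)
  define L where "L t = of_real (ln r) + (G t - G 0)" for t
  have L': "(L has_vector_derivative (\<psi>' t / \<psi> t)) (at t)" for t
    unfolding L_def by (auto intro!: derivative_eq_intros G)
  have cL: "continuous_on UNIV L"
    using L' by (meson continuous_at_imp_continuous_on has_vector_derivative_continuous)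
  have eL: "((\<lambda>t. exp (- L t)) has_vector_derivative (- (\<psi>' t / \<psi> t) * exp (- L t))) (at t)" for t
    using field_vector_diff_chain_at[OF has_vector_derivative_minus[OF L'], of exp "exp (- L t)" t]
    by (simp add: o_def)
  have "((\<lambda>t. \<psi> t * exp (- L t)) has_vector_derivative 0) (at t)" for t
    using has_vector_derivative_mult[OF der eL, of t] nz[of t] by simp
  then have "\<exists>c. \<forall>t\<in>UNIV. \<psi> t * exp (- L t) = c"
    by (intro has_derivative_zero_constant) (auto simp: has_vector_derivative_def)
  then obtain c where c: "\<And>t. \<psi> t * exp (- L t) = c" by auto
  have "c = 1" using c[of 0] r by (simp add: L_def exp_minus exp_of_real)
  then have e: "exp (L t) = \<psi> t" for t using c[of t] by (simp add: exp_minus field_simps)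
  have "distinguished_log \<psi> = L"
    by (rule distinguished_log_eqI[OF cL e]) (simp add: L_def r)
  moreover have "(LINT s:{0..1}|lborel. t *\<^sub>R (\<psi>' (t * s) / \<psi> (t * s))) = G t - G 0"
  proof -
    have "(LBINT s=0..1. t *\<^sub>R (\<psi>' (t * s) / \<psi> (t * s))) = G (t * 1) - G (t * 0)"
    proof (rule interval_integral_FTC_finite[where F="\<lambda>s. G (t * s)" and a=0 and b=1, simplified zero_ereal_def[symmetric] one_ereal_def[symmetric]])
      show "continuous_on {min 0 1..max 0 1} (\<lambda>s. t *\<^sub>R (\<psi>' (t * s) / \<psi> (t * s)))"
        by (intro continuous_intros continuous_on_compose2[OF cont] continuous_on_compose2[OF c\<psi>]) (use nz in auto)
      fix s :: real
      have "((\<lambda>s. t * s) has_vector_derivative t) (at s)" by (auto intro!: derivative_eq_intros)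
      from vector_diff_chain_at[OF this G]
      show "((\<lambda>s. G (t * s)) has_vector_derivative t *\<^sub>R (\<psi>' (t * s) / \<psi> (t * s))) (at s within {min 0 1..max 0 1})"
        by (simp add: o_def has_vector_derivative_at_within)
    qed
    then show ?thesis by (simp add: interval_integral_Icc zero_ereal_def one_ereal_def)
  qed
  ultimately show ?thesis by (simp add: L_def)
qed

section \<open>Measurability of the estimator as a function of the sample\<close>

lemma iexp_has_vector_derivative:
  "((\<lambda>t. iexp (t * z)) has_vector_derivative (\<i> * of_real z * iexp (t * z))) (at t)"
proof -
  have "((\<lambda>u. exp (\<i> * (u * of_real z))) has_field_derivative (\<i> * of_real z * iexp (t * z))) (at (of_real t))"
    by (auto intro!: derivative_eq_intros simp: mult_ac)
  from has_vector_derivative_real_field[OF this] show ?thesis by simp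
qed

text \<open>Two features hide measurability: nonvanishing is quantified over uncountably many
  \<open>t\<close>, and the logarithm is given by \<open>THE\<close>. The first is reduced to
  rational \<open>t\<close>, the second is replaced by the integral of the logarithmic derivative,
  which is where continuous differentiability of \<open>fourier w\<close> enters.\<close>

lemma measurable_f_nh:
  fixes Z :: "nat \<Rightarrow> 'a \<Rightarrow> real" and M :: "'a measure"
  assumes Z[measurable]: "\<And>k. Z k \<in> borel_measurable M"
    and lam: "lam > 0" and h: "h > 0" and n: "n \<ge> 1"
    and C1: "fourier w C1_differentiable_on UNIV" and w0: "fourier w 0 = 1"
    and supp: "\<And>t. \<bar>t\<bar> > 1 \<Longrightarrow> fourier w t = 0"
  shows "(\<lambda>\<omega>. f_nh lam w h n (\<lambda>k. Z k \<omega>) x) \<in> borel_measurable M"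
proof -
  obtain D where D: "\<And>t. (fourier w has_vector_derivative D t) (at t)" and cD: "continuous_on UNIV D"
    using C1 unfolding C1_differentiable_on_def by auto
  have cw: "continuous_on UNIV (fourier w)"
    using D by (meson continuous_at_imp_continuous_on has_vector_derivative_continuous)
  have [measurable]: "D \<in> borel_measurable borel" "fourier w \<in> borel_measurable borel"
    using cD cw by (auto intro: borel_measurable_continuous_onI)
  define \<psi> where "\<psi> \<omega> t = log_arg lam w h n (\<lambda>k. Z k \<omega>) t" for \<omega> t
  define e' where "e' \<omega> t = (1 / of_nat n) * (\<Sum>j<n. \<i> * of_real (Z j \<omega>) * iexp (t * Z j \<omega>))" for \<omega> t
  define \<psi>' where "\<psi>' \<omega> t = of_real (exp lam - 1) * emp_cf n (\<lambda>k. Z k \<omega>) t * (h *\<^sub>R D (h * t))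
      + of_real (exp lam - 1) * e' \<omega> t * fourier w (h * t)" for \<omega> t
  have de: "((\<lambda>t. of_real (exp lam - 1) * emp_cf n (\<lambda>k. Z k \<omega>) t) has_vector_derivative of_real (exp lam - 1) * e' \<omega> t) (at t)" for \<omega> t
    unfolding emp_cf_def e'_def
    by (intro has_vector_derivative_mult_right has_vector_derivative_sum iexp_has_vector_derivative)
  have dw: "((\<lambda>t. fourier w (h * t)) has_vector_derivative h *\<^sub>R D (h * t)) (at t)" for t
  proof -
    have "((\<lambda>s. h * s) has_vector_derivative h) (at t)" by (auto intro!: derivative_eq_intros)
    from vector_diff_chain_at[OF this D] show ?thesis by (simp add: o_def)
  qed
  have d\<psi>: "(\<psi> \<omega> has_vector_derivative \<psi>' \<omega> t) (at t)" for \<omega> t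
    using has_vector_derivative_add[OF has_vector_derivative_mult[OF de[of \<omega> t] dw[of t]] has_vector_derivative_const[of 1]]
    unfolding \<psi>_def[abs_def] \<psi>'_def log_arg_def by simp
  have c\<psi>: "continuous_on UNIV (\<psi> \<omega>)" for \<omega>
    using d\<psi> by (meson continuous_at_imp_continuous_on has_vector_derivative_continuous)
  have c\<psi>': "continuous_on UNIV (\<psi>' \<omega>)" for \<omega>
    unfolding \<psi>'_def e'_def emp_cf_def
    by (intro continuous_intros continuous_on_compose2[OF cD] continuous_on_compose2[OF cw]) auto
  have \<psi>0: "\<psi> \<omega> 0 = of_real (exp lam)" for \<omega>
    unfolding \<psi>_def log_arg_def emp_cf_def using n w0 by simp
  have jm: "(\<lambda>p. \<psi> (fst p) (snd p)) \<in> borel_measurable (M \<Otimes>\<^sub>M borel)"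
      "(\<lambda>p. \<psi>' (fst p) (snd p)) \<in> borel_measurable (M \<Otimes>\<^sub>M borel)"
    unfolding \<psi>_def \<psi>'_def log_arg_def emp_cf_def e'_def by measurable
  have [measurable (raw)]: "(\<lambda>x. \<psi> (F x) (u x)) \<in> borel_measurable K" "(\<lambda>x. \<psi>' (F x) (u x)) \<in> borel_measurable K"
    if F: "F \<in> measurable K M" and u: "u \<in> borel_measurable K" for F u and K :: "'k measure"
    using measurable_compose[OF measurable_Pair[OF F u] jm(1)] measurable_compose[OF measurable_Pair[OF F u] jm(2)]
    by simp_all
  have \<psi>m: "(\<lambda>\<omega>. \<psi> \<omega> t) \<in> borel_measurable M" for t
    unfolding \<psi>_def log_arg_def emp_cf_def by measurable
  \<comment> \<open>Beyond 1/h the function equals 1 and the remaining interval is compact, so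
    nonvanishing is the same as being bounded away from 0. By continuity that bound can be tested on
    the rationals.\<close>
  have iff: "(\<forall>t. \<psi> \<omega> t \<noteq> 0) \<longleftrightarrow> (\<exists>k::nat. \<forall>r::rat. cmod (\<psi> \<omega> (of_rat r)) \<ge> 1 / real (Suc k))" for \<omega>
  proof
    assume nz: "\<forall>t. \<psi> \<omega> t \<noteq> 0"
    have "compact {-(1/h)..1/h}" "{-(1/h)..1/h} \<noteq> {}" using h by auto
    moreover have "continuous_on {-(1/h)..1/h} (\<lambda>t. cmod (\<psi> \<omega> t))"
      by (intro continuous_intros continuous_on_subset[OF c\<psi>]) auto
    ultimately obtain u where u: "\<And>t. t \<in> {-(1/h)..1/h} \<Longrightarrow> cmod (\<psi> \<omega> u) \<le> cmod (\<psi> \<omega> t)"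
      using continuous_attains_inf by metis
    define m where "m = min 1 (cmod (\<psi> \<omega> u))"
    have "m > 0" using nz by (simp add: m_def)
    then obtain k where k: "1 / real (Suc k) < m" using nat_approx_posE by blast
    have "m \<le> cmod (\<psi> \<omega> t)" for t
    proof (cases "t \<in> {-(1/h)..1/h}")
      case True then show ?thesis using u[OF True] by (simp add: m_def)
    next
      case False
      then have "1 / h < \<bar>t\<bar>" by auto
      then have "\<bar>h * t\<bar> > 1" using h by (simp add: abs_mult field_simps)
      then have "\<psi> \<omega> t = 1" by (simp add: \<psi>_def log_arg_def supp)
      then show ?thesis by (simp add: m_def)
    qed
    then show "\<exists>k::nat. \<forall>r::rat. cmod (\<psi> \<omega> (of_rat r)) \<ge> 1 / real (Suc k)"
      using k by (meson less_eq_real_def order_trans)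
  next
    assume "\<exists>k::nat. \<forall>r::rat. cmod (\<psi> \<omega> (of_rat r)) \<ge> 1 / real (Suc k)"
    then obtain k :: nat where k: "\<And>r::rat. cmod (\<psi> \<omega> (of_rat r)) \<ge> 1 / real (Suc k)" by auto
    have "t \<in> {t. 1 / real (Suc k) \<le> cmod (\<psi> \<omega> t)}" for t
    proof -
      have "closed {t. 1 / real (Suc k) \<le> cmod (\<psi> \<omega> t)}"
        by (intro closed_Collect_le continuous_intros c\<psi>)
      moreover have "\<rat> \<subseteq> {t. 1 / real (Suc k) \<le> cmod (\<psi> \<omega> t)}"
        using k by (auto simp: Rats_def)
      ultimately have "closure \<rat> \<subseteq> {t. 1 / real (Suc k) \<le> cmod (\<psi> \<omega> t)}" by (intro closure_minimal)
      moreover have "t \<in> closure \<rat>"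
        unfolding closure_approachable
      proof (intro allI impI)
        fix e :: real assume "e > 0"
        then obtain q where "t < of_rat q" "of_rat q < t + e" using of_rat_dense[of t "t + e"] by auto
        then show "\<exists>y\<in>\<rat>. dist y t < e" by (intro bexI[of _ "of_rat q"]) (auto simp: dist_real_def)
      qed
      ultimately show ?thesis by auto
    qed
    then have "0 < cmod (\<psi> \<omega> t)" for t
      using order_less_le_trans[of 0 "1 / real (Suc k)" "cmod (\<psi> \<omega> t)"] by simp
    then show "\<forall>t. \<psi> \<omega> t \<noteq> 0" by simp
  qed
  have [measurable]: "Measurable.pred M (\<lambda>\<omega>. \<forall>t. \<psi> \<omega> t \<noteq> 0)"
    unfolding iff using \<psi>m by measurable
  \<comment> \<open>At \<open>t = 0\<close> the logarithm is \<open>ln (exp lam) = lam\<close>, the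
    constant in front of the inner integral.\<close>
  have eq: "f_nh lam w h n (\<lambda>k. Z k \<omega>) x = (if \<forall>t. \<psi> \<omega> t \<noteq> 0 then
      Re (complex_of_real (1 / (2 * pi * lam)) *
               (LINT t:{- (1 / h)..1 / h}|lborel. iexp (- (t * x)) *
           (of_real lam + (LINT s:{0..1}|lborel. t *\<^sub>R (\<psi>' \<omega> (t * s) / \<psi> \<omega> (t * s)))))) else 0)" for \<omega>
  proof (cases "\<forall>t. \<psi> \<omega> t \<noteq> 0")
    case True
    have "distinguished_log (\<psi> \<omega>) t = of_real lam + (LINT s:{0..1}|lborel. t *\<^sub>R (\<psi>' \<omega> (t * s) / \<psi> \<omega> (t * s)))" for t
      using distinguished_log_eq_integral[OF d\<psi> c\<psi>' _ \<psi>0, of \<omega> t] True by simp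
    moreover have "log_arg lam w h n (\<lambda>k. Z k \<omega>) = \<psi> \<omega>" by (simp add: \<psi>_def[abs_def])
    ultimately show ?thesis using True by (simp add: f_nh_def)
  next
    case False
    then show ?thesis by (auto simp: f_nh_def \<psi>_def)
  qed
  have "(\<lambda>\<omega>. LINT t:{- (1 / h)..1 / h}|lborel. iexp (- (t * x)) *
           (of_real lam + (LINT s:{0..1}|lborel. t *\<^sub>R (\<psi>' \<omega> (t * s) / \<psi> \<omega> (t * s))))) \<in> borel_measurable M"
    unfolding set_lebesgue_integral_def by measurable
  then show ?thesis unfolding eq by measurable
qed

text \<open>The Riemann-Lebesgue lemma. Translating by \<open>pi / t\<close> changes the sign of the
  exponential, so twice the transform is the transform of \<open>g\<close> minus its translate, and
  translation is continuous in the L1 norm.\<close>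

lemma fourier_tendsto_0:
  assumes cont: "continuous_on UNIV g" and int: "integrable lborel g" and nn: "\<And>y. g y \<ge> 0"
  shows "(fourier g \<longlongrightarrow> 0) at_infinity"
proof -
  \<comment> \<open>The L1 modulus of continuity of \<open>g\<close>. All translates have the same
    norm, so pointwise convergence and Scheffe's lemma give its continuity at 0.\<close>
  define D where "D s = (LINT x|lborel. \<bar>g (s + x) - g x\<bar>)" for s
  have [measurable]: "g \<in> borel_measurable borel" by (rule borel_measurable_continuous_onI[OF cont])
  have ints: "integrable lborel (\<lambda>x. g (s + x))" for s
    using lborel_integrable_real_affine[OF int, of 1 s] by simp
  have D0: "(D \<longlongrightarrow> 0) (at 0)"
    unfolding tendsto_at_iff_sequentially
  proof (intro allI impI)
    fix X :: "nat \<Rightarrow> real" assume X: "\<forall>i. X i \<in> UNIV - {0}" "X \<longlonglongrightarrow> 0"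
    have "(\<lambda>n. \<integral>\<^sup>+ x. norm (g (X n + x) - g x) \<partial>lborel) \<longlonglongrightarrow> 0"
    proof (rule Scheffe_lemma1)
      show "AE x in lborel. (\<lambda>n. g (X n + x)) \<longlonglongrightarrow> g x"
      proof (rule AE_I2)
        fix x
        have "isCont g x" using cont by (simp add: continuous_on_eq_continuous_at)
        moreover have "(\<lambda>n. X n + x) \<longlonglongrightarrow> x" using tendsto_add[OF X(2) tendsto_const, of x] by simp
        ultimately show "(\<lambda>n. g (X n + x)) \<longlonglongrightarrow> g x" by (rule isCont_tendsto_compose)
      qed
      have "(\<integral>\<^sup>+ x. norm (g (X n + x)) \<partial>lborel) = (\<integral>\<^sup>+ x. norm (g x) \<partial>lborel)" for n
        by (subst (2) nn_integral_real_affine[where c=1 and t="X n"]) auto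
      then show "limsup (\<lambda>n. \<integral>\<^sup>+ x. norm (g (X n + x)) \<partial>lborel) \<le> (\<integral>\<^sup>+ x. norm (g x) \<partial>lborel)"
        by (simp add: Limsup_const)
    qed (use int ints in auto)
    moreover have "(\<integral>\<^sup>+ x. norm (g (s + x) - g x) \<partial>lborel) = ennreal (D s)" for s
      unfolding D_def real_norm_def by (rule nn_integral_eq_integral) (use int ints in auto)
    ultimately have "(\<lambda>n. ennreal (D (X n))) \<longlonglongrightarrow> ennreal 0" by simp
    then show "(D \<circ> X) \<longlonglongrightarrow> 0"
      unfolding o_def by (subst (asm) tendsto_ennreal_iff) (auto simp: D_def)
  qed
  have lim: "filterlim (\<lambda>t::real. pi / t) (at 0) at_infinity"
    unfolding filterlim_at
  proof
    show "\<forall>\<^sub>F t::real in at_infinity. pi / t \<in> UNIV \<and> pi / t \<noteq> 0"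
      unfolding eventually_at_infinity by (rule exI[of _ 1]) auto
    show "((\<lambda>t::real. pi / t) \<longlongrightarrow> 0) at_infinity"
      by (rule tendsto_divide_0[OF tendsto_const]) (rule filterlim_ident)
  qed
  have le: "cmod (fourier g t) \<le> D (pi / t)" if t: "t \<noteq> 0" for t
  proof -
    have i1: "integrable lborel (\<lambda>x. iexp (t * x) * complex_of_real (g x))"
      using int by (rule Bochner_Integration.integrable_bound) (auto simp: norm_mult)
    have i2: "integrable lborel (\<lambda>x. iexp (t * x) * complex_of_real (g (pi / t + x)))"
      using ints[of "pi / t"] by (rule Bochner_Integration.integrable_bound) (auto simp: norm_mult)
    have "fourier g t = (LINT x|lborel. iexp (t * (pi / t + 1 * x)) * complex_of_real (g (pi / t + 1 * x)))"
      unfolding fourier_def by (subst lborel_integral_real_affine[where c=1 and t="pi / t"]) auto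
    also have "\<dots> = (LINT x|lborel. - (iexp (t * x) * complex_of_real (g (pi / t + x))))"
    proof (intro Bochner_Integration.integral_cong refl)
      fix x :: real
      have "t * (pi / t + 1 * x) = pi + t * x" using t by (simp add: field_simps)
      then have "iexp (t * (pi / t + 1 * x)) = - iexp (t * x)"
        by (simp add: distrib_left exp_add)
      then show "iexp (t * (pi / t + 1 * x)) * complex_of_real (g (pi / t + 1 * x)) = - (iexp (t * x) * complex_of_real (g (pi / t + x)))"
        by simp
    qed
    finally have "2 * fourier g t = (LINT x|lborel. iexp (t * x) * complex_of_real (g x)) -
       (LINT x|lborel. iexp (t * x) * complex_of_real (g (pi / t + x)))"
      by (simp add: fourier_def)
    also have "\<dots> = (LINT x|lborel. iexp (t * x) * complex_of_real (g x - g (pi / t + x)))"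
      using i1 i2 by (simp add: right_diff_distrib)
    also have "cmod \<dots> \<le> (LINT x|lborel. cmod (iexp (t * x) * complex_of_real (g x - g (pi / t + x))))"
      by (rule integral_norm_bound)
    also have "\<dots> = D (pi / t)" unfolding D_def
      by (intro Bochner_Integration.integral_cong refl) (simp only: norm_mult norm_exp_i_times norm_of_real mult_1 abs_minus_commute)
    finally have "2 * cmod (fourier g t) \<le> D (pi / t)" by (simp add: norm_mult)
    then show ?thesis using norm_ge_zero[of "fourier g t"] by linarith
  qed
  show ?thesis
  proof (rule Lim_null_comparison)
    show "\<forall>\<^sub>F t in at_infinity. norm (fourier g t) \<le> D (pi / t)"
      unfolding eventually_at_infinity by (rule exI[of _ 1]) (auto intro!: le)
    show "((\<lambda>t. D (pi / t)) \<longlongrightarrow> 0) at_infinity"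
      using filterlim_compose[OF D0 lim] .
  qed
qed

text \<open>If the transform vanished identically, averaging it over a Gaussian frequency of
  standard deviation \<open>m\<close> would make the integral of \<open>r\<close> against a Gaussian
  of width 1/m vanish for all \<open>m\<close>. As \<open>m\<close> grows this weight concentrates
  at 0, forcing \<open>r 0 = 0\<close>.\<close>

lemma cos_transform_nonzero:
  fixes r :: "real \<Rightarrow> real"
  assumes cont: "continuous_on UNIV r" and r0: "r 0 \<noteq> 0"
  shows "\<exists>u. (LINT t:{-1..1}|lborel. cos (t * u) * r t) \<noteq> 0"
proof (rule ccontr)
  assume "\<not> ?thesis"
  then have z: "(LINT t:{-1..1}|lborel. cos (t * u) * r t) = 0" for u by auto
  let ?N = std_normal_distribution
  interpret N: real_distribution ?N by (rule real_dist_normal_dist)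
  have [measurable]: "r \<in> borel_measurable borel" by (rule borel_measurable_continuous_onI[OF cont])
  have "bounded (r ` {-1..1})"
    by (intro compact_imp_bounded compact_continuous_image continuous_on_subset[OF cont]) auto
  then obtain K where "\<forall>y\<in>r ` {-1..1}. norm y \<le> K" unfolding bounded_iff by blast
  then have K: "\<bar>r t\<bar> \<le> K" if "t \<in> {-1..1}" for t using that by simp
  have K0: "K \<ge> 0" using K[of 0] by simp
  have ck: "\<bar>cos a * r t\<bar> \<le> K" if "t \<in> {-1..1}" for a t
    using mult_mono[OF abs_cos_le_one[of a] K[OF that]] by (simp add: abs_mult)
  have cosN: "(LINT u|?N. cos (a * u)) = exp (- (a\<^sup>2) / 2)" for a
  proof -
    have "Re (char ?N a) = (LINT u|?N. Re (iexp (a * u)))"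
      unfolding char_def by (rule integral_Re[symmetric]) (auto intro!: N.integrable_const_bound[where B=1])
    then show ?thesis by (simp add: char_std_normal_distribution Re_exp)
  qed
  have ik: "integrable lborel (\<lambda>t. indicator {-1..1} t * (cos (t * a) * r t))" for a
  proof (rule Bochner_Integration.integrable_bound[where f="\<lambda>t. K * indicator {-1..1} t"])
    show "AE t in lborel. norm (indicator {-1..1} t * (cos (t * a) * r t)) \<le> norm (K * indicator {-1..1} t)"
      using ck K0 by (auto simp: indicator_def)
  qed auto
  \<comment> \<open>The cosine averaged over \<open>m\<close> times a standard normal variable is
    \<open>exp (- (t * m)\<^sup>2 / 2)\<close>; the substitution \<open>v = t * m\<close> then makes
    the Gaussian weight independent of \<open>m\<close>.\<close>
  have key: "(LINT v|lborel. indicator {-m..m} v * (r (v / m) * exp (- (v\<^sup>2) / 2))) = 0" if m: "m > 0" for m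
  proof -
    have "0 = (LINT u|?N. LINT t|lborel. indicator {-1..1} t * (cos (t * (m * u)) * r t))"
      using z unfolding set_lebesgue_integral_def by simp
    also have "\<dots> = (LINT t|lborel. LINT u|?N. indicator {-1..1} t * (cos (t * (m * u)) * r t))"
    proof (rule N.integral_swap_dominated[where b="\<lambda>t. K * indicator {-1..1} t"])
      show "integrable lborel (\<lambda>t. K * indicator {-1..1::real} t)" by simp
    qed (use ck K0 in \<open>auto simp: indicator_def\<close>)
    also have "\<dots> = (LINT t|lborel. indicator {-1..1} t * (r t * exp (- ((t * m)\<^sup>2) / 2)))"
    proof (intro Bochner_Integration.integral_cong refl)
      fix t :: real
      have "(LINT u|?N. indicator {-1..1} t * (cos (t * (m * u)) * r t)) = (LINT u|?N. (indicator {-1..1} t * r t) * cos ((t * m) * u))"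
        by (simp add: mult_ac)
      then show "(LINT u|?N. indicator {-1..1} t * (cos (t * (m * u)) * r t)) = indicator {-1..1} t * (r t * exp (- ((t * m)\<^sup>2) / 2))"
        by (simp add: cosN)
    qed
    also have "\<dots> = \<bar>1 / m\<bar> *\<^sub>R (LINT v|lborel. indicator {-1..1} (0 + 1 / m * v) * (r (0 + 1 / m * v) * exp (- (((0 + 1 / m * v) * m)\<^sup>2) / 2)))"
      by (rule lborel_integral_real_affine) (use m in simp)
    also have "(LINT v|lborel. indicator {-1..1} (0 + 1 / m * v) * (r (0 + 1 / m * v) * exp (- (((0 + 1 / m * v) * m)\<^sup>2) / 2)))
       = (LINT v|lborel. indicator {-m..m} v * (r (v / m) * exp (- (v\<^sup>2) / 2)))"
      using m by (intro Bochner_Integration.integral_cong refl) (auto simp: indicator_def field_simps)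
    finally show ?thesis using m by simp
  qed
  have ig: "integrable lborel (\<lambda>v::real. exp (- (v\<^sup>2) / 2))" and gv: "(LINT v|lborel. exp (- (v\<^sup>2) / 2 :: real)) > 0"
  proof -
    have "integrable lborel (\<lambda>v. sqrt (2 * pi) * std_normal_density v)" by simp
    then show "integrable lborel (\<lambda>v::real. exp (- (v\<^sup>2) / 2))"
      by (simp add: std_normal_density_def)
    have "(LINT v|lborel. sqrt (2 * pi) * std_normal_density v) = sqrt (2 * pi)" by simp
    then show "(LINT v|lborel. exp (- (v\<^sup>2) / 2 :: real)) > 0"
      by (simp add: std_normal_density_def)
  qed
  have "(\<lambda>n. LINT v|lborel. indicator {-(real (Suc n))..real (Suc n)} v * (r (v / real (Suc n)) * exp (- (v\<^sup>2) / 2)))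
     \<longlonglongrightarrow> (LINT v|lborel. r 0 * exp (- (v\<^sup>2) / 2))"
  proof (rule integral_dominated_convergence[where w="\<lambda>v. K * exp (- (v\<^sup>2) / 2)"])
    show "integrable lborel (\<lambda>v. K * exp (- (v\<^sup>2) / 2))" using ig by simp
    show "AE v in lborel. (\<lambda>n. indicator {-(real (Suc n))..real (Suc n)} v * (r (v / real (Suc n)) * exp (- (v\<^sup>2) / 2))) \<longlonglongrightarrow> r 0 * exp (- (v\<^sup>2) / 2)"
    proof (rule AE_I2)
      fix v :: real
      have "(\<lambda>n. v / real (Suc n)) \<longlonglongrightarrow> 0" by (intro LIMSEQ_Suc lim_const_over_n)
      then have "(\<lambda>n. r (v / real (Suc n))) \<longlonglongrightarrow> r 0"
        using cont by (intro isCont_tendsto_compose[of 0 r]) (auto simp: continuous_on_eq_continuous_at)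
      moreover have "\<forall>\<^sub>F n in sequentially. indicator {-(real (Suc n))..real (Suc n)} v = (1::real)"
        by (rule eventually_sequentiallyI[of "nat \<lceil>\<bar>v\<bar>\<rceil>"]) (auto simp: indicator_def)
      then have "(\<lambda>n. indicator {-(real (Suc n))..real (Suc n)} v) \<longlonglongrightarrow> (1::real)"
        by (rule tendsto_eventually)
      ultimately have "(\<lambda>n. indicator {-(real (Suc n))..real (Suc n)} v * (r (v / real (Suc n)) * exp (- (v\<^sup>2) / 2))) \<longlonglongrightarrow> 1 * (r 0 * exp (- (v\<^sup>2) / 2))"
        by (intro tendsto_intros)
      then show "(\<lambda>n. indicator {-(real (Suc n))..real (Suc n)} v * (r (v / real (Suc n)) * exp (- (v\<^sup>2) / 2))) \<longlonglongrightarrow> r 0 * exp (- (v\<^sup>2) / 2)" by simp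
    qed
    fix n
    show "AE v in lborel. norm (indicator {-(real (Suc n))..real (Suc n)} v * (r (v / real (Suc n)) * exp (- (v\<^sup>2) / 2))) \<le> K * exp (- (v\<^sup>2) / 2)"
    proof (rule AE_I2)
      fix v :: real
      show "norm (indicator {-(real (Suc n))..real (Suc n)} v * (r (v / real (Suc n)) * exp (- (v\<^sup>2) / 2))) \<le> K * exp (- (v\<^sup>2) / 2)"
      proof (cases "v \<in> {-(real (Suc n))..real (Suc n)}")
        case True
        then have "v / real (Suc n) \<in> {-1..1}" by (auto simp: field_simps)
        then show ?thesis using True K by (simp add: abs_mult)
      qed (use K0 in simp)
    qed
  qed auto
  moreover have "(LINT v|lborel. indicator {-(real (Suc n))..real (Suc n)} v * (r (v / real (Suc n)) * exp (- (v\<^sup>2) / 2))) = 0" for n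
    by (rule key) simp
  ultimately have "(LINT v|lborel. r 0 * exp (- (v\<^sup>2) / 2)) = 0"
    by (simp only: LIMSEQ_const_iff)
  then show False using r0 gv by simp
qed

section \<open>The compound Poisson law\<close>

lemma compound_poisson_prob:
  fixes P :: "'p measure" and N :: "'p \<Rightarrow> nat"
  assumes "prob_space P"
    and N_meas: "N \<in> measurable P (count_space UNIV)"
    and N_poisson: "distr P (count_space UNIV) N = measure_pmf (poisson_pmf lam)" and lam: "lam > 0"
  shows "measure P (N -` {k} \<inter> space P) = lam ^ k / fact k * exp (- lam)"
    and "measure P {\<omega>\<in>space P. N \<omega> > 0} = 1 - exp (- lam)"
proof -
  interpret prob_space P by fact
  have [measurable]: "N \<in> measurable P (count_space UNIV)" by fact
  show *: "measure P (N -` {k} \<inter> space P) = lam ^ k / fact k * exp (- lam)" for k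
  proof -
    have "measure P (N -` {k} \<inter> space P) = measure (distr P (count_space UNIV) N) {k}"
      by (subst measure_distr) auto
    also have "\<dots> = pmf (poisson_pmf lam) k" unfolding N_poisson by (simp add: pmf.rep_eq)
    finally show ?thesis using lam by simp
  qed
  have "measure P {\<omega>\<in>space P. N \<omega> > 0} = prob (space P - (N -` {0} \<inter> space P))"
    by (intro arg_cong[where f=prob]) auto
  also have "\<dots> = 1 - exp (- lam)" using *[of 0] by (subst prob_compl) auto
  finally show "measure P {\<omega>\<in>space P. N \<omega> > 0} = 1 - exp (- lam)" .
qed

lemma measurable_compound_sum:
  assumes [measurable]: "N \<in> measurable P (count_space UNIV)" "\<And>j. Y j \<in> borel_measurable P"
  shows "compound_sum N Y \<in> borel_measurable P"
proof -
  have "(\<lambda>\<omega>. (\<lambda>k \<omega>. \<Sum>j<k. Y j \<omega>) (N \<omega>) \<omega>) \<in> borel_measurable P"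
    by (rule measurable_compose_countable[where g=N]) measurable
  then show ?thesis unfolding compound_sum_def[abs_def] .
qed

text \<open>An empty sum is 0, and given \<open>N > 0\<close> the sum has a density and so no atom
  at 0. Hence up to a null event the sum is nonzero exactly when \<open>N > 0\<close>, and
  conditioning on either event gives the law with density \<open>g\<close>.\<close>

lemma compound_poisson_law:
  fixes P :: "'p measure" and N :: "'p \<Rightarrow> nat" and Y :: "nat \<Rightarrow> 'p \<Rightarrow> real"
  assumes "prob_space P" and lam: "lam > 0"
    and N_meas[measurable]: "N \<in> measurable P (count_space UNIV)"
    and N_poisson: "distr P (count_space UNIV) N = measure_pmf (poisson_pmf lam)"
    and Y_meas[measurable]: "\<And>j. Y j \<in> borel_measurable P"
    and g_nonneg: "\<And>y. g y \<ge> 0"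
    and g_density: "distributed (uniform_measure P {\<omega> \<in> space P. N \<omega> > 0}) lborel
                      (compound_sum N Y) (\<lambda>y. ennreal (g y))"
  defines "\<mu> \<equiv> distr P borel (compound_sum N Y)"
  shows "integrable lborel g" and "(LINT y|lborel. g y) = 1"
    and "measure \<mu> {0} = exp (- lam)"
    and "A \<in> sets borel \<Longrightarrow>
      measure \<mu> (A - {0}) / (1 - measure \<mu> {0}) = measure (density lborel (\<lambda>y. ennreal (g y))) A"
proof -
  interpret P: prob_space P by fact
  have Xm[measurable]: "compound_sum N Y \<in> borel_measurable P"
    by (rule measurable_compound_sum) auto
  interpret \<mu>: prob_space \<mu> unfolding \<mu>_def by (rule P.prob_space_distr) simp
  let ?S = "{\<omega> \<in> space P. N \<omega> > 0}"
  have S[measurable]: "?S \<in> sets P" by measurable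
  note pS = compound_poisson_prob(2)[OF assms(1) N_meas N_poisson lam]
  have p0: "0 < 1 - exp (- lam)" using lam by simp
  interpret U: prob_space "uniform_measure P ?S"
    using p0 pS by (intro prob_space_uniform_measure) (auto simp: P.emeasure_eq_measure)
  have g[measurable]: "g \<in> borel_measurable borel"
    using distributed_real_measurable[OF _ g_density] g_nonneg by auto
  define G where "G = density lborel (\<lambda>y. ennreal (g y))"
  have GU: "distr (uniform_measure P ?S) lborel (compound_sum N Y) = G"
    using g_density unfolding distributed_def G_def by simp
  interpret G: prob_space G
    unfolding GU[symmetric] by (intro U.prob_space_distr) (simp add: measurable_def)
  have one: "(\<integral>\<^sup>+y. ennreal (g y) \<partial>lborel) = 1"
    using G.emeasure_space_1 unfolding G_def by (simp add: emeasure_density)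
  show i: "integrable lborel g"
    by (rule integrableI_nonneg) (use g_nonneg one in auto)
  show "(LINT y|lborel. g y) = 1"
    using one g_nonneg by (subst integral_eq_nn_integral) auto
  have key: "measure P {\<omega>\<in>space P. N \<omega> > 0 \<and> compound_sum N Y \<omega> \<in> A} = (1 - exp (- lam)) * measure G A"
    if A[measurable]: "A \<in> sets borel" for A
  proof -
    have "measure G A = measure (uniform_measure P ?S) (compound_sum N Y -` A \<inter> space P)"
      unfolding GU[symmetric] by (subst measure_distr) (auto simp: measurable_def)
    also have "\<dots> = measure P (?S \<inter> (compound_sum N Y -` A \<inter> space P)) / measure P ?S"
      using p0 pS by (subst measure_uniform_measure) (auto simp: P.emeasure_eq_measure)
    also have "?S \<inter> (compound_sum N Y -` A \<inter> space P) = {\<omega>\<in>space P. N \<omega> > 0 \<and> compound_sum N Y \<omega> \<in> A}"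
      by auto
    finally show ?thesis using p0 pS by (simp add: field_simps)
  qed
  have Gnull: "measure G (A - {0}) = measure G A" if A[measurable]: "A \<in> sets borel" for A
  proof (rule measure_eq_AE)
    have "AE y in lborel. y \<noteq> (0::real)" by (rule AE_lborel_singleton)
    then show "AE y in G. y \<in> A - {0} \<longleftrightarrow> y \<in> A" unfolding G_def by (subst AE_density) auto
  qed (auto simp: G_def)
  have m0: "measure \<mu> (A - {0}) = (1 - exp (- lam)) * measure G A" if A[measurable]: "A \<in> sets borel" for A
  proof -
    have "measure \<mu> (A - {0}) = measure P (compound_sum N Y -` (A - {0}) \<inter> space P)"
      unfolding \<mu>_def by (subst measure_distr) auto
    \<comment> \<open>A nonzero value forces \<open>N > 0\<close>, since the sum over no terms is
      0.\<close>
    also have "compound_sum N Y -` (A - {0}) \<inter> space P = {\<omega>\<in>space P. N \<omega> > 0 \<and> compound_sum N Y \<omega> \<in> A - {0}}"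
      by (auto simp: compound_sum_def intro!: Nat.gr0I)
    also have "measure P \<dots> = (1 - exp (- lam)) * measure G (A - {0})" by (rule key) simp
    finally show ?thesis by (simp add: Gnull)
  qed
  have "1 - measure \<mu> {0} = measure \<mu> (UNIV - {0})"
    using \<mu>.prob_compl[of "{0}"] by (simp add: \<mu>_def)
  also have "\<dots> = 1 - exp (- lam)"
    using m0[of UNIV] G.prob_space by (simp add: G_def)
  finally have q: "1 - measure \<mu> {0} = 1 - exp (- lam)" .
  then show "measure \<mu> {0} = exp (- lam)" by simp
  show "measure \<mu> (A - {0}) / (1 - measure \<mu> {0}) = measure (density lborel (\<lambda>y. ennreal (g y))) A"
    if "A \<in> sets borel"
    unfolding q m0[OF that] G_def[symmetric] using p0 by simp
qed

text \<open>Conditioning on \<open>N = k\<close> gives the \<open>k\<close>-th power of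
  \<open>fourier f\<close> with Poisson weight, and the exponential series sums these terms.\<close>

lemma compound_poisson_char:
  fixes P :: "'p measure" and N :: "'p \<Rightarrow> nat" and Y :: "nat \<Rightarrow> 'p \<Rightarrow> real"
  assumes "prob_space P" and lam: "lam > 0"
    and N_meas[measurable]: "N \<in> measurable P (count_space UNIV)"
    and N_poisson: "distr P (count_space UNIV) N = measure_pmf (poisson_pmf lam)"
    and f_nonneg: "\<And>y. f y \<ge> 0"
    and Y_density: "\<And>j. distributed P lborel (Y j) (\<lambda>y. ennreal (f y))"
    and NY_indep: "prob_space.indep_vars P (\<lambda>_. borel)
                     (case_option (\<lambda>\<omega>. real (N \<omega>)) Y) (UNIV :: nat option set)"
  shows "(CLINT \<omega>|P. iexp (t * compound_sum N Y \<omega>)) = exp (of_real lam * (fourier f t - 1))"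
proof -
  interpret P: prob_space P by fact
  have Y_meas[measurable]: "Y j \<in> borel_measurable P" for j
    using Y_density[of j] unfolding distributed_def by (simp add: measurable_lborel1)
  have Xm[measurable]: "compound_sum N Y \<in> borel_measurable P"
    by (rule measurable_compound_sum) auto
  have f[measurable]: "f \<in> borel_measurable borel"
    using distributed_real_measurable[OF _ Y_density[of 0]] f_nonneg by auto
  \<comment> \<open>An indicator at the index of \<open>N\<close> and an exponential at each index
    of \<open>Y\<close>: the expectation then factorizes by one product rule for a single
    independent family.\<close>
  define V :: "nat \<Rightarrow> nat option \<Rightarrow> real \<Rightarrow> complex" where
    "V k i = (case i of None \<Rightarrow> (\<lambda>x. of_real (indicator {real k} x)) | Some j \<Rightarrow> (\<lambda>y. iexp (t * y)))" for k i
  have Vm[measurable]: "V k i \<in> borel_measurable borel" for k i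
    unfolding V_def by (cases i) auto
  define I where "I k = insert None (Some ` {..<k})" for k :: nat
  have tm: "integrable P (\<lambda>\<omega>. of_real (indicator (N -` {k}) \<omega>) * (\<Prod>j<k. iexp (t * Y j \<omega>)))"
     "(CLINT \<omega>|P. of_real (indicator (N -` {k}) \<omega>) * (\<Prod>j<k. iexp (t * Y j \<omega>)))
       = of_real (lam ^ k / fact k * exp (- lam)) * fourier f t ^ k" for k
  proof -
    have ind: "P.indep_vars (\<lambda>_. borel) (\<lambda>i \<omega>. V k i (case_option (\<lambda>\<omega>. real (N \<omega>)) Y i \<omega>)) (I k)"
      by (rule P.indep_vars_subset[OF P.indep_vars_compose2[OF NY_indep]]) auto
    have int: "integrable P (\<lambda>\<omega>. V k i (case_option (\<lambda>\<omega>. real (N \<omega>)) Y i \<omega>))" for i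
      by (rule P.integrable_const_bound[where B=1]) (auto simp: V_def split: option.split)
    have eq: "(\<Prod>i\<in>I k. V k i (case_option (\<lambda>\<omega>. real (N \<omega>)) Y i \<omega>))
       = of_real (indicator (N -` {k}) \<omega>) * (\<Prod>j<k. iexp (t * Y j \<omega>))" for \<omega>
      unfolding I_def
      by (subst prod.insert) (auto simp: V_def prod.reindex indicator_def)
    show "integrable P (\<lambda>\<omega>. of_real (indicator (N -` {k}) \<omega>) * (\<Prod>j<k. iexp (t * Y j \<omega>)))"
      unfolding eq[symmetric] by (rule P.indep_vars_integrable[OF _ ind int]) (simp add: I_def)
    have "(CLINT \<omega>|P. of_real (indicator (N -` {k}) \<omega>) * (\<Prod>j<k. iexp (t * Y j \<omega>)))
       = (\<Prod>i\<in>I k. CLINT \<omega>|P. V k i (case_option (\<lambda>\<omega>. real (N \<omega>)) Y i \<omega>))"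
      unfolding eq[symmetric] by (rule P.indep_vars_lebesgue_integral[OF _ ind int]) (simp add: I_def)
    also have "\<dots> = (CLINT \<omega>|P. of_real (indicator (N -` {k}) \<omega>)) * (\<Prod>j<k. CLINT \<omega>|P. iexp (t * Y j \<omega>))"
      unfolding I_def
      by (subst prod.insert) (auto simp: V_def prod.reindex indicator_def intro!: arg_cong2[where f="(*)"] Bochner_Integration.integral_cong)
    also have "(\<Prod>j<k. CLINT \<omega>|P. iexp (t * Y j \<omega>)) = fourier f t ^ k"
    proof -
      have "(CLINT \<omega>|P. iexp (t * Y j \<omega>)) = fourier f t" for j
      proof -
        have "(CLINT \<omega>|P. iexp (t * Y j \<omega>)) = (CLINT y|distr P lborel (Y j). iexp (t * y))"
          by (subst integral_distr) (auto simp: measurable_lborel1)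
        also have "distr P lborel (Y j) = density lborel (\<lambda>y. ennreal (f y))"
          using Y_density[of j] unfolding distributed_def by simp
        finally show ?thesis using f_nonneg by (subst fourier_eq_integral_density) auto
      qed
      then show ?thesis by simp
    qed
    also have "(CLINT \<omega>|P. of_real (indicator (N -` {k}) \<omega>)) = complex_of_real (lam ^ k / fact k * exp (- lam))"
      using compound_poisson_prob(1)[OF assms(1) N_meas N_poisson lam, of k]
      by (subst integral_complex_of_real) (simp add: Int_commute)
    finally show "(CLINT \<omega>|P. of_real (indicator (N -` {k}) \<omega>) * (\<Prod>j<k. iexp (t * Y j \<omega>)))
       = of_real (lam ^ k / fact k * exp (- lam)) * fourier f t ^ k" .
  qed
  let ?W = "\<lambda>k \<omega>. of_real (indicator (N -` {k}) \<omega>) * (\<Prod>j<k. iexp (t * Y j \<omega>))"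
  have Wnorm: "cmod (?W k \<omega>) = indicator (N -` {k}) \<omega>" for k \<omega>
    by (simp add: norm_mult prod_norm[symmetric])
  have Wsums: "(\<lambda>k. ?W k \<omega>) sums iexp (t * compound_sum N Y \<omega>)" for \<omega>
  proof -
    have "(\<lambda>k. ?W k \<omega>) sums (\<Sum>k\<in>{N \<omega>}. ?W k \<omega>)"
      by (rule sums_finite) (auto simp: indicator_def)
    also have "(\<Sum>k\<in>{N \<omega>}. ?W k \<omega>) = iexp (t * compound_sum N Y \<omega>)"
      by (simp add: compound_sum_def exp_sum[symmetric] sum_distrib_left)
    finally show ?thesis .
  qed
  have Wn_sums: "summable (\<lambda>k. cmod (?W k \<omega>))" for \<omega>
    unfolding Wnorm by (rule summable_finite[of "{N \<omega>}"]) (auto simp: indicator_def)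
  \<comment> \<open>Sum and expectation may be exchanged because the L1 norms of the terms are the
    Poisson probabilities.\<close>
  have "(\<lambda>k. CLINT \<omega>|P. ?W k \<omega>) sums (CLINT \<omega>|P. (\<Sum>k. ?W k \<omega>))"
  proof (rule sums_integral[OF tm(1)])
    show "AE \<omega> in P. summable (\<lambda>k. cmod (?W k \<omega>))" using Wn_sums by simp
    have "(\<integral>\<omega>. cmod (?W k \<omega>) \<partial>P) = lam ^ k / fact k * exp (- lam)" for k
      unfolding Wnorm using compound_poisson_prob(1)[OF assms(1) N_meas N_poisson lam, of k]
      by (simp add: Int_commute)
    moreover have "summable (\<lambda>k. lam ^ k / fact k * exp (- lam))"
      using summable_exp[of lam] by (intro summable_mult2) (simp add: field_simps)
    ultimately show "summable (\<lambda>k. \<integral>\<omega>. cmod (?W k \<omega>) \<partial>P)" by simp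
  qed
  then have "(\<lambda>k. of_real (lam ^ k / fact k * exp (- lam)) * fourier f t ^ k) sums
      (CLINT \<omega>|P. iexp (t * compound_sum N Y \<omega>))"
    unfolding tm using Wsums by (simp add: sums_iff)
  moreover have "(\<lambda>k. of_real (lam ^ k / fact k * exp (- lam)) * fourier f t ^ k) sums
     (exp (of_real lam * fourier f t) * of_real (exp (- lam)))"
  proof -
    have "(\<lambda>k. ((of_real lam * fourier f t) ^ k /\<^sub>R fact k) * complex_of_real (exp (- lam))) sums
      (exp (of_real lam * fourier f t) * of_real (exp (- lam)))"
      by (intro sums_mult2 exp_converges)
    then show ?thesis
      by (simp add: scaleR_conv_of_real power_mult_distrib field_simps)
  qed
  ultimately have "(CLINT \<omega>|P. iexp (t * compound_sum N Y \<omega>)) = exp (of_real lam * fourier f t) * of_real (exp (- lam))"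
    by (rule sums_unique2)
  also have "\<dots> = exp (of_real lam * (fourier f t - 1))"
    by (simp add: exp_of_real[symmetric] exp_add[symmetric] algebra_simps)
  finally show ?thesis .
qed

text \<open>The characteristic function of the compound sum splits into the part on
  \<open>N > 0\<close>, which is \<open>1 - exp (- lam)\<close> times \<open>fourier g\<close>, and
  the mass \<open>exp (- lam)\<close> of \<open>N = 0\<close>. Multiplying by \<open>exp lam\<close>
  gives the identity.\<close>

lemma fourier_conditional_density:
  fixes P :: "'p measure" and N :: "'p \<Rightarrow> nat" and Y :: "nat \<Rightarrow> 'p \<Rightarrow> real"
  assumes "prob_space P" and lam: "lam > 0"
    and N_meas[measurable]: "N \<in> measurable P (count_space UNIV)"
    and N_poisson: "distr P (count_space UNIV) N = measure_pmf (poisson_pmf lam)"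
    and f_nonneg: "\<And>y. f y \<ge> 0"
    and Y_density: "\<And>j. distributed P lborel (Y j) (\<lambda>y. ennreal (f y))"
    and NY_indep: "prob_space.indep_vars P (\<lambda>_. borel)
                     (case_option (\<lambda>\<omega>. real (N \<omega>)) Y) (UNIV :: nat option set)"
    and g_nonneg: "\<And>y. g y \<ge> 0"
    and g_density: "distributed (uniform_measure P {\<omega> \<in> space P. N \<omega> > 0}) lborel
                      (compound_sum N Y) (\<lambda>y. ennreal (g y))"
  shows "of_real (exp lam - 1) * fourier g t + 1 = exp (of_real lam * fourier f t)"
proof -
  interpret P: prob_space P by fact
  have Y_meas[measurable]: "Y j \<in> borel_measurable P" for j
    using Y_density[of j] unfolding distributed_def by (simp add: measurable_lborel1)
  have Xm[measurable]: "compound_sum N Y \<in> borel_measurable P"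
    by (rule measurable_compound_sum) auto
  let ?S = "{\<omega> \<in> space P. N \<omega> > 0}"
  have S[measurable]: "?S \<in> sets P" by measurable
  note pS = compound_poisson_prob(2)[OF assms(1) N_meas N_poisson lam]
  have p0: "0 < 1 - exp (- lam)" using lam by simp
  have g[measurable]: "g \<in> borel_measurable borel"
    using distributed_real_measurable[OF _ g_density] g_nonneg by auto
  let ?e = "\<lambda>\<omega>. iexp (t * compound_sum N Y \<omega>)"
  have "fourier g t = (CLINT y|distr (uniform_measure P ?S) lborel (compound_sum N Y). iexp (t * y))"
    using g_density g_nonneg unfolding distributed_def by (simp add: fourier_eq_integral_density)
  also have "\<dots> = (CLINT \<omega>|uniform_measure P ?S. ?e \<omega>)"
  proof (rule integral_distr)
    show "compound_sum N Y \<in> measurable (uniform_measure P ?S) lborel"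
      using Xm by (simp add: measurable_def)
  qed simp
  also have "\<dots> = (CLINT \<omega>|P. (indicator ?S \<omega> / (1 - exp (- lam))) *\<^sub>R ?e \<omega>)"
  proof -
    have *: "uniform_measure P ?S = density P (\<lambda>\<omega>. ennreal (indicator ?S \<omega> / (1 - exp (- lam))))"
      unfolding uniform_measure_def using p0 pS
      by (auto simp: P.emeasure_eq_measure divide_ennreal[symmetric] ennreal_indicator intro!: arg_cong[where f="density P"])
    show ?thesis unfolding * using p0 by (subst integral_density) auto
  qed
  also have "\<dots> = (CLINT \<omega>|P. (1 / (1 - exp (- lam))) *\<^sub>R (indicator ?S \<omega> *\<^sub>R ?e \<omega>))"
    by simp
  also have "\<dots> = (1 / (1 - exp (- lam))) *\<^sub>R (CLINT \<omega>|P. indicator ?S \<omega> *\<^sub>R ?e \<omega>)"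
    by (rule integral_scaleR_right)
  finally have fg: "fourier g t = (1 / (1 - exp (- lam))) *\<^sub>R (CLINT \<omega>|P. indicator ?S \<omega> *\<^sub>R ?e \<omega>)" .
  have gS: "(1 - exp (- lam)) *\<^sub>R fourier g t = (CLINT \<omega>|P. indicator ?S \<omega> *\<^sub>R ?e \<omega>)"
    unfolding fg scaleR_scaleR using p0 by simp
  have "exp (of_real lam * (fourier f t - 1)) = (CLINT \<omega>|P. ?e \<omega>)"
    by (rule compound_poisson_char[OF assms(1-7), symmetric])
  also have "\<dots> = (CLINT \<omega>|P. indicator ?S \<omega> *\<^sub>R ?e \<omega> + complex_of_real (indicator (N -` {0}) \<omega>))"
    by (intro Bochner_Integration.integral_cong) (auto simp: indicator_def compound_sum_def)
  also have "\<dots> = (CLINT \<omega>|P. indicator ?S \<omega> *\<^sub>R ?e \<omega>) + (CLINT \<omega>|P. complex_of_real (indicator (N -` {0}) \<omega>))"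
    by (rule Bochner_Integration.integral_add)
       (auto intro!: P.integrable_const_bound[where B=1] simp: indicator_def)
  also have "(CLINT \<omega>|P. complex_of_real (indicator (N -` {0}) \<omega>)) = complex_of_real (exp (- lam))"
    using compound_poisson_prob(1)[OF assms(1) N_meas N_poisson lam, of 0]
    by (subst integral_complex_of_real) (simp add: Int_commute)
  finally have "exp (of_real lam * (fourier f t - 1)) = of_real (1 - exp (- lam)) * fourier g t + of_real (exp (- lam))"
    by (simp only: gS[unfolded scaleR_conv_of_real] scaleR_conv_of_real)
  from arg_cong[OF this, of "\<lambda>z. complex_of_real (exp lam) * z"]
  show ?thesis
    by (simp add: exp_of_real[symmetric] exp_add[symmetric] algebra_simps)
qed

section \<open>Linearization of the estimator\<close>

text \<open>A non-integrable integrand has Bochner integral 0, which the nonnegative bound covers,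
  so callers supply only the pointwise estimate on \<open>A\<close>.\<close>

lemma set_integral_norm_le:
  fixes u :: "real \<Rightarrow> 'b::{banach, second_countable_topology}"
  assumes b: "integrable lborel b" "\<And>t. b t \<ge> 0" and le: "\<And>t. t \<in> A \<Longrightarrow> norm (u t) \<le> b t"
  shows "norm (LINT t:A|lborel. u t) \<le> (LINT t|lborel. b t)"
proof (cases "integrable lborel (\<lambda>t. indicator A t *\<^sub>R u t)")
  case True
  then show ?thesis unfolding set_lebesgue_integral_def
    by (rule Bochner_Integration.integral_norm_bound_integral[OF _ b(1)]) (use b le in \<open>auto simp: indicator_def\<close>)
next
  case False
  then show ?thesis unfolding set_lebesgue_integral_def
    by (simp add: not_integrable_integral_eq b integral_nonneg_AE)
qed

lemma indicator_bound_integral: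
  assumes "h > 0"
  shows "integrable lborel (\<lambda>t. c * indicator {-(1/h)..1/h} t :: real)"
    and "(LINT t|lborel. c * indicator {-(1/h)..1/h} t) = c * (2 / h)"
  using assms by auto

text \<open>The analytic content of the model: the law of the observations, the relation
  \<open>fg_eq\<close> between the transforms, and the properties of the transform of
  \<open>w\<close> on the frequency side. \<open>K\<close> is a uniform bound on that
  transform.\<close>

locale decompounding = prob_space Q for Q :: "'q measure" +
  fixes Z :: "nat \<Rightarrow> 'q \<Rightarrow> real" and f g w :: "real \<Rightarrow> real" and lam x K :: real
  assumes Z_indep: "indep_vars (\<lambda>_. borel) Z UNIV"
    and Z_distr: "\<And>k. distr Q borel (Z k) = density lborel (\<lambda>y. ennreal (g y))"
    and lam: "lam > 0"
    and g_cont: "continuous_on UNIV g" and g_nonneg: "\<And>y. g y \<ge> 0" and g_int: "integrable lborel g"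
    and g_x: "g x \<noteq> 0"
    and ff_cont: "continuous_on UNIV (fourier f)" and ff_le: "\<And>t. cmod (fourier f t) \<le> 1"
    and ff_int: "integrable lborel (fourier f)"
    and fg_eq: "\<And>t. of_real (exp lam - 1) * fourier g t + 1 = exp (of_real lam * fourier f t)"
    and w_C1: "fourier w C1_differentiable_on UNIV" and w_0: "fourier w 0 = 1"
    and w_supp: "\<And>t. \<bar>t\<bar> > 1 \<Longrightarrow> fourier w t = 0" and w_real: "\<And>t. Im (fourier w t) = 0"
    and w_le: "\<And>t. cmod (fourier w t) \<le> K"
begin

text \<open>\<open>\<psi>0 h\<close> is the mean of \<^const>\<open>log_arg\<close> and \<open>E\<close> its limit as \<open>h\<close> tends to 0. On the good event
  the estimator is \<open>c h\<close> plus the mean of the \<open>Kf h (Z j) - mK h\<close> plus a remainder.\<close>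

definition "a = exp lam - 1"
definition "G = density lborel (\<lambda>y. ennreal (g y))"
definition "\<kappa> = 1 / (2 * pi * lam)"
text \<open>Bounds 1 over \<open>\<psi>0\<close> in modulus: \<open>E\<close> has modulus at least
  \<open>exp (- lam)\<close> and \<open>\<psi>0\<close> at least half that of \<open>E\<close>. Then
  \<open>C0\<close> bounds the coefficient of the deviation in the linearized logarithm.\<close>

definition "B = 2 * exp lam"
definition "C0 = a * K * B"
definition "J = (LINT t|lborel. cmod (fourier g t))"
definition "\<psi>0 h t = of_real a * fourier g t * fourier w (h * t) + 1"
definition "E t = exp (of_real lam * fourier f t)"
text \<open>The radius 1/4 keeps the ratio off the branch cut of \<open>Ln\<close> and inside the
  disk where the linear bound \<open>norm_Ln_le\<close> applies.\<close>

definition "ok h \<longleftrightarrow> h > 0 \<and> (\<forall>t. cmod (\<psi>0 h t / E t - 1) \<le> 1 / 4)"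
text \<open>The derivative of the logarithm at \<open>\<psi>0\<close> with respect to the empirical
  characteristic function, times the Fourier inversion factor at \<open>x\<close>.\<close>

definition "b h t = iexp (- (t * x)) * (of_real a * fourier w (h * t) / \<psi>0 h t)"
definition "c h = Re (of_real \<kappa> * (LINT t:{-(1/h)..1/h}|lborel. iexp (- (t * x)) * (of_real lam * fourier f t + Ln (\<psi>0 h t / E t))))"
definition "Kf h y = Re (of_real \<kappa> * (LINT t:{-(1/h)..1/h}|lborel. b h t * iexp (t * y)))"
definition "mK h = Re (of_real \<kappa> * (LINT t:{-(1/h)..1/h}|lborel. b h t * fourier g t))"

section \<open>Bounds on the point of linearization, uniform in frequency and bandwidth\<close>

lemma a_pos: "a > 0" using lam by (simp add: a_def)
lemma \<kappa>_pos: "\<kappa> > 0" using lam by (simp add: \<kappa>_def)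
lemma abs_Re_\<kappa>_le: "cmod S \<le> d \<Longrightarrow> \<bar>Re (of_real \<kappa> * S)\<bar> \<le> \<kappa> * d"
proof -
  assume d: "cmod S \<le> d"
  have "\<bar>Re (of_real \<kappa> * S)\<bar> \<le> cmod (of_real \<kappa> * S)" by (rule abs_Re_le_cmod)
  also have "\<dots> = \<kappa> * cmod S" using \<kappa>_pos by (simp add: norm_mult)
  also have "\<dots> \<le> \<kappa> * d" using \<kappa>_pos d by (intro mult_left_mono) auto
  finally show ?thesis .
qed

lemma B_pos: "B > 0" by (simp add: B_def)
lemma K_ge: "K \<ge> 1" using w_le[of 0] w_0 by simp
lemma C0_pos: "C0 > 0" using a_pos B_pos K_ge by (simp add: C0_def)

lemma g_meas[measurable]: "g \<in> borel_measurable borel"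
  using g_cont by (rule borel_measurable_continuous_onI)

lemma Z_meas[measurable]: "Z k \<in> borel_measurable Q"
  using Z_indep unfolding indep_vars_def by auto

sublocale G: real_distribution G
  using real_distribution_distr[OF Z_meas[of 0]] unfolding Z_distr G_def .

lemma fg_char: "fourier g t = char G t"
  unfolding char_def G_def by (rule fourier_eq_integral_density) (use g_nonneg in auto)

lemma fg_cont: "continuous_on UNIV (fourier g)"
  unfolding fg_char[abs_def] by (auto intro!: continuous_at_imp_continuous_on G.isCont_char)

lemma fg_le: "cmod (fourier g t) \<le> 1"
  unfolding fg_char by (rule G.cmod_char_le_1)

lemma w_cont: "continuous_on UNIV (fourier w)"
  using w_C1 by (rule C1_differentiable_imp_continuous_on)

lemma fourier_meas[measurable]: "fourier g \<in> borel_measurable borel" "fourier w \<in> borel_measurable borel"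
    "fourier f \<in> borel_measurable borel"
  using fg_cont w_cont ff_cont by (auto intro: borel_measurable_continuous_onI)

text \<open>\<open>fourier g\<close> is a multiple of \<open>exp (lam * fourier f) - 1\<close>,
  hence dominated by a multiple of \<open>fourier f\<close>.\<close>

lemma fg_int: "integrable lborel (fourier g)"
proof (rule Bochner_Integration.integrable_bound)
  show "integrable lborel (\<lambda>t. (lam * exp lam / a) *\<^sub>R fourier f t)" using ff_int by simp
  show "AE t in lborel. norm (fourier g t) \<le> norm ((lam * exp lam / a) *\<^sub>R fourier f t)"
  proof (rule AE_I2)
    fix t
    have "a * cmod (fourier g t) = cmod (exp (of_real lam * fourier f t) - 1)"
      using a_pos fg_eq[of t] unfolding a_def[symmetric]
      by (metis add_diff_cancel_right' norm_mult norm_of_real abs_of_pos)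
    also have "\<dots> \<le> cmod (of_real lam * fourier f t) * exp (cmod (of_real lam * fourier f t))"
      by (rule cmod_exp_minus_one_le)
    also have "\<dots> \<le> (lam * cmod (fourier f t)) * exp lam"
      using lam ff_le[of t] by (auto simp: norm_mult intro!: mult_left_mono)
    finally show "norm (fourier g t) \<le> norm ((lam * exp lam / a) *\<^sub>R fourier f t)"
      using a_pos lam by (simp add: field_simps)
  qed
qed simp

lemma fg_tendsto_0: "(fourier g \<longlongrightarrow> 0) at_infinity"
  using g_cont g_int g_nonneg by (rule fourier_tendsto_0)

lemma J_nonneg: "J \<ge> 0" by (simp add: J_def)

lemma E_cont: "continuous_on UNIV E"
  unfolding E_def by (intro continuous_intros ff_cont)

lemma E_nz[simp]: "E t \<noteq> 0" by (simp add: E_def)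

lemma E_eq: "E t = of_real a * fourier g t + 1"
  using fg_eq by (simp add: E_def a_def)

lemma E_ge: "cmod (E t) \<ge> exp (- lam)"
proof -
  have "Re (fourier f t) \<ge> -1"
    using abs_Re_le_cmod[of "fourier f t"] ff_le[of t] by linarith
  then have "- lam \<le> lam * Re (fourier f t)"
    using lam mult_left_mono[of "-1" "Re (fourier f t)" lam] by simp
  then show ?thesis by (simp add: E_def)
qed

lemma inv_E_le: "1 / cmod (E t) \<le> exp lam"
proof -
  have "1 / cmod (E t) \<le> 1 / exp (- lam)"
    using E_ge[of t] by (intro divide_left_mono) auto
  then show ?thesis by (simp add: exp_minus inverse_eq_divide)
qed

lemma \<psi>0_cont: "continuous_on UNIV (\<psi>0 h)"
  unfolding \<psi>0_def by (intro continuous_intros fg_cont continuous_on_compose2[OF w_cont]) auto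

lemma ratio_eq: "\<psi>0 h t / E t - 1 = of_real a * fourier g t * (fourier w (h * t) - 1) / E t"
proof -
  have "\<psi>0 h t - E t = of_real a * fourier g t * (fourier w (h * t) - 1)"
    by (simp add: \<psi>0_def E_eq algebra_simps)
  then show ?thesis by (simp add: diff_divide_distrib[symmetric] field_simps)
qed

lemma ratio_le: "cmod (\<psi>0 h t / E t - 1) \<le> a * exp lam * (cmod (fourier g t) * cmod (fourier w (h * t) - 1))"
proof -
  have "cmod (\<psi>0 h t / E t - 1) = a * (cmod (fourier g t) * cmod (fourier w (h * t) - 1)) * (1 / cmod (E t))"
    using a_pos by (simp add: ratio_eq norm_mult norm_divide)
  also have "\<dots> \<le> a * (cmod (fourier g t) * cmod (fourier w (h * t) - 1)) * exp lam"
    using a_pos by (intro mult_left_mono inv_E_le) auto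
  finally show ?thesis by (simp add: mult_ac)
qed

text \<open>The distance of the ratio from 1 is controlled by \<open>fourier g t\<close> times
  \<open>fourier w (h * t) - 1\<close>. For large \<open>t\<close> the first factor is small; for
  bounded \<open>t\<close> the second is, once \<open>h\<close> is small.\<close>

lemma ok_small: "\<exists>h0>0. \<forall>h. 0 < h \<and> h < h0 \<longrightarrow> ok h"
proof -
  \<comment> \<open>Chosen so that \<open>\<epsilon> * (K + 1)\<close>, which covers both ranges of
    \<open>t\<close>, yields exactly 1/4; \<open>K + 1\<close> bounds
    \<open>fourier w - 1\<close>.\<close>
  define \<epsilon> where "\<epsilon> = 1 / (4 * (a * exp lam) * (K + 1))"
  have \<epsilon>: "\<epsilon> > 0" using a_pos K_ge by (simp add: \<epsilon>_def)
  have \<epsilon>4: "a * exp lam * (\<epsilon> * (K + 1)) = 1 / 4"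
    using a_pos K_ge by (simp add: \<epsilon>_def)
  have "\<forall>\<^sub>F t in at_infinity. dist (fourier g t) 0 < \<epsilon>"
    using fg_tendsto_0 \<epsilon> by (rule tendstoD)
  then obtain T where T: "\<And>t. \<bar>t\<bar> \<ge> T \<Longrightarrow> cmod (fourier g t) < \<epsilon>"
    unfolding eventually_at_infinity by auto
  have "isCont (fourier w) 0" using w_cont by (simp add: continuous_on_eq_continuous_at)
  then obtain d where d: "d > 0" "\<And>s. \<bar>s\<bar> < d \<Longrightarrow> cmod (fourier w s - 1) < \<epsilon>"
    using \<epsilon> unfolding continuous_at_eps_delta w_0 dist_norm by (metis real_norm_def diff_zero)
  \<comment> \<open>Guarantees that \<open>h * t\<close> stays within \<open>d\<close> of 0 as long
    as \<open>t\<close> is below \<open>T\<close> in modulus.\<close>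
  define h0 where "h0 = d / (\<bar>T\<bar> + 1)"
  have "h0 > 0" using d by (simp add: h0_def)
  moreover have "ok h" if h: "0 < h" "h < h0" for h
    unfolding ok_def
  proof (intro conjI allI)
    fix t
    have w1: "cmod (fourier w s - 1) \<le> K + 1" for s
      using w_le[of s] norm_triangle_ineq4[of "fourier w s" 1] by simp
    have "cmod (fourier g t) * cmod (fourier w (h * t) - 1) \<le> \<epsilon> * (K + 1)"
    proof (cases "\<bar>t\<bar> \<ge> T")
      case True
      then show ?thesis using T[of t] w1[of "h * t"] by (intro mult_mono) (auto simp: \<epsilon> less_imp_le)
    next
      case False
      have "\<bar>h * t\<bar> \<le> h * (\<bar>T\<bar> + 1)" using False h by (auto simp: abs_mult intro!: mult_left_mono)
      also have "\<dots> < d" using h by (simp add: h0_def field_simps)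
      finally have "cmod (fourier w (h * t) - 1) < \<epsilon>" by (rule d(2))
      then have "cmod (fourier g t) * cmod (fourier w (h * t) - 1) \<le> 1 * \<epsilon>"
        using fg_le[of t] \<epsilon> by (intro mult_mono) auto
      also have "\<dots> \<le> \<epsilon> * (K + 1)" using \<epsilon> K_ge by simp
      finally show ?thesis .
    qed
    then have "a * exp lam * (cmod (fourier g t) * cmod (fourier w (h * t) - 1)) \<le> a * exp lam * (\<epsilon> * (K + 1))"
      using a_pos by (intro mult_left_mono) auto
    then show "cmod (\<psi>0 h t / E t - 1) \<le> 1 / 4"
      using ratio_le[of h t] unfolding \<epsilon>4 by linarith
  qed (use h in simp)
  ultimately show ?thesis by blast
qed

lemma \<psi>0_ge: assumes "ok h" shows "1 / B \<le> cmod (\<psi>0 h t)"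
proof -
  have "cmod (\<psi>0 h t / E t - 1) \<le> 1 / 4" using assms by (simp add: ok_def)
  moreover have "cmod 1 - cmod (\<psi>0 h t / E t) \<le> cmod (\<psi>0 h t / E t - 1)"
    using norm_triangle_ineq2[of 1 "\<psi>0 h t / E t"] by (simp only: norm_minus_commute)
  ultimately have "cmod (\<psi>0 h t / E t) \<ge> 1 / 2" by simp
  then have "cmod (\<psi>0 h t) \<ge> 1 / 2 * cmod (E t)"
    by (simp add: norm_divide field_simps)
  moreover have "1 / 2 * cmod (E t) \<ge> 1 / 2 * exp (- lam)" using E_ge[of t] by simp
  moreover have "1 / B = 1 / 2 * exp (- lam)"
  proof -
    have "(1 / 2 * exp (- lam)) * B = exp lam * exp (- lam)" by (simp add: B_def)
    also have "\<dots> = 1" by (rule exp_minus_inverse)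
    finally have *: "(1 / 2 * exp (- lam)) * B = 1" .
    have "B \<noteq> 0" using B_pos by auto
    then have "(1 / 2 * exp (- lam)) * B / B = 1 / 2 * exp (- lam)" by (rule nonzero_mult_div_cancel_right)
    then show ?thesis unfolding * .
  qed
  ultimately show ?thesis by linarith
qed

lemma \<psi>0_nz: "ok h \<Longrightarrow> \<psi>0 h t \<noteq> 0"
  using \<psi>0_ge[of h t] B_pos by auto

lemma inv_\<psi>0_le: assumes "ok h" shows "1 / cmod (\<psi>0 h t) \<le> B"
proof -
  have "1 / cmod (\<psi>0 h t) \<le> 1 / (1 / B)"
    using \<psi>0_ge[OF assms, of t] \<psi>0_nz[OF assms] B_pos by (intro divide_left_mono) auto
  then show ?thesis by simp
qed

lemma coeff_le: assumes "ok h" shows "cmod (of_real a * fourier w (h * t) / \<psi>0 h t) \<le> C0"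
proof -
  have "cmod (of_real a * fourier w (h * t) / \<psi>0 h t) = a * cmod (fourier w (h * t)) * (1 / cmod (\<psi>0 h t))"
    using a_pos by (simp add: norm_mult norm_divide)
  also have "\<dots> \<le> a * K * B"
    using a_pos K_ge B_pos by (intro mult_mono mult_left_mono w_le inv_\<psi>0_le assms) auto
  finally show ?thesis by (simp add: C0_def)
qed

lemma b_le: "ok h \<Longrightarrow> cmod (b h t) \<le> C0"
  using coeff_le[of h t] by (simp add: b_def norm_mult norm_divide)

lemma b_cont: assumes "ok h" shows "continuous_on UNIV (b h)"
  unfolding b_def using \<psi>0_nz[OF assms]
  by (intro continuous_intros continuous_on_compose2[OF w_cont] continuous_on_compose2[OF \<psi>0_cont]) auto

lemma b_meas: "ok h \<Longrightarrow> b h \<in> borel_measurable borel"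
  using b_cont by (rule borel_measurable_continuous_onI)

lemma cont_set_integrable:
  fixes u :: "real \<Rightarrow> 'b::{banach, second_countable_topology}"
  shows "continuous_on UNIV u \<Longrightarrow> set_integrable lborel {p..q} u"
  by (intro borel_integrable_atLeastAtMost') (auto intro: continuous_on_subset)

lemma emp_cont: "continuous_on UNIV (emp_cf n z)"
  unfolding emp_cf_def by (intro continuous_intros)

text \<open>The argument of the logarithm factorizes as \<open>E\<close> times
  \<open>\<psi>0 / E\<close> times \<open>1 + q\<close>, and the sum of
  \<open>lam * fourier f\<close> and two principal logarithms is a continuous logarithm of it. By
  uniqueness it is the distinguished one. Of \<open>Ln (1 + q)\<close> the linear part gives
  \<open>T\<close>, and the rest is quadratic in the deviation.\<close>

lemma f_nh_expansion:
  assumes ok: "ok h" and n: "n \<ge> 1"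
    and close: "\<And>t. \<bar>t\<bar> \<le> 1 / h \<Longrightarrow> cmod (emp_cf n z t - fourier g t) \<le> 1 / (4 * C0)"
  defines "T \<equiv> Re (of_real \<kappa> * (LINT t:{-(1/h)..1/h}|lborel. b h t * (emp_cf n z t - fourier g t)))"
  shows "\<bar>f_nh lam w h n z x - c h - T\<bar>
     \<le> 2 * \<kappa> * C0\<^sup>2 * (LINT t:{-(1/h)..1/h}|lborel. (cmod (emp_cf n z t - fourier g t))\<^sup>2)"
proof -
  have h: "h > 0" using ok by (simp add: ok_def)
  \<comment> \<open>The relative deviation of the logarithm's argument from its mean
    \<open>\<psi>0\<close>.\<close>
  define q where "q t = of_real a * fourier w (h * t) / \<psi>0 h t * (emp_cf n z t - fourier g t)" for t
  have qs: "cmod (q t) \<le> C0 * cmod (emp_cf n z t - fourier g t)" for t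
    unfolding q_def norm_mult[of "_ / _"] by (intro mult_right_mono coeff_le ok) simp
  \<comment> \<open>Smallness is needed on the whole line, since the logarithm is continued along
    it. Inside the interval it is the closeness assumption, outside \<open>fourier w (h * t)\<close>
    is 0.\<close>
  have q4: "cmod (q t) \<le> 1 / 4" for t
  proof (cases "\<bar>t\<bar> \<le> 1 / h")
    case True
    have "cmod (q t) \<le> C0 * (1 / (4 * C0))"
      using qs[of t] close[OF True] C0_pos by (meson mult_left_mono less_imp_le order_trans)
    then show ?thesis using C0_pos by simp
  next
    case False
    then have "\<bar>h * t\<bar> > 1" using h by (simp add: abs_mult field_simps)
    then show ?thesis by (simp add: q_def w_supp)
  qed
  have q_cont: "continuous_on UNIV q"
    unfolding q_def using \<psi>0_nz[OF ok]
    by (intro continuous_intros continuous_on_compose2[OF w_cont] continuous_on_compose2[OF \<psi>0_cont]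
        emp_cont fg_cont) auto
  define \<psi> where "\<psi> = log_arg lam w h n z"
  have \<psi>q: "\<psi> t = \<psi>0 h t * (1 + q t)" for t
    using \<psi>0_nz[OF ok, of t] unfolding \<psi>_def log_arg_def q_def \<psi>0_def a_def
    by (simp add: field_simps)
  have Lnc: "1 + u \<notin> \<real>\<^sub>\<le>\<^sub>0" if "cmod u \<le> 1 / 4" for u :: complex
  proof
    assume "1 + u \<in> \<real>\<^sub>\<le>\<^sub>0"
    then have "Re (1 + u) \<le> 0" by (simp add: complex_nonpos_Reals_iff)
    then show False using that abs_Re_le_cmod[of u] by simp
  qed
  have rat: "1 + (\<psi>0 h t / E t - 1) \<notin> \<real>\<^sub>\<le>\<^sub>0" for t
    by (rule Lnc) (use ok in \<open>simp add: ok_def\<close>)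
  have nz: "1 + q t \<noteq> 0" for t using Lnc[OF q4[of t]] by auto
  define D where "D t = of_real lam * fourier f t + Ln (\<psi>0 h t / E t)" for t
  define L where "L t = D t + Ln (1 + q t)" for t
  have D_cont: "continuous_on UNIV D"
    unfolding D_def by (intro continuous_intros ff_cont \<psi>0_cont E_cont) (use rat in auto)
  have Lq_cont: "continuous_on UNIV (\<lambda>t. Ln (1 + q t))"
    by (intro continuous_intros q_cont) (use Lnc[OF q4] in auto)
  have L_cont: "continuous_on UNIV L" unfolding L_def by (intro continuous_intros D_cont Lq_cont)
  have eL: "exp (L t) = \<psi> t" for t
    using \<psi>0_nz[OF ok, of t] nz[of t] by (simp add: L_def D_def exp_add E_def \<psi>q)
  have g0: "fourier g 0 = 1" unfolding fg_char by (rule G.char_zero)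
  have "emp_cf n z 0 = 1" using n by (simp add: emp_cf_def)
  then have q0: "q 0 = 0" by (simp add: q_def g0)
  have E0: "E 0 = of_real (exp lam)" by (simp add: E_eq g0 a_def)
  have \<psi>00: "\<psi>0 h 0 = of_real (exp lam)" by (simp add: \<psi>0_def g0 w_0 a_def)
  \<comment> \<open>The value of \<open>E\<close> at 0 fixes \<open>lam * fourier f 0\<close> only
    modulo 2 pi i. Its modulus gives real part 1 for \<open>fourier f 0\<close>, and together with
    modulus at most 1 this excludes an imaginary part.\<close>
  have f0: "of_real lam * fourier f 0 = of_real lam"
  proof (rule exp_complex_eqI)
    show "exp (of_real lam * fourier f 0) = exp (complex_of_real lam)"
      using E0 by (simp add: E_def exp_of_real)
    have "Re (of_real lam * fourier f 0) = lam"
    proof -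
      have "exp (Re (of_real lam * fourier f 0)) = cmod (exp (of_real lam * fourier f 0))" by simp
      also have "\<dots> = exp lam" using E0 by (simp add: E_def)
      finally show ?thesis by simp
    qed
    then have "Re (fourier f 0) = 1" using lam by simp
    then have "Im (fourier f 0) = 0"
      using cmod_power2[of "fourier f 0"] power_le_one[OF norm_ge_zero ff_le[of 0], of 2] by simp
    then show "\<bar>Im (of_real lam * fourier f 0) - Im (of_real lam)\<bar> < 2 * pi" by simp
  qed
  have L0: "L 0 = complex_of_real (ln (Re (\<psi> 0)))"
    by (simp add: L_def D_def q0 f0 E0 \<psi>00 \<psi>q)
  have dl: "distinguished_log \<psi> = L" by (rule distinguished_log_eqI[OF L_cont eL L0])
  have nz': "\<forall>t. log_arg lam w h n z t \<noteq> 0"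
    using \<psi>q nz \<psi>0_nz[OF ok] unfolding \<psi>_def[symmetric] by simp
  let ?I = "{-(1/h)..1/h}"
  have c1: "set_integrable lborel ?I (\<lambda>t. iexp (- (t * x)) * D t)"
    by (intro cont_set_integrable continuous_intros D_cont)
  have c2: "set_integrable lborel ?I (\<lambda>t. iexp (- (t * x)) * q t)"
    by (intro cont_set_integrable continuous_intros q_cont)
  have c3: "set_integrable lborel ?I (\<lambda>t. iexp (- (t * x)) * (Ln (1 + q t) - q t))"
    by (intro cont_set_integrable continuous_intros q_cont Lq_cont) (use Lnc[OF q4] in auto)
  have "(LINT t:?I|lborel. iexp (- (t * x)) * L t)
     = (LINT t:?I|lborel. iexp (- (t * x)) * D t + (iexp (- (t * x)) * q t + iexp (- (t * x)) * (Ln (1 + q t) - q t)))"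
    by (rule set_lebesgue_integral_cong) (auto simp: L_def algebra_simps)
  also have "\<dots> = (LINT t:?I|lborel. iexp (- (t * x)) * D t) + ((LINT t:?I|lborel. iexp (- (t * x)) * q t)
       + (LINT t:?I|lborel. iexp (- (t * x)) * (Ln (1 + q t) - q t)))"
    using c1 c2 c3 by (simp add: set_integral_add)
  finally have split: "(LINT t:?I|lborel. iexp (- (t * x)) * L t) = \<dots>" .
  have Tq: "(LINT t:?I|lborel. b h t * (emp_cf n z t - fourier g t)) = (LINT t:?I|lborel. iexp (- (t * x)) * q t)"
    by (rule set_lebesgue_integral_cong) (auto simp: b_def q_def)
  have "f_nh lam w h n z x = Re (of_real \<kappa> * (LINT t:?I|lborel. iexp (- (t * x)) * L t))"
    using nz' dl unfolding f_nh_def \<psi>_def \<kappa>_def by simp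
  also have "\<dots> = c h + T + Re (of_real \<kappa> * (LINT t:?I|lborel. iexp (- (t * x)) * (Ln (1 + q t) - q t)))"
    unfolding split T_def Tq c_def D_def by (simp add: algebra_simps)
  finally have "\<bar>f_nh lam w h n z x - c h - T\<bar> = \<bar>Re (of_real \<kappa> * (LINT t:?I|lborel. iexp (- (t * x)) * (Ln (1 + q t) - q t)))\<bar>"
    by simp
  also have "\<dots> \<le> \<kappa> * (LINT t|lborel. indicator ?I t *\<^sub>R (2 * C0\<^sup>2 * (cmod (emp_cf n z t - fourier g t))\<^sup>2))"
  proof (rule abs_Re_\<kappa>_le, rule set_integral_norm_le)
    show "integrable lborel (\<lambda>t. indicator ?I t *\<^sub>R (2 * C0\<^sup>2 * (cmod (emp_cf n z t - fourier g t))\<^sup>2))"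
      unfolding set_integrable_def[symmetric]
      by (intro cont_set_integrable continuous_intros emp_cont fg_cont)
    fix t assume t: "t \<in> ?I"
    \<comment> \<open>As \<open>q\<close> is at most 1/4 in modulus, the denominator
      \<open>1 - cmod (q t)\<close> exceeds 1/2; this is the factor 2 of the statement.\<close>
    have "cmod (Ln (1 + q t) - q t) \<le> (cmod (q t))\<^sup>2 / (1 - cmod (q t))"
      by (rule Ln_approx_linear) (use q4[of t] in simp)
    also have "\<dots> \<le> (cmod (q t))\<^sup>2 / (1 / 2)"
      using q4[of t] by (intro divide_left_mono) auto
    also have "\<dots> \<le> 2 * (C0 * cmod (emp_cf n z t - fourier g t))\<^sup>2"
      using qs[of t] by (simp add: power_mono)
    finally show "norm (iexp (- (t * x)) * (Ln (1 + q t) - q t)) \<le> indicator ?I t *\<^sub>R (2 * C0\<^sup>2 * (cmod (emp_cf n z t - fourier g t))\<^sup>2)"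
      using t by (simp add: norm_mult power_mult_distrib mult.assoc)
  qed simp
  also have "(LINT t|lborel. indicator ?I t *\<^sub>R (2 * C0\<^sup>2 * (cmod (emp_cf n z t - fourier g t))\<^sup>2))
     = 2 * C0\<^sup>2 * (LINT t:?I|lborel. (cmod (emp_cf n z t - fourier g t))\<^sup>2)"
    unfolding set_lebesgue_integral_def[symmetric] by (rule set_integral_mult_right)
  also have "\<kappa> * (2 * C0\<^sup>2 * (LINT t:?I|lborel. (cmod (emp_cf n z t - fourier g t))\<^sup>2))
     = 2 * \<kappa> * C0\<^sup>2 * (LINT t:?I|lborel. (cmod (emp_cf n z t - fourier g t))\<^sup>2)"
    by (simp only: mult_ac)
  finally show ?thesis .
qed

text \<open>The integrand is dominated, uniformly in \<open>h\<close>, by a combination of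
  \<open>fourier f\<close> and \<open>fourier g\<close>, both integrable. A bounded centre is
  eventually far inside the truncation interval.\<close>

lemma c_bound: "\<exists>Cc. \<forall>h. ok h \<longrightarrow> \<bar>c h\<bar> \<le> Cc"
proof -
  define bd where "bd t = lam * cmod (fourier f t) + 2 * (a * exp lam * (cmod (fourier g t) * (K + 1)))" for t
  have "\<bar>c h\<bar> \<le> \<kappa> * (LINT t|lborel. bd t)" if ok: "ok h" for h
  proof -
    let ?S = "LINT t:{-(1/h)..1/h}|lborel. iexp (- (t * x)) * (of_real lam * fourier f t + Ln (\<psi>0 h t / E t))"
    have "cmod ?S \<le> (LINT t|lborel. bd t)"
    proof (rule set_integral_norm_le)
      show "integrable lborel bd" unfolding bd_def using ff_int fg_int by auto
      show "bd t \<ge> 0" for t using lam a_pos K_ge by (simp add: bd_def)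
      fix t
      have "cmod (Ln (1 + (\<psi>0 h t / E t - 1))) \<le> 2 * cmod (\<psi>0 h t / E t - 1)"
      proof (rule norm_Ln_le)
        have "cmod (\<psi>0 h t / E t - 1) \<le> 1 / 4" using ok by (simp add: ok_def)
        then show "cmod (\<psi>0 h t / E t - 1) < 1 / 2" by simp
      qed
      also have "\<dots> \<le> 2 * (a * exp lam * (cmod (fourier g t) * cmod (fourier w (h * t) - 1)))"
        using ratio_le[of h t] by simp
      also have "\<dots> \<le> 2 * (a * exp lam * (cmod (fourier g t) * (K + 1)))"
        using a_pos w_le[of "h * t"] norm_triangle_ineq4[of "fourier w (h * t)" 1] by (intro mult_left_mono) auto
      finally have "cmod (of_real lam * fourier f t + Ln (\<psi>0 h t / E t)) \<le> bd t"
        using lam by (intro order_trans[OF norm_triangle_ineq]) (simp add: bd_def norm_mult)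
      then show "cmod (iexp (- (t * x)) * (of_real lam * fourier f t + Ln (\<psi>0 h t / E t))) \<le> bd t"
        by (simp add: norm_mult)
    qed
    then show ?thesis unfolding c_def by (rule abs_Re_\<kappa>_le)
  qed
  then show ?thesis by blast
qed

text \<open>The linear part depends linearly on the empirical characteristic function, so it is an
  average over the sample; independence becomes available for it.\<close>

lemma linear_term:
  assumes ok: "ok h" and n: "n \<ge> 1"
  shows "Re (of_real \<kappa> * (LINT t:{-(1/h)..1/h}|lborel. b h t * (emp_cf n z t - fourier g t)))
     = (\<Sum>j<n. (Kf h (z j) - mK h) / n)"
proof -
  let ?I = "{-(1/h)..1/h}"
  have i1: "set_integrable lborel ?I (\<lambda>t. b h t * iexp (t * z j))" for j
    by (intro cont_set_integrable continuous_intros b_cont ok)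
  have i2: "set_integrable lborel ?I (\<lambda>t. b h t * fourier g t)"
    by (intro cont_set_integrable continuous_intros b_cont ok fg_cont)
  have i3: "set_integrable lborel ?I (\<lambda>t. b h t * emp_cf n z t)"
    by (intro cont_set_integrable continuous_intros b_cont ok emp_cont)
  have "(LINT t:?I|lborel. b h t * emp_cf n z t) = (LINT t:?I|lborel. \<Sum>j<n. (1 / of_nat n) * (b h t * iexp (t * z j)))"
    unfolding emp_cf_def sum_distrib_left by (intro set_lebesgue_integral_cong) (auto simp: mult.left_commute)
  also have "\<dots> = (\<Sum>j<n. LINT t:?I|lborel. (1 / of_nat n) * (b h t * iexp (t * z j)))"
    unfolding set_lebesgue_integral_def scaleR_sum_right
    by (rule Bochner_Integration.integral_sum)
       (use set_integrable_mult_right[OF i1, of "1 / of_nat n"] in \<open>auto simp: set_integrable_def\<close>)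
  also have "\<dots> = (\<Sum>j<n. (1 / of_nat n) * (LINT t:?I|lborel. b h t * iexp (t * z j)))"
    by (simp only: set_integral_mult_right)
  finally have e: "(LINT t:?I|lborel. b h t * emp_cf n z t) = \<dots>" .
  have "(LINT t:?I|lborel. b h t * (emp_cf n z t - fourier g t))
     = (\<Sum>j<n. (1 / of_nat n) * (LINT t:?I|lborel. b h t * iexp (t * z j))) - (LINT t:?I|lborel. b h t * fourier g t)"
    unfolding right_diff_distrib set_integral_diff(2)[OF i3 i2] e ..
  then have "of_real \<kappa> * (LINT t:?I|lborel. b h t * (emp_cf n z t - fourier g t)) =
     (\<Sum>j<n. of_real (1 / n) * (of_real \<kappa> * (LINT t:?I|lborel. b h t * iexp (t * z j))))
       - of_real \<kappa> * (LINT t:?I|lborel. b h t * fourier g t)"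
    by (simp only: right_diff_distrib sum_distrib_left of_real_divide of_real_1 of_real_of_nat_eq mult.left_commute)
  moreover have "Re (of_real (1 / n) * u) = Re u / n" for u :: complex
    by simp
  ultimately have "Re (of_real \<kappa> * (LINT t:?I|lborel. b h t * (emp_cf n z t - fourier g t)))
     = (\<Sum>j<n. Kf h (z j) / n) - mK h"
    by (simp only: minus_complex.simps Re_sum Kf_def mK_def)
  then show ?thesis using n by (simp add: diff_divide_distrib sum_subtractf)
qed

lemma Kf_le: assumes ok: "ok h" shows "\<bar>Kf h y\<bar> \<le> 2 * \<kappa> * C0 / h"
proof -
  have h: "h > 0" using ok by (simp add: ok_def)
  have "cmod (LINT t:{-(1/h)..1/h}|lborel. b h t * iexp (t * y)) \<le> (LINT t|lborel. C0 * indicator {-(1/h)..1/h} t)"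
    by (rule set_integral_norm_le[OF indicator_bound_integral(1)[OF h]])
       (use b_le[OF ok] C0_pos in \<open>auto simp: norm_mult\<close>)
  also have "\<dots> = C0 * (2 / h)" by (rule indicator_bound_integral(2)[OF h])
  finally have "\<bar>Kf h y\<bar> \<le> \<kappa> * (C0 * (2 / h))" unfolding Kf_def by (rule abs_Re_\<kappa>_le)
  then show ?thesis by (simp add: mult_ac)
qed

text \<open>Unlike the pointwise bound of order 1/h on \<open>Kf\<close>, the mean stays bounded
  because \<open>fourier g\<close> is integrable.\<close>

lemma mK_le: assumes ok: "ok h" shows "\<bar>mK h\<bar> \<le> \<kappa> * C0 * J"
proof -
  have "cmod (LINT t:{-(1/h)..1/h}|lborel. b h t * fourier g t) \<le> (LINT t|lborel. C0 * cmod (fourier g t))"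
    by (rule set_integral_norm_le)
       (use b_le[OF ok] C0_pos fg_int in \<open>auto simp: norm_mult intro!: mult_right_mono\<close>)
  also have "\<dots> = C0 * J" by (simp add: J_def)
  finally have "\<bar>mK h\<bar> \<le> \<kappa> * (C0 * J)" unfolding mK_def by (rule abs_Re_\<kappa>_le)
  then show ?thesis by (simp only: mult.assoc)
qed

end

section \<open>Moments of the linear term\<close>

lemma cos_diff_le: "\<bar>cos p - cos q\<bar> \<le> \<bar>p - q\<bar>" for p q :: real
proof -
  have "\<bar>Re (iexp p - iexp q)\<bar> \<le> cmod (iexp p - iexp q)" by (rule abs_Re_le_cmod)
  also have "\<dots> \<le> \<bar>p - q\<bar>" by (rule cmod_iexp_diff_le)
  finally show ?thesis by (simp add: Re_exp)
qed

context decompounding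
begin

text \<open>The complex integral whose scaled real part is \<open>Kf\<close>; its squared modulus is
  a product with the conjugate and so expands into a double integral.\<close>

definition "S h y = (LINT t:{-(1/h)..1/h}|lborel. b h t * iexp (t * y))"

lemma S_le: assumes ok: "ok h" shows "cmod (S h y) \<le> C0 * (2 / h)"
proof -
  have h: "h > 0" using ok by (simp add: ok_def)
  have "cmod (S h y) \<le> (LINT t|lborel. C0 * indicator {-(1/h)..1/h} t)"
    unfolding S_def by (rule set_integral_norm_le[OF indicator_bound_integral(1)[OF h]])
       (use b_le[OF ok] C0_pos in \<open>auto simp: norm_mult\<close>)
  then show ?thesis unfolding indicator_bound_integral(2)[OF h] .
qed

lemma S_meas: assumes ok: "ok h" shows "S h \<in> borel_measurable borel"
proof -
  note [measurable] = b_meas[OF ok]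
  show ?thesis unfolding S_def[abs_def] set_lebesgue_integral_def by measurable
qed

lemma Kf_S: "Kf h y = Re (of_real \<kappa> * S h y)"
  by (simp add: Kf_def S_def)

lemma Kf_meas: "ok h \<Longrightarrow> Kf h \<in> borel_measurable borel"
  using S_meas[of h] unfolding Kf_S[abs_def] by measurable

text \<open>The affine frequency \<open>p + r * t\<close> serves two purposes:
  \<open>p = 0, r = 1\<close> gives the mean of \<open>S\<close>, and \<open>r = -1\<close> with a
  fixed \<open>p\<close> gives its correlation with an exponential.\<close>

lemma char_swap:
  assumes [measurable]: "v \<in> borel_measurable borel" and h: "h > 0" and le: "\<And>t. cmod (v t) \<le> d"
  shows "(CLINT y|G. (LINT t:{-(1/h)..1/h}|lborel. v t * iexp ((p + r * t) * y)))
     = (LINT t:{-(1/h)..1/h}|lborel. v t * fourier g (p + r * t))"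
proof -
  have "(CLINT y|G. (LINT t|lborel. indicator {-(1/h)..1/h} t *\<^sub>R (v t * iexp ((p + r * t) * y))))
     = (LINT t|lborel. (CLINT y|G. indicator {-(1/h)..1/h} t *\<^sub>R (v t * iexp ((p + r * t) * y))))"
    by (rule G.integral_swap_dominated[OF _ indicator_bound_integral(1)[OF h, of d]])
       (use le order_trans[OF norm_ge_zero le] in \<open>auto simp: norm_mult indicator_def\<close>)
  then show ?thesis
    unfolding set_lebesgue_integral_def by (simp add: fg_char char_def)
qed

lemma S_expectation: assumes ok: "ok h"
  shows "(CLINT y|G. S h y) = (LINT t:{-(1/h)..1/h}|lborel. b h t * fourier g t)"
proof -
  have h: "h > 0" using ok by (simp add: ok_def)
  from char_swap[OF b_meas[OF ok] h b_le[OF ok], of 0 1] show ?thesis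
    unfolding S_def by (simp only: mult_1 add_0)
qed

lemma S_int: "ok h \<Longrightarrow> integrable G (S h)"
  by (rule G.integrable_const_bound[where B="C0 * (2 / h)"]) (use S_le S_meas in auto)

lemma Kf_expectation: assumes ok: "ok h" shows "(LINT y|G. Kf h y) = mK h"
proof -
  have "(LINT y|G. Kf h y) = Re (CLINT y|G. of_real \<kappa> * S h y)"
    unfolding Kf_S by (rule integral_Re) (use S_int[OF ok] in simp)
  also have "\<dots> = mK h" unfolding mK_def S_expectation[OF ok, symmetric] by simp
  finally show ?thesis .
qed

text \<open>The supremum bound would only give order 1/h squared. Taking the expectation inside one
  of the two integrals leaves a convolution of \<open>b h\<close> with \<open>fourier g\<close>,
  bounded because \<open>fourier g\<close> is integrable; the other integral contributes the length
  2/h.\<close>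

lemma S_second_moment: assumes ok: "ok h"
  shows "(LINT y|G. (cmod (S h y))\<^sup>2) \<le> C0\<^sup>2 * J * (2 / h)"
proof -
  have h: "h > 0" using ok by (simp add: ok_def)
  note [measurable] = b_meas[OF ok] S_meas[OF ok]
  have [measurable]: "cnj \<in> borel_measurable borel"
    by (intro borel_measurable_continuous_onI continuous_intros)
  let ?I = "{-(1/h)..1/h}"
  \<comment> \<open>The correlation of an exponential with the conjugate of \<open>S\<close>,
    bounded uniformly in \<open>t\<close>.\<close>
  define H where "H t = (CLINT y|G. iexp (t * y) * cnj (S h y))" for t
  have cS: "cnj (S h y) = (LINT s:?I|lborel. cnj (b h s) * iexp (- s * y))" for y
  proof -
    have "cnj (S h y) = (LINT s|lborel. cnj (indicator ?I s *\<^sub>R (b h s * iexp (s * y))))"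
      unfolding S_def set_lebesgue_integral_def by (rule Bochner_Integration.integral_cnj[symmetric])
    also have "\<dots> = (LINT s|lborel. indicator ?I s *\<^sub>R (cnj (b h s) * iexp (- s * y)))"
      by (rule Bochner_Integration.integral_cong[OF refl]) (simp add: exp_cnj)
    finally show ?thesis unfolding set_lebesgue_integral_def .
  qed
  have H_eq: "H t = (LINT s:?I|lborel. cnj (b h s) * fourier g (t - s))" for t
  proof -
    have "H t = (CLINT y|G. (LINT s:?I|lborel. cnj (b h s) * iexp ((t + (-1) * s) * y)))"
      unfolding H_def
    proof (intro Bochner_Integration.integral_cong refl)
      fix y
      have "iexp (t * y) * cnj (S h y) = (LINT s:?I|lborel. iexp (t * y) * (cnj (b h s) * iexp (- s * y)))"
        unfolding cS by (rule set_integral_mult_right[symmetric])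
      also have "\<dots> = (LINT s:?I|lborel. cnj (b h s) * iexp ((t + (-1) * s) * y))"
        by (intro set_lebesgue_integral_cong) (auto simp: algebra_simps exp_add[symmetric])
      finally show "iexp (t * y) * cnj (S h y) = (LINT s:?I|lborel. cnj (b h s) * iexp ((t + (-1) * s) * y))" .
    qed
    also have "\<dots> = (LINT s:?I|lborel. cnj (b h s) * fourier g (t + (-1) * s))"
      by (rule char_swap[OF _ h, of _ C0])
         (use b_le[OF ok] in \<open>auto intro!: borel_measurable_continuous_onI continuous_on_cnj b_cont ok\<close>)
    finally show ?thesis by simp
  qed
  have H_le: "cmod (H t) \<le> C0 * J" for t
  proof -
    have i: "integrable lborel (\<lambda>s. C0 * cmod (fourier g (t + (-1) * s)))"
      by (intro integrable_mult_right lborel_integrable_real_affine integrable_norm fg_int) simp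
    have "cmod (H t) \<le> (LINT s|lborel. C0 * cmod (fourier g (t + (-1) * s)))"
      unfolding H_eq by (rule set_integral_norm_le[OF i])
         (use b_le[OF ok] C0_pos in \<open>auto simp: norm_mult intro!: mult_right_mono\<close>)
    \<comment> \<open>The reflected translate of \<open>fourier g\<close> has the same L1 norm
      \<open>J\<close>.\<close>
    also have "\<dots> = C0 * J"
      unfolding J_def by (subst (2) lborel_integral_real_affine[of "-1" _ t]) auto
    finally show ?thesis .
  qed
  have "of_real (LINT y|G. (cmod (S h y))\<^sup>2) = (CLINT y|G. S h y * cnj (S h y))"
    by (subst integral_complex_of_real[symmetric]) (simp only: complex_norm_square)
  also have "\<dots> = (CLINT y|G. (LINT t|lborel. indicator ?I t *\<^sub>R (b h t * iexp (t * y)) * cnj (S h y)))"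
  proof (rule Bochner_Integration.integral_cong[OF refl])
    fix y
    have "(LINT t|lborel. indicator ?I t *\<^sub>R (b h t * iexp (t * y))) = S h y"
      by (simp only: S_def set_lebesgue_integral_def)
    then show "S h y * cnj (S h y) = (LINT t|lborel. indicator ?I t *\<^sub>R (b h t * iexp (t * y)) * cnj (S h y))"
      by (simp only: integral_mult_left_zero)
  qed
  also have "\<dots> = (LINT t|lborel. (CLINT y|G. indicator ?I t *\<^sub>R (b h t * iexp (t * y)) * cnj (S h y)))"
  proof (rule G.integral_swap_dominated[OF _ indicator_bound_integral(1)[OF h, of "C0 * (C0 * (2 / h))"]])
    fix t y
    show "norm (indicator ?I t *\<^sub>R (b h t * iexp (t * y)) * cnj (S h y)) \<le> C0 * (C0 * (2 / h)) * indicator ?I t"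
    proof -
      have "cmod (b h t) * cmod (S h y) \<le> C0 * (C0 * (2 / h))"
        using b_le[OF ok, of t] S_le[OF ok, of y] C0_pos by (intro mult_mono) auto
      then show ?thesis by (simp add: norm_mult indicator_def)
    qed
  qed measurable
  also have "\<dots> = (LINT t|lborel. indicator ?I t *\<^sub>R (b h t * H t))"
    unfolding H_def by (simp add: mult.assoc)
  finally have "cmod (of_real (LINT y|G. (cmod (S h y))\<^sup>2)) = cmod (LINT t:?I|lborel. b h t * H t)"
    unfolding set_lebesgue_integral_def by simp
  also have "\<dots> \<le> (LINT t|lborel. (C0 * (C0 * J)) * indicator ?I t)"
    by (rule set_integral_norm_le[OF indicator_bound_integral(1)[OF h]])
       (use b_le[OF ok] H_le C0_pos J_nonneg in \<open>auto simp: norm_mult intro!: mult_mono\<close>)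
  also have "\<dots> = C0\<^sup>2 * J * (2 / h)"
    unfolding indicator_bound_integral(2)[OF h] by (simp add: power2_eq_square)
  finally show ?thesis by simp
qed

lemma Kf_int: "ok h \<Longrightarrow> integrable G (Kf h)" "ok h \<Longrightarrow> integrable G (\<lambda>y. (Kf h y)\<^sup>2)"
proof -
  assume ok: "ok h"
  note [measurable] = Kf_meas[OF ok]
  show "integrable G (Kf h)"
    by (rule G.integrable_const_bound[where B="2 * \<kappa> * C0 / h"]) (use Kf_le[OF ok] in auto)
  show "integrable G (\<lambda>y. (Kf h y)\<^sup>2)"
    by (rule G.integrable_const_bound[where B="(2 * \<kappa> * C0 / h)\<^sup>2"])
       (use order_trans[OF Kf_le[OF ok] abs_ge_self] in \<open>auto simp: abs_le_square_iff[symmetric]\<close>)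
qed

lemma Kf_second_moment: assumes ok: "ok h"
  shows "(LINT y|G. (Kf h y)\<^sup>2) \<le> \<kappa>\<^sup>2 * (C0\<^sup>2 * J * (2 / h))"
proof -
  note [measurable] = S_meas[OF ok]
  have "(LINT y|G. (Kf h y)\<^sup>2) \<le> (LINT y|G. \<kappa>\<^sup>2 * (cmod (S h y))\<^sup>2)"
  proof (rule integral_mono[OF Kf_int(2)[OF ok]])
    show "integrable G (\<lambda>y. \<kappa>\<^sup>2 * (cmod (S h y))\<^sup>2)"
      by (intro integrable_mult_right G.integrable_const_bound[where B="(C0 * (2 / h))\<^sup>2"])
         (use S_le[OF ok] in \<open>auto intro!: power_mono\<close>)
    fix y
    have "\<bar>Kf h y\<bar> \<le> \<kappa> * cmod (S h y)" unfolding Kf_S by (rule abs_Re_\<kappa>_le) simp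
    then have "\<bar>Kf h y\<bar>\<^sup>2 \<le> (\<kappa> * cmod (S h y))\<^sup>2" by (rule power_mono) simp
    then show "(Kf h y)\<^sup>2 \<le> \<kappa>\<^sup>2 * (cmod (S h y))\<^sup>2" by (simp add: power_mult_distrib)
  qed
  also have "\<dots> = \<kappa>\<^sup>2 * (LINT y|G. (cmod (S h y))\<^sup>2)" by simp
  also have "\<dots> \<le> \<kappa>\<^sup>2 * (C0\<^sup>2 * J * (2 / h))" by (intro mult_left_mono S_second_moment ok) simp
  finally show ?thesis .
qed

section \<open>Kernel approximation of the summands and two-sided bounds on their variance\<close>

definition "kw u = (LINT s:{-1..1}|lborel. cos (s * u) * Re (fourier w s))"

lemma Re_w_cont: "continuous_on UNIV (\<lambda>s. Re (fourier w s))"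
  by (intro continuous_intros w_cont)

text \<open>On [-1,1] the cosine varies by at most \<open>|u - v|\<close>, and the interval has
  length 2. Up to the factor 2 pi, \<open>kw\<close> is the Fourier inversion integral of
  \<open>fourier w\<close>.\<close>

lemma kw_lipschitz: "\<bar>kw u - kw v\<bar> \<le> 2 * K * \<bar>u - v\<bar>"
proof -
  have i: "set_integrable lborel {-1..1} (\<lambda>s. cos (s * u) * Re (fourier w s))" for u
    by (intro cont_set_integrable continuous_intros Re_w_cont)
  have "kw u - kw v = (LINT s:{-1..1}|lborel. cos (s * u) * Re (fourier w s) - cos (s * v) * Re (fourier w s))"
    unfolding kw_def using set_integral_diff(2)[OF i i] by simp
  also have "norm \<dots> \<le> (LINT s|lborel. (\<bar>u - v\<bar> * K) * indicator {-1..1::real} s)"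
  proof (rule set_integral_norm_le)
    show "integrable lborel (\<lambda>s. (\<bar>u - v\<bar> * K) * indicator {-1..1::real} s)" by simp
    fix s :: real assume s: "s \<in> {-1..1}"
    have "\<bar>cos (s * u) - cos (s * v)\<bar> \<le> \<bar>s\<bar> * \<bar>u - v\<bar>"
      using cos_diff_le[of "s * u" "s * v"] by (simp add: abs_mult[symmetric] right_diff_distrib)
    also have "\<dots> \<le> 1 * \<bar>u - v\<bar>" using s by (intro mult_right_mono) auto
    finally have "\<bar>cos (s * u) - cos (s * v)\<bar> * \<bar>Re (fourier w s)\<bar> \<le> \<bar>u - v\<bar> * K"
      using w_le[of s] abs_Re_le_cmod[of "fourier w s"] by (intro mult_mono) auto
    then show "norm (cos (s * u) * Re (fourier w s) - cos (s * v) * Re (fourier w s)) \<le> (\<bar>u - v\<bar> * K) * indicator {-1..1} s"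
      using s by (simp add: abs_mult[symmetric] left_diff_distrib)
  qed (use K_ge in auto)
  also have "\<dots> = 2 * K * \<bar>u - v\<bar>" by simp
  finally show ?thesis by simp
qed

text \<open>Replacing \<open>\<psi>0\<close> by 1 in the denominator of \<open>b\<close> introduces
  the factor \<open>1 - \<psi>0\<close>, which contains \<open>fourier g\<close>. The error is
  therefore bounded by an integrable function, while the main term is of order 1/h.\<close>

lemma Kf_approx: assumes ok: "ok h"
  shows "\<bar>Kf h y - \<kappa> * a / h * kw ((y - x) / h)\<bar> \<le> \<kappa> * (a * K * B * (a * K) * J)"
proof -
  have h: "h > 0" using ok by (simp add: ok_def)
  let ?I = "{-(1/h)..1/h}"
  \<comment> \<open>The integrand of \<open>S\<close> with \<open>\<psi>0\<close> replaced by
    1.\<close>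
  define m where "m t = iexp (- (t * x)) * (of_real a * fourier w (h * t)) * iexp (t * y)" for t
  have wh: "continuous_on UNIV (\<lambda>t. fourier w (h * t))"
    by (intro continuous_on_compose2[OF w_cont] continuous_intros) auto
  have m_cont: "continuous_on UNIV m" unfolding m_def by (intro continuous_intros wh)
  have i1: "set_integrable lborel ?I m" by (intro cont_set_integrable m_cont)
  have i2: "set_integrable lborel ?I (\<lambda>t. b h t * iexp (t * y) - m t)"
    by (intro cont_set_integrable continuous_intros b_cont ok m_cont)
  have "S h y = (LINT t:?I|lborel. m t + (b h t * iexp (t * y) - m t))"
    unfolding S_def by (rule set_lebesgue_integral_cong) auto
  also have "\<dots> = (LINT t:?I|lborel. m t) + (LINT t:?I|lborel. b h t * iexp (t * y) - m t)"
    by (rule set_integral_add(2)[OF i1 i2])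
  finally have Ssplit: "S h y = (LINT t:?I|lborel. m t) + (LINT t:?I|lborel. b h t * iexp (t * y) - m t)" .
  have r: "cmod (LINT t:?I|lborel. b h t * iexp (t * y) - m t) \<le> (LINT t|lborel. (a * K * B * (a * K)) * cmod (fourier g t))"
  proof (rule set_integral_norm_le)
    show "integrable lborel (\<lambda>t. (a * K * B * (a * K)) * cmod (fourier g t))" using fg_int by auto
    show "0 \<le> (a * K * B * (a * K)) * cmod (fourier g t)" for t using a_pos K_ge B_pos by simp
    fix t
    have "b h t * iexp (t * y) - m t = m t * ((1 - \<psi>0 h t) / \<psi>0 h t)"
      using \<psi>0_nz[OF ok, of t] unfolding b_def m_def by (simp add: field_simps)
    moreover have "cmod (m t) \<le> a * K"
      unfolding m_def using a_pos w_le[of "h * t"] by (simp add: norm_mult)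
    moreover have "cmod ((1 - \<psi>0 h t) / \<psi>0 h t) \<le> (a * cmod (fourier g t) * K) * B"
    proof -
      have "cmod ((1 - \<psi>0 h t) / \<psi>0 h t) = (a * cmod (fourier g t) * cmod (fourier w (h * t))) * (1 / cmod (\<psi>0 h t))"
        using a_pos by (simp add: norm_divide \<psi>0_def norm_mult)
      also have "\<dots> \<le> (a * cmod (fourier g t) * K) * B"
        using a_pos K_ge by (intro mult_mono inv_\<psi>0_le ok mult_left_mono w_le) auto
      finally show ?thesis .
    qed
    ultimately have "cmod (b h t * iexp (t * y) - m t) \<le> (a * K) * ((a * cmod (fourier g t) * K) * B)"
      using a_pos K_ge by (simp only: norm_mult) (intro mult_mono, auto)
    then show "cmod (b h t * iexp (t * y) - m t) \<le> (a * K * B * (a * K)) * cmod (fourier g t)"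
      by (simp only: mult_ac)
  qed
  have main: "Re (LINT t:?I|lborel. m t) = a / h * kw ((y - x) / h)"
  proof -
    have "Re (LINT t:?I|lborel. m t) = (LINT t|lborel. Re (indicator ?I t *\<^sub>R m t))"
      unfolding set_lebesgue_integral_def
      by (rule integral_Re[symmetric]) (use i1 in \<open>simp add: set_integrable_def\<close>)
    also have "\<dots> = (LINT t|lborel. indicator ?I t * (a * (cos (t * (y - x)) * Re (fourier w (h * t)))))"
    proof (intro Bochner_Integration.integral_cong refl)
      fix t :: real
      have "m t = of_real a * (iexp (t * (y - x)) * fourier w (h * t))"
        unfolding m_def by (simp add: exp_add[symmetric] algebra_simps)
      then have "Re (m t) = a * (cos (t * (y - x)) * Re (fourier w (h * t)))"
        using w_real[of "h * t"] by (simp add: Re_exp)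
      then show "Re (indicator ?I t *\<^sub>R m t) = indicator ?I t * (a * (cos (t * (y - x)) * Re (fourier w (h * t))))"
        by simp
    qed
    \<comment> \<open>The substitution \<open>t = s / h\<close> moves the bandwidth out of the
      transform and produces the argument \<open>(y - x) / h\<close>.\<close>
    also have "\<dots> = \<bar>1 / h\<bar> *\<^sub>R (LINT s|lborel. indicator ?I (0 + 1 / h * s) * (a * (cos ((0 + 1 / h * s) * (y - x)) * Re (fourier w (h * (0 + 1 / h * s))))))"
      by (rule lborel_integral_real_affine) (use h in simp)
    also have "(LINT s|lborel. indicator ?I (0 + 1 / h * s) * (a * (cos ((0 + 1 / h * s) * (y - x)) * Re (fourier w (h * (0 + 1 / h * s))))))
       = (LINT s|lborel. a * (indicator {-1..1} s *\<^sub>R (cos (s * ((y - x) / h)) * Re (fourier w s))))"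
      using h by (intro Bochner_Integration.integral_cong refl) (auto simp: indicator_def field_simps)
    also have "\<dots> = a * kw ((y - x) / h)" unfolding kw_def set_lebesgue_integral_def by simp
    finally show ?thesis using h by simp
  qed
  have "Kf h y - \<kappa> * a / h * kw ((y - x) / h) = Re (of_real \<kappa> * (LINT t:?I|lborel. b h t * iexp (t * y) - m t))"
    unfolding Kf_S Ssplit using main by (simp add: distrib_left)
  also have "\<bar>\<dots>\<bar> \<le> \<kappa> * (LINT t|lborel. (a * K * B * (a * K)) * cmod (fourier g t))"
    by (rule abs_Re_\<kappa>_le[OF r])
  also have "\<dots> = \<kappa> * (a * K * B * (a * K) * J)" by (simp add: J_def)
  finally show ?thesis .
qed

text \<open>For the lower bound only a window around \<open>x + h * u0\<close> is kept, with
  \<open>u0\<close> a point where \<open>kw\<close> does not vanish. There \<open>Kf\<close> squared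
  is at least of order 1/h squared up to a bounded error, and by continuity of \<open>g\<close> at
  \<open>x\<close> the window has probability at least of order \<open>h\<close>. Bounded errors are
  absorbed for small \<open>h\<close>.\<close>

lemma variance_bounds:
  "\<exists>h1 v V. h1 > 0 \<and> v > 0 \<and> V > 0 \<and> (\<forall>h. 0 < h \<and> h < h1 \<longrightarrow> ok h \<and>
     v / h \<le> (LINT y|G. (Kf h y - mK h)\<^sup>2) \<and> (LINT y|G. (Kf h y - mK h)\<^sup>2) \<le> V / h)"
proof -
  obtain h0 where h0: "h0 > 0" "\<And>h. 0 < h \<Longrightarrow> h < h0 \<Longrightarrow> ok h" using ok_small by blast
  have gx: "g x > 0" using g_x g_nonneg[of x] by simp
  have "\<exists>u. (LINT s:{-1..1}|lborel. cos (s * u) * Re (fourier w s)) \<noteq> 0"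
    by (rule cos_transform_nonzero[OF Re_w_cont]) (simp add: w_0)
  then obtain u0 where u0: "kw u0 \<noteq> 0" unfolding kw_def by blast
  \<comment> \<open>On the neighbourhood of radius \<open>\<eta>\<close> the Lipschitz constant
    \<open>2 * K\<close> costs at most half of \<open>kw u0\<close>.\<close>
  define k1 where "k1 = \<bar>kw u0\<bar> / 2"
  define \<eta> where "\<eta> = k1 / (2 * K)"
  have k1: "k1 > 0" using u0 by (simp add: k1_def)
  have \<eta>: "\<eta> > 0" using k1 K_ge by (simp add: \<eta>_def)
  have klow: "\<bar>kw u\<bar> \<ge> k1" if "\<bar>u - u0\<bar> \<le> \<eta>" for u
  proof -
    have "\<bar>kw u - kw u0\<bar> \<le> 2 * K * \<bar>u - u0\<bar>" by (rule kw_lipschitz)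
    also have "\<dots> \<le> 2 * K * \<eta>" using that K_ge by (intro mult_left_mono) auto
    also have "\<dots> = k1" using K_ge by (simp add: \<eta>_def)
    finally show ?thesis unfolding k1_def by linarith
  qed
  have "isCont g x" using g_cont by (simp add: continuous_on_eq_continuous_at)
  then obtain d where d: "d > 0" "\<And>y. \<bar>y - x\<bar> < d \<Longrightarrow> \<bar>g y - g x\<bar> < g x / 2"
    using gx unfolding continuous_at_eps_delta dist_real_def by (meson half_gt_zero)
  define r where "r = \<kappa> * (a * K * B * (a * K) * J)"
  \<comment> \<open>The product of the lower bounds for \<open>Kf\<close> squared and for the
    probability of the window, multiplied by \<open>h\<close>.\<close>
  define c1 where "c1 = g x * \<eta> * (\<kappa> * a * k1)\<^sup>2 / 2"
  have c1: "c1 > 0" using gx \<eta> \<kappa>_pos a_pos k1 by (simp add: c1_def)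
  define R where "R = r\<^sup>2 + (\<kappa> * C0 * J)\<^sup>2"
  have R: "R \<ge> 0" by (simp add: R_def)
  \<comment> \<open>Three demands: \<open>ok h\<close>, the window stays where \<open>g\<close>
    exceeds half of \<open>g x\<close>, and the bounded terms \<open>R\<close> take at most half of
    \<open>c1 / h\<close>.\<close>
  define h1 where "h1 = min h0 (min (d / (\<bar>u0\<bar> + \<eta> + 1)) (c1 / (2 * (R + 1))))"
  have h1: "h1 > 0" using h0 d \<eta> c1 R by (simp add: h1_def)
  \<comment> \<open>Adding 1 to the upper constant makes it positive without a lower bound on
    \<open>J\<close>.\<close>
  have "ok h \<and> (c1 / 2) / h \<le> (LINT y|G. (Kf h y - mK h)\<^sup>2) \<and>
      (LINT y|G. (Kf h y - mK h)\<^sup>2) \<le> (\<kappa>\<^sup>2 * (C0\<^sup>2 * J * 2) + 1) / h" if h: "0 < h" "h < h1" for h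
  proof (intro conjI)
    show ok: "ok h" using h h0 by (simp add: h1_def)
    note [measurable] = Kf_meas[OF ok]
    have var: "(LINT y|G. (Kf h y - mK h)\<^sup>2) = (LINT y|G. (Kf h y)\<^sup>2) - (mK h)\<^sup>2"
      using G.variance_eq[OF Kf_int[OF ok]] unfolding Kf_expectation[OF ok] .
    have "(LINT y|G. (Kf h y)\<^sup>2) \<le> \<kappa>\<^sup>2 * (C0\<^sup>2 * J * 2) / h"
      using Kf_second_moment[OF ok] by simp
    also have "\<dots> \<le> (\<kappa>\<^sup>2 * (C0\<^sup>2 * J * 2) + 1) / h" using h by (intro divide_right_mono) auto
    finally show "(LINT y|G. (Kf h y - mK h)\<^sup>2) \<le> (\<kappa>\<^sup>2 * (C0\<^sup>2 * J * 2) + 1) / h"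
      unfolding var using zero_le_power2[of "mK h"] by linarith
    define A where "A = {x + h * (u0 - \<eta>) .. x + h * (u0 + \<eta>)}"
    have hd: "h * (\<bar>u0\<bar> + \<eta> + 1) < d" using h \<eta> by (simp add: h1_def field_simps)
    have gA: "g y \<ge> g x / 2" if "y \<in> A" for y
    proof -
      have "\<bar>y - x\<bar> \<le> h * (\<bar>u0\<bar> + \<eta>)"
      proof -
        have "y - x \<le> h * (u0 + \<eta>)" "h * (u0 - \<eta>) \<le> y - x" using that by (auto simp: A_def)
        moreover have "h * (u0 + \<eta>) \<le> h * (\<bar>u0\<bar> + \<eta>)" using h by (intro mult_left_mono) auto
        moreover have "- (h * (\<bar>u0\<bar> + \<eta>)) \<le> h * (u0 - \<eta>)"
          unfolding mult_minus_right[symmetric] using h by (intro mult_left_mono) auto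
        ultimately show ?thesis by (auto simp: abs_le_iff)
      qed
      also have "\<dots> < h * (\<bar>u0\<bar> + \<eta> + 1)" using h by (intro mult_strict_left_mono) auto
      also note hd
      finally show ?thesis using d(2)[of y] by linarith
    qed
    have PA: "measure G A \<ge> g x * \<eta> * h"
    proof -
      have "ennreal (g x * \<eta> * h) = ennreal (g x / 2) * ennreal (2 * \<eta> * h)"
        using gx \<eta> h by (simp add: ennreal_mult[symmetric] mult_ac)
      also have "ennreal (2 * \<eta> * h) = emeasure lborel A"
        using h \<eta> unfolding A_def by (subst emeasure_lborel_Icc) (auto simp: algebra_simps)
      also have "ennreal (g x / 2) * emeasure lborel A = (\<integral>\<^sup>+y. ennreal (g x / 2) * indicator A y \<partial>lborel)"
        by (subst nn_integral_cmult_indicator) (auto simp: A_def)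
      also have "\<dots> \<le> (\<integral>\<^sup>+y. ennreal (g y) * indicator A y \<partial>lborel)"
        using gA by (intro nn_integral_mono) (auto simp: indicator_def intro!: ennreal_leI)
      also have "\<dots> = emeasure G A" unfolding G_def by (subst emeasure_density) (auto simp: A_def)
      finally show ?thesis by (simp add: G.emeasure_eq_measure)
    qed
    \<comment> \<open>Half of the squared lower bound for the kernel term \<open>p\<close>; the
      other half is lost in passing from \<open>p\<close> to \<open>Kf h y\<close> by
      \<open>p\<^sup>2 \<le> 2 * (Kf h y)\<^sup>2 + 2 * (Kf h y - p)\<^sup>2\<close>.\<close>
    define q where "q = (\<kappa> * a / h * k1)\<^sup>2 / 2"
    have low: "q * indicator A y - r\<^sup>2 \<le> (Kf h y)\<^sup>2" for y
    proof (cases "y \<in> A")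
      case True
      define p where "p = \<kappa> * a / h * kw ((y - x) / h)"
      have "\<bar>(y - x) / h - u0\<bar> \<le> \<eta>"
        using True h by (auto simp: A_def abs_le_iff field_simps)
      then have "k1 \<le> \<bar>kw ((y - x) / h)\<bar>" by (rule klow)
      then have "(\<kappa> * a / h) * k1 \<le> (\<kappa> * a / h) * \<bar>kw ((y - x) / h)\<bar>"
        using h \<kappa>_pos a_pos by (intro mult_left_mono) auto
      then have "(\<kappa> * a / h) * k1 \<le> \<bar>p\<bar>" using h \<kappa>_pos a_pos by (simp add: p_def abs_mult)
      then have "((\<kappa> * a / h) * k1)\<^sup>2 \<le> \<bar>p\<bar>\<^sup>2"
        by (rule power_mono) (use h \<kappa>_pos a_pos k1 in simp)
      then have pq: "2 * q \<le> p\<^sup>2" by (simp add: q_def)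
      have "\<bar>Kf h y - p\<bar> \<le> r" unfolding p_def r_def by (rule Kf_approx[OF ok])
      then have "\<bar>Kf h y - p\<bar>\<^sup>2 \<le> r\<^sup>2" by (rule power_mono) simp
      then have "(Kf h y - p)\<^sup>2 \<le> r\<^sup>2" by simp
      moreover have "p\<^sup>2 \<le> 2 * (Kf h y)\<^sup>2 + 2 * (Kf h y - p)\<^sup>2"
      proof -
        have "0 \<le> (2 * Kf h y - p)\<^sup>2" by simp
        then show ?thesis by (simp add: power2_eq_square algebra_simps)
      qed
      ultimately show ?thesis using pq True by simp
    next
      case False
      then show ?thesis using order_trans[OF _ zero_le_power2[of "Kf h y"], of "- r\<^sup>2"] by simp
    qed
    have "q * measure G A - r\<^sup>2 = (LINT y|G. q * indicator A y - r\<^sup>2)"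
      using G.prob_space by (subst Bochner_Integration.integral_diff) (auto simp: A_def G.emeasure_eq_measure)
    also have "\<dots> \<le> (LINT y|G. (Kf h y)\<^sup>2)"
      by (rule integral_mono[OF _ Kf_int(2)[OF ok] low]) (auto simp: A_def G.emeasure_eq_measure)
    finally have "q * measure G A - r\<^sup>2 \<le> (LINT y|G. (Kf h y)\<^sup>2)" .
    moreover have "q * (g x * \<eta> * h) \<le> q * measure G A"
      using PA by (intro mult_left_mono) (simp_all add: q_def)
    moreover have "q * (g x * \<eta> * h) = c1 / h"
      using h by (simp add: q_def c1_def power2_eq_square mult_ac)
    moreover have "(mK h)\<^sup>2 \<le> (\<kappa> * C0 * J)\<^sup>2"
    proof -
      have "\<bar>mK h\<bar>\<^sup>2 \<le> (\<kappa> * C0 * J)\<^sup>2" by (rule power_mono[OF mK_le[OF ok]]) simp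
      then show ?thesis by simp
    qed
    ultimately have "c1 / h - R \<le> (LINT y|G. (Kf h y - mK h)\<^sup>2)" unfolding var R_def by linarith
    moreover have "R \<le> (c1 / 2) / h"
    proof -
      have "h * (2 * (R + 1)) < c1" using h R by (simp add: h1_def field_simps)
      then show ?thesis using h by (simp add: field_simps)
    qed
    moreover have "c1 / h = (c1 / 2) / h + (c1 / 2) / h" by (simp add: field_simps)
    ultimately show "(c1 / 2) / h \<le> (LINT y|G. (Kf h y - mK h)\<^sup>2)" by linarith
  qed
  moreover have "\<kappa>\<^sup>2 * (C0\<^sup>2 * J * 2) + 1 > 0" using J_nonneg by (intro add_nonneg_pos) auto
  ultimately show ?thesis using h1 c1
    by (intro exI[of _ h1] exI[of _ "c1 / 2"] exI[of _ "\<kappa>\<^sup>2 * (C0\<^sup>2 * J * 2) + 1"]) auto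
qed

end

section \<open>Deviations of the empirical characteristic function\<close>

text \<open>Cauchy-Schwarz on an interval of length 2/h, read off from the integrated squared
  distance of \<open>u\<close> to its average \<open>m\<close>.\<close>

lemma square_set_integral_le:
  fixes u :: "real \<Rightarrow> real"
  assumes "continuous_on UNIV u" and h: "h > 0"
  shows "(LINT t:{-(1/h)..1/h}|lborel. u t)\<^sup>2 \<le> (2 / h) * (LINT t:{-(1/h)..1/h}|lborel. (u t)\<^sup>2)"
proof -
  let ?I = "{-(1/h)..1/h}"
  define m where "m = (h / 2) * (LINT t:?I|lborel. u t)"
  have i: "set_integrable lborel ?I v" if "continuous_on UNIV v" for v :: "real \<Rightarrow> real"
    by (intro borel_integrable_atLeastAtMost') (auto intro: continuous_on_subset[OF that])
  have i1: "set_integrable lborel ?I (\<lambda>t. (u t)\<^sup>2)" "set_integrable lborel ?I (\<lambda>t. 2 * m * u t)" "set_integrable lborel ?I (\<lambda>t. m\<^sup>2)"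
      "set_integrable lborel ?I (\<lambda>t. (u t)\<^sup>2 - 2 * m * u t)"
    by (intro i continuous_intros assms)+
  have "0 \<le> (LINT t:?I|lborel. (u t - m)\<^sup>2)"
    unfolding set_lebesgue_integral_def by (rule Bochner_Integration.integral_nonneg) simp
  also have "\<dots> = (LINT t:?I|lborel. (u t)\<^sup>2 - 2 * m * u t + m\<^sup>2)"
    by (rule set_lebesgue_integral_cong) (auto simp: power2_diff algebra_simps)
  also have "\<dots> = (LINT t:?I|lborel. (u t)\<^sup>2) - 2 * m * (LINT t:?I|lborel. u t) + m\<^sup>2 * (2 / h)"
  proof -
    have "(LINT t:?I|lborel. m\<^sup>2) = m\<^sup>2 * (2 / h)"
      unfolding set_lebesgue_integral_def using h by simp
    then show ?thesis
      unfolding set_integral_add(2)[OF i1(4) i1(3)] set_integral_diff(2)[OF i1(1) i1(2)] set_integral_mult_right by simp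
  qed
  also have "\<dots> = (LINT t:?I|lborel. (u t)\<^sup>2) - (h / 2) * (LINT t:?I|lborel. u t)\<^sup>2"
    unfolding m_def using h by (simp add: power2_eq_square field_simps)
  finally have "(h / 2) * (LINT t:?I|lborel. u t)\<^sup>2 \<le> (LINT t:?I|lborel. (u t)\<^sup>2)" by simp
  then have "(2 / h) * ((h / 2) * (LINT t:?I|lborel. u t)\<^sup>2) \<le> (2 / h) * (LINT t:?I|lborel. (u t)\<^sup>2)"
    by (rule mult_left_mono) (use h in simp)
  then show ?thesis using h by simp
qed

context decompounding
begin

lemma Z_integral:
  fixes u :: "real \<Rightarrow> 'b::{banach, second_countable_topology}"
  assumes "u \<in> borel_measurable borel"
  shows "(\<integral>\<omega>. u (Z k \<omega>) \<partial>Q) = (\<integral>y. u y \<partial>G)"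
  using integral_distr[OF Z_meas[of k] assms] unfolding Z_distr G_def by simp

lemma Z_indep_fun:
  assumes "u \<in> borel_measurable borel"
  shows "indep_vars (\<lambda>_. borel) (\<lambda>j \<omega>. u (Z j \<omega>) :: real) {..<n}"
  using indep_vars_subset[OF indep_vars_compose2[OF Z_indep, of "\<lambda>_. u" "\<lambda>_. borel"]] assms by auto

text \<open>After centring and division by the square root of \<open>n\<close> the summands are
  bounded by 2 and their variances add up to at most 4, so the general fourth-moment bound gives a
  constant independent of \<open>n\<close>.\<close>

lemma mean_fourth_moment:
  fixes u :: "real \<Rightarrow> real"
  assumes u[measurable]: "u \<in> borel_measurable borel" and le: "\<And>y. \<bar>u y\<bar> \<le> 1" and n: "n \<ge> 1"
  shows "expectation (\<lambda>\<omega>. ((\<Sum>j<n. u (Z j \<omega>)) / n - (LINT y|G. u y)) ^ 4) \<le> 48 * exp (4 * exp 2) / (real n)\<^sup>2"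
proof -
  define m where "m = (LINT y|G. u y)"
  have intu: "integrable G u" by (rule G.integrable_const_bound[where B=1]) (use le in auto)
  have m: "\<bar>m\<bar> \<le> 1"
    using G.integrable_const_bound intu le G.prob_space
      order_trans[OF integral_abs_bound[of G u] integral_mono[OF integrable_abs[OF intu] G.integrable_const[of 1]]]
    by (simp add: m_def)
  define \<xi> where "\<xi> j \<omega> = (u (Z j \<omega>) - m) / sqrt n" for j \<omega>
  have sn: "sqrt n \<ge> 1" using n by simp
  have b0: "\<bar>u y - m\<bar> \<le> 2" for y using le[of y] m by linarith
  have bnd: "\<bar>\<xi> j \<omega>\<bar> \<le> 2" for j \<omega>
  proof -
    have "\<bar>u (Z j \<omega>) - m\<bar> / sqrt n \<le> 2 / 1" using b0 sn by (intro frac_le) auto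
    then show ?thesis using sn by (simp add: \<xi>_def abs_divide)
  qed
  have ind: "indep_vars (\<lambda>_. borel) \<xi> {..<n}"
    unfolding \<xi>_def[abs_def] by (rule Z_indep_fun) simp
  have mean: "expectation (\<xi> j) = 0" for j
  proof -
    have "expectation (\<xi> j) = (LINT y|G. (u y - m) / sqrt n)"
      unfolding \<xi>_def[abs_def] by (rule Z_integral) simp
    then show ?thesis using intu G.prob_space by (simp add: m_def)
  qed
  have sq: "(\<xi> j \<omega>)\<^sup>2 \<le> 4 / n" for j \<omega>
  proof -
    have "\<bar>u (Z j \<omega>) - m\<bar>\<^sup>2 \<le> 2\<^sup>2" by (rule power_mono[OF b0]) simp
    then show ?thesis by (simp add: \<xi>_def power_divide divide_right_mono)
  qed
  have [measurable]: "\<xi> j \<in> borel_measurable Q" for j unfolding \<xi>_def[abs_def] by measurable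
  have var1: "expectation (\<lambda>\<omega>. (\<xi> j \<omega>)\<^sup>2) \<le> 4 / n" for j
  proof -
    have "expectation (\<lambda>\<omega>. (\<xi> j \<omega>)\<^sup>2) \<le> expectation (\<lambda>\<omega>. 4 / n)"
      by (rule integral_mono') (use sq in auto)
    then show ?thesis by (simp add: prob_space)
  qed
  have var: "(\<Sum>j<n. expectation (\<lambda>\<omega>. (\<xi> j \<omega>)\<^sup>2)) \<le> 4"
    using sum_mono[of "{..<n}" "\<lambda>j. expectation (\<lambda>\<omega>. (\<xi> j \<omega>)\<^sup>2)" "\<lambda>_. 4 / real n"] var1 n by simp
  have eq: "(\<Sum>j<n. u (Z j \<omega>)) / n - m = (\<Sum>j<n. \<xi> j \<omega>) / sqrt n" for \<omega>
  proof -
    have "(\<Sum>j<n. \<xi> j \<omega>) / sqrt n = (\<Sum>j<n. u (Z j \<omega>) - m) / (sqrt n * sqrt n)"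
      by (simp only: \<xi>_def sum_divide_distrib[symmetric] divide_divide_eq_left)
    also have "\<dots> = (\<Sum>j<n. u (Z j \<omega>)) / n - m" using n by (simp add: sum_subtractf diff_divide_distrib)
    finally show ?thesis by simp
  qed
  have s4: "sqrt (real n) ^ 4 = (real n)\<^sup>2"
    using real_sqrt_pow2[of "real n"] by (simp add: power4_eq_xxxx power2_eq_square)
  have "expectation (\<lambda>\<omega>. ((\<Sum>j<n. u (Z j \<omega>)) / n - m) ^ 4) = expectation (\<lambda>\<omega>. (\<Sum>j<n. \<xi> j \<omega>) ^ 4) / (real n)\<^sup>2"
    unfolding eq power_divide s4 by simp
  also have "\<dots> \<le> 48 * exp (4 * exp 2) / (real n)\<^sup>2"
    by (intro divide_right_mono fourth_moment_sum_indep_le[OF _ ind bnd mean var]) auto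
  finally show ?thesis unfolding m_def .
qed

definition "dev n \<omega> t = emp_cf n (\<lambda>k. Z k \<omega>) t - fourier g t"

lemma iexp_int: "complex_integrable G (\<lambda>y. iexp (t * y))"
  by (rule G.integrable_const_bound[where B=1]) auto

lemma Re_fg: "Re (fourier g t) = (LINT y|G. cos (t * y))"
  and Im_fg: "Im (fourier g t) = (LINT y|G. sin (t * y))"
proof -
  have "Re (fourier g t) = (LINT y|G. Re (iexp (t * y)))"
    unfolding fg_char char_def by (rule integral_Re[OF iexp_int, symmetric])
  then show "Re (fourier g t) = (LINT y|G. cos (t * y))" by (simp add: Re_exp)
  have "Im (fourier g t) = (LINT y|G. Im (iexp (t * y)))"
    unfolding fg_char char_def by (rule integral_Im[OF iexp_int, symmetric])
  then show "Im (fourier g t) = (LINT y|G. sin (t * y))" by (simp add: Im_exp)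
qed

lemma Re_emp: "Re (emp_cf n z t) = (\<Sum>j<n. cos (t * z j)) / n"
  and Im_emp: "Im (emp_cf n z t) = (\<Sum>j<n. sin (t * z j)) / n"
proof -
  have "emp_cf n z t = of_real (1 / n) * (\<Sum>j<n. iexp (t * z j))" by (simp add: emp_cf_def)
  then show "Re (emp_cf n z t) = (\<Sum>j<n. cos (t * z j)) / n" "Im (emp_cf n z t) = (\<Sum>j<n. sin (t * z j)) / n"
    by (simp_all add: Re_exp Im_exp)
qed

lemma Re_dev: "Re (dev n \<omega> t) = (\<Sum>j<n. cos (t * Z j \<omega>)) / n - (LINT y|G. cos (t * y))"
  and Im_dev: "Im (dev n \<omega> t) = (\<Sum>j<n. sin (t * Z j \<omega>)) / n - (LINT y|G. sin (t * y))"
  by (simp_all add: dev_def Re_emp Im_emp Re_fg Im_fg)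

lemma dev_meas[measurable]: "(\<lambda>p. dev n (snd p) (fst p)) \<in> borel_measurable (lborel \<Otimes>\<^sub>M Q)"
  "(\<lambda>\<omega>. dev n \<omega> t) \<in> borel_measurable Q"
  unfolding dev_def emp_cf_def by measurable

lemma emp_le: "cmod (emp_cf n z t) \<le> 1"
proof -
  have "cmod (\<Sum>j<n. iexp (t * z j)) \<le> (\<Sum>j<n. cmod (iexp (t * z j)))" by (rule norm_sum)
  also have "\<dots> = n" by simp
  finally have "cmod (emp_cf n z t) \<le> (1 / n) * n"
    unfolding emp_cf_def norm_mult by (intro mult_mono) (auto simp: norm_divide)
  also have "\<dots> \<le> 1" by simp
  finally show ?thesis .
qed

lemma dev_le: "cmod (dev n \<omega> t) \<le> 2"
  unfolding dev_def using norm_triangle_ineq4[of "emp_cf n (\<lambda>k. Z k \<omega>) t" "fourier g t"]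
    emp_le[of n "\<lambda>k. Z k \<omega>" t] fg_le[of t] by linarith

lemma dev_cont: "continuous_on UNIV (dev n \<omega>)"
  unfolding dev_def by (intro continuous_intros emp_cont fg_cont)

text \<open>192 = 4 * 48: real and imaginary part each contribute 48, doubled by squaring the sum of
  their squares.\<close>

definition "C4 = 192 * exp (4 * exp 2 :: real)"

lemma dev_fourth_moment: assumes n: "n \<ge> 1"
  shows "expectation (\<lambda>\<omega>. cmod (dev n \<omega> t) ^ 4) \<le> C4 / (real n)\<^sup>2"
proof -
  let ?R = "\<lambda>\<omega>. Re (dev n \<omega> t)" and ?J = "\<lambda>\<omega>. Im (dev n \<omega> t)"
  have i: "integrable Q (\<lambda>\<omega>. ?R \<omega> ^ 4)" "integrable Q (\<lambda>\<omega>. ?J \<omega> ^ 4)"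
  proof -
    have "\<bar>?R \<omega>\<bar> ^ 4 \<le> 2 ^ 4" "\<bar>?J \<omega>\<bar> ^ 4 \<le> 2 ^ 4" for \<omega>
      by (rule power_mono[OF order_trans[OF abs_Re_le_cmod dev_le] abs_ge_zero],
          rule power_mono[OF order_trans[OF abs_Im_le_cmod dev_le] abs_ge_zero])
    then show "integrable Q (\<lambda>\<omega>. ?R \<omega> ^ 4)" "integrable Q (\<lambda>\<omega>. ?J \<omega> ^ 4)"
      by (auto intro!: integrable_const_bound[where B=16] simp: power_abs)
  qed
  have "expectation (\<lambda>\<omega>. cmod (dev n \<omega> t) ^ 4) \<le> expectation (\<lambda>\<omega>. 2 * ?R \<omega> ^ 4 + 2 * ?J \<omega> ^ 4)"
  proof (rule integral_mono')
    fix \<omega>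
    have "cmod (dev n \<omega> t) ^ 4 = ((cmod (dev n \<omega> t))\<^sup>2)\<^sup>2" by simp
    also have "\<dots> = ((?R \<omega>)\<^sup>2 + (?J \<omega>)\<^sup>2)\<^sup>2" by (simp add: cmod_power2)
    also have "\<dots> \<le> 2 * ((?R \<omega>)\<^sup>2)\<^sup>2 + 2 * ((?J \<omega>)\<^sup>2)\<^sup>2"
      using sum_squares_bound[of "(?R \<omega>)\<^sup>2" "(?J \<omega>)\<^sup>2"] by (simp only: power2_sum)
    finally show "cmod (dev n \<omega> t) ^ 4 \<le> 2 * ?R \<omega> ^ 4 + 2 * ?J \<omega> ^ 4" by simp
  qed (use i in auto)
  also have "\<dots> = 2 * expectation (\<lambda>\<omega>. ?R \<omega> ^ 4) + 2 * expectation (\<lambda>\<omega>. ?J \<omega> ^ 4)" using i by simp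
  also have "\<dots> \<le> 2 * (48 * exp (4 * exp 2) / (real n)\<^sup>2) + 2 * (48 * exp (4 * exp 2) / (real n)\<^sup>2)"
    unfolding Re_dev Im_dev by (intro add_mono mult_left_mono mean_fourth_moment n) auto
  finally show ?thesis by (simp add: C4_def)
qed

text \<open>Cauchy-Schwarz in \<open>t\<close> reduces the squared integral to an integral of fourth
  powers. Each of the two integrations over the interval costs a factor 2/h, and the pointwise
  fourth moment is of order 1/n squared.\<close>

lemma dev_square_integral:
  assumes n: "n \<ge> 1" and h: "h > 0"
  shows "integrable Q (\<lambda>\<omega>. (LINT t:{-(1/h)..1/h}|lborel. (cmod (dev n \<omega> t))\<^sup>2)\<^sup>2)"
    and "expectation (\<lambda>\<omega>. (LINT t:{-(1/h)..1/h}|lborel. (cmod (dev n \<omega> t))\<^sup>2)\<^sup>2) \<le> 4 * C4 / (h * n)\<^sup>2"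
proof -
  let ?I = "{-(1/h)..1/h}"
  let ?R = "\<lambda>\<omega>. (LINT t:?I|lborel. (cmod (dev n \<omega> t))\<^sup>2)"
  have le4: "cmod (dev n \<omega> t) ^ 4 \<le> 16" for \<omega> t
    using power_mono[OF dev_le, of n \<omega> t 4] by simp
  note sw = integral_swap_dominated[where F="\<lambda>t \<omega>. indicator ?I t *\<^sub>R cmod (dev n \<omega> t) ^ 4"
      and b="\<lambda>t. 16 * indicator ?I t", OF _ indicator_bound_integral(1)[OF h]]
  have swm: "(\<lambda>p. indicator ?I (fst p) *\<^sub>R cmod (dev n (snd p) (fst p)) ^ 4) \<in> borel_measurable (lborel \<Otimes>\<^sub>M Q)"
    by measurable
  have swle: "norm (indicator ?I t *\<^sub>R cmod (dev n \<omega> t) ^ 4) \<le> 16 * indicator ?I t" for t \<omega>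
    using le4 by (simp add: indicator_def)
  have pw: "(?R \<omega>)\<^sup>2 \<le> (2 / h) * (LINT t|lborel. indicator ?I t *\<^sub>R cmod (dev n \<omega> t) ^ 4)" for \<omega>
  proof -
    have "continuous_on UNIV (\<lambda>t. (cmod (dev n \<omega> t))\<^sup>2)" by (intro continuous_intros dev_cont)
    from square_set_integral_le[OF this h] show ?thesis
      unfolding set_lebesgue_integral_def[of _ _ "\<lambda>t. ((cmod (dev n \<omega> t))\<^sup>2)\<^sup>2"] by simp
  qed
  have i2: "integrable Q (\<lambda>\<omega>. (2 / h) * (LINT t|lborel. indicator ?I t *\<^sub>R cmod (dev n \<omega> t) ^ 4))"
    by (intro integrable_mult_right sw(3)[OF swm swle])
  have Rm: "?R \<in> borel_measurable Q"
  proof -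
    have "(\<lambda>p. indicator ?I (snd p) *\<^sub>R (cmod (dev n (fst p) (snd p)))\<^sup>2) \<in> borel_measurable (Q \<Otimes>\<^sub>M lborel)"
      unfolding dev_def emp_cf_def by measurable
    then show ?thesis unfolding set_lebesgue_integral_def
      by (intro lborel.borel_measurable_lebesgue_integral) (simp add: case_prod_beta')
  qed
  show iR: "integrable Q (\<lambda>\<omega>. (?R \<omega>)\<^sup>2)"
    by (rule Bochner_Integration.integrable_bound[OF i2])
       (use Rm h in \<open>auto intro!: AE_I2 order_trans[OF pw]\<close>)
  have "expectation (\<lambda>\<omega>. (?R \<omega>)\<^sup>2) \<le> expectation (\<lambda>\<omega>. (2 / h) * (LINT t|lborel. indicator ?I t *\<^sub>R cmod (dev n \<omega> t) ^ 4))"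
    by (rule integral_mono[OF iR i2 pw])
  also have "\<dots> = (2 / h) * expectation (\<lambda>\<omega>. (LINT t|lborel. indicator ?I t *\<^sub>R cmod (dev n \<omega> t) ^ 4))"
    by (rule integral_mult_right_zero)
  also have "\<dots> \<le> (2 / h) * ((C4 / (real n)\<^sup>2) * (2 / h))"
  proof (rule mult_left_mono)
    have "expectation (\<lambda>\<omega>. (LINT t|lborel. indicator ?I t *\<^sub>R cmod (dev n \<omega> t) ^ 4))
       = (LINT t|lborel. expectation (\<lambda>\<omega>. indicator ?I t *\<^sub>R cmod (dev n \<omega> t) ^ 4))"
      by (rule sw(1)[OF swm swle])
    also have "\<dots> \<le> (LINT t|lborel. (C4 / (real n)\<^sup>2) * indicator ?I t)"
    proof (rule integral_mono[OF sw(2)[OF swm swle] indicator_bound_integral(1)[OF h]])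
      fix t
      show "expectation (\<lambda>\<omega>. indicator ?I t *\<^sub>R cmod (dev n \<omega> t) ^ 4) \<le> (C4 / (real n)\<^sup>2) * indicator ?I t"
        using dev_fourth_moment[OF n, of t] by (simp add: indicator_def)
    qed
    also have "\<dots> = (C4 / (real n)\<^sup>2) * (2 / h)" by (rule indicator_bound_integral(2)[OF h])
    finally show "expectation (\<lambda>\<omega>. (LINT t|lborel. indicator ?I t *\<^sub>R cmod (dev n \<omega> t) ^ 4)) \<le> (C4 / (real n)\<^sup>2) * (2 / h)" .
  qed (use h in simp)
  also have "(2 / h) * ((C4 / (real n)\<^sup>2) * (2 / h)) = 4 * C4 / (h * n)\<^sup>2"
    by (simp add: power2_eq_square)
  finally show "expectation (\<lambda>\<omega>. (?R \<omega>)\<^sup>2) \<le> 4 * C4 / (h * n)\<^sup>2" .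
qed

text \<open>The range [-2,2] has length 4, so the Hoeffding exponent
  \<open>2 * (n * \<eta>)\<^sup>2 / (16 * n)\<close> equals
  \<open>\<eta>\<^sup>2 / 8 * n\<close>.\<close>

lemma hoeffding_mean:
  fixes u :: "real \<Rightarrow> real"
  assumes u[measurable]: "u \<in> borel_measurable borel" and le: "\<And>y. \<bar>u y\<bar> \<le> 2" and n: "n \<ge> 1" and \<eta>: "\<eta> > 0"
  shows "prob {\<omega>\<in>space Q. \<bar>(\<Sum>j<n. u (Z j \<omega>)) / n - (LINT y|G. u y)\<bar> \<ge> \<eta>} \<le> 2 * exp (- (\<eta>\<^sup>2 / 8) * n)"
proof -
  interpret H: Hoeffding_ineq Q "{..<n}" "\<lambda>j \<omega>. u (Z j \<omega>)" "\<lambda>_. -2" "\<lambda>_. 2" "n * (LINT y|G. u y)"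
  proof unfold_locales
    show "indep_vars (\<lambda>_. borel) (\<lambda>j \<omega>. u (Z j \<omega>)) {..<n}" by (rule Z_indep_fun) simp
    have "u y \<in> {- 2..2}" for y using le[of y] unfolding atLeastAtMost_iff by linarith
    then show "AE \<omega> in Q. u (Z i \<omega>) \<in> {- 2..2}" for i by simp
    show "real n * (LINT y|G. u y) \<equiv> (\<Sum>i<n. expectation (\<lambda>\<omega>. u (Z i \<omega>)))"
      by (subst Z_integral) auto
  qed auto
  have "{\<omega>\<in>space Q. \<bar>(\<Sum>j<n. u (Z j \<omega>)) / n - (LINT y|G. u y)\<bar> \<ge> \<eta>}
     = {\<omega>\<in>space Q. \<bar>(\<Sum>j<n. u (Z j \<omega>)) - n * (LINT y|G. u y)\<bar> \<ge> n * \<eta>}"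
  proof -
    have "\<bar>p / n - q\<bar> \<ge> \<eta> \<longleftrightarrow> \<bar>p - n * q\<bar> \<ge> n * \<eta>" for p q :: real
    proof -
      have "p - n * q = n * (p / n - q)" using n by (simp add: right_diff_distrib)
      then have "\<bar>p - n * q\<bar> = n * \<bar>p / n - q\<bar>" by (simp add: abs_mult)
      then show ?thesis using n by simp
    qed
    then show ?thesis by simp
  qed
  also have "prob \<dots> \<le> 2 * exp (- 2 * (n * \<eta>)\<^sup>2 / (\<Sum>i<n. (2 - (-2))\<^sup>2))"
    by (rule H.Hoeffding_ineq_abs_ge) (use n \<eta> in auto)
  also have "- 2 * (n * \<eta>)\<^sup>2 / (\<Sum>i<n. (2 - (-2))\<^sup>2) = - (\<eta>\<^sup>2 / 8) * n"
    using n by (simp add: power2_eq_square)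
  finally show ?thesis .
qed

section \<open>Uniform exponential concentration on the frequency interval\<close>

lemma cmod_iexp_diff_le_min: "cmod (iexp p - iexp q) \<le> min 2 \<bar>p - q\<bar>"
  using cmod_iexp_diff_le[of p q] norm_triangle_ineq4[of "iexp p" "iexp q"] by simp

text \<open>The mesh depends only on \<open>\<epsilon>\<close> and the law of the observations, so
  \<open>c\<close> and \<open>D\<close> are the same for all \<open>h\<close> and \<open>n\<close>,
  and the number of grid points grows like 1/h. Between grid points the oscillation is bounded by
  the average of one function \<open>mo\<close> of the observations, to which Hoeffding's inequality
  applies as well.\<close>

lemma sup_concentration:
  assumes \<epsilon>: "\<epsilon> > 0"
  shows "\<exists>c D. c > 0 \<and> D > 0 \<and> (\<forall>h n. h > 0 \<longrightarrow> n \<ge> 1 \<longrightarrow> (\<exists>A\<in>events.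
     prob (space Q - A) \<le> D * (1 + 1 / h) * exp (- c * real n) \<and>
     (\<forall>\<omega>\<in>A. \<forall>t. \<bar>t\<bar> \<le> 1 / h \<longrightarrow> cmod (dev n \<omega> t) \<le> \<epsilon>)))"
proof -
  \<comment> \<open>The final triangle inequality spends at most 5 units \<open>\<eta>\<close>: two
    at the grid point, two on the empirical increment and one on the increment of
    \<open>fourier g\<close>.\<close>
  define \<eta> where "\<eta> = \<epsilon> / 8"
  have \<eta>: "\<eta> > 0" using \<epsilon> by (simp add: \<eta>_def)
  \<comment> \<open>Truncating the modulus at 2, the trivial bound for a difference of exponentials,
    lets dominated convergence work without a moment of the observations.\<close>
  have "(\<lambda>m. LINT y|G. min 2 (1 / real (Suc m) * \<bar>y\<bar>)) \<longlonglongrightarrow> (LINT y|G. 0)"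
  proof (rule integral_dominated_convergence[where w="\<lambda>_. 2"])
    show "AE y in G. (\<lambda>m. min 2 (1 / real (Suc m) * \<bar>y\<bar>)) \<longlonglongrightarrow> 0"
    proof (rule AE_I2)
      fix y :: real
      have "(\<lambda>m. \<bar>y\<bar> / real (Suc m)) \<longlonglongrightarrow> 0" by (intro LIMSEQ_Suc lim_const_over_n)
      then have "(\<lambda>m. min 2 (\<bar>y\<bar> / real (Suc m))) \<longlonglongrightarrow> min 2 0" by (intro tendsto_min tendsto_const)
      then show "(\<lambda>m. min 2 (1 / real (Suc m) * \<bar>y\<bar>)) \<longlonglongrightarrow> 0" by simp
    qed
  qed auto
  then have "\<forall>\<^sub>F m in sequentially. (LINT y|G. min 2 (1 / real (Suc m) * \<bar>y\<bar>)) < \<eta>"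
    using \<eta> by (intro order_tendstoD(2)) auto
  then obtain m where m: "(LINT y|G. min 2 (1 / real (Suc m) * \<bar>y\<bar>)) < \<eta>"
    by (meson eventually_happens' sequentially_bot)
  define \<delta> where "\<delta> = 1 / real (Suc m)"
  have \<delta>: "\<delta> > 0" by (simp add: \<delta>_def)
  define mo where "mo y = min 2 (\<delta> * \<bar>y\<bar>)" for y
  have mo: "(LINT y|G. mo y) < \<eta>" using m by (simp add: mo_def \<delta>_def)
  have mo_le: "\<bar>mo y\<bar> \<le> 2" and mo_ge: "0 \<le> mo y" for y using \<delta> by (auto simp: mo_def)
  have [measurable]: "mo \<in> borel_measurable borel" unfolding mo_def by measurable
  have mo_int: "integrable G mo" by (rule G.integrable_const_bound[where B=2]) (use mo_le in auto)
  have iexp_mo: "cmod (iexp (t * y) - iexp (s * y)) \<le> mo y" if "\<bar>t - s\<bar> \<le> \<delta>" for t s y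
  proof -
    have "\<bar>t * y - s * y\<bar> \<le> \<delta> * \<bar>y\<bar>"
      using that by (simp add: left_diff_distrib[symmetric] abs_mult mult_right_mono)
    then show ?thesis using cmod_iexp_diff_le_min[of "t * y" "s * y"] by (auto simp: mo_def)
  qed
  define c where "c = \<eta>\<^sup>2 / 8"
  \<comment> \<open>With \<open>r = 1 / (h * \<delta>)\<close> there are at most
    \<open>2 * (r + 1) + 1\<close> grid points, each carrying two Hoeffding bounds of weight 2, and
    \<open>mo\<close> carries one more: \<open>2 + 4 * (2 * r + 3) = 14 + 8 * r\<close>.\<close>
  define D where "D = 14 + 8 / \<delta>"
  have "\<exists>A\<in>events. prob (space Q - A) \<le> D * (1 + 1 / h) * exp (- c * real n) \<and>
     (\<forall>\<omega>\<in>A. \<forall>t. \<bar>t\<bar> \<le> 1 / h \<longrightarrow> cmod (dev n \<omega> t) \<le> \<epsilon>)" if h: "h > 0" and n: "n \<ge> 1" for h n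
  proof -
    define N where "N = \<lceil>1 / (h * \<delta>)\<rceil>"
    define I where "I = {-N..N}"
    define bad where "bad u = {\<omega>\<in>space Q. \<bar>(\<Sum>j<n. u (Z j \<omega>)) / n - (LINT y|G. u y)\<bar> \<ge> \<eta>}" for u
    have bad_ev[measurable]: "bad u \<in> events" if [measurable]: "u \<in> borel_measurable borel" for u
      unfolding bad_def by measurable
    have bad_pr: "prob (bad u) \<le> 2 * exp (- c * n)" if "u \<in> borel_measurable borel" "\<And>y. \<bar>u y\<bar> \<le> 2" for u
      unfolding bad_def c_def using hoeffding_mean[OF that n \<eta>] by simp
    define cs where "cs k = (\<lambda>y. cos ((of_int k * \<delta>) * y))" for k :: int
    define sn where "sn k = (\<lambda>y. sin ((of_int k * \<delta>) * y))" for k :: int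
    have [measurable]: "cs k \<in> borel_measurable borel" "sn k \<in> borel_measurable borel" for k
      unfolding cs_def sn_def by measurable
    \<comment> \<open>The exceptional event: the sample mean of \<open>mo\<close>, or of a cosine or
      sine at some grid frequency, is off by at least \<open>\<eta>\<close>.\<close>
    define U where "U = bad mo \<union> ((\<Union>k\<in>I. bad (cs k)) \<union> (\<Union>k\<in>I. bad (sn k)))"
    have finI: "finite I" by (simp add: I_def)
    have U1: "(\<Union>k\<in>I. bad (cs k)) \<in> events" "(\<Union>k\<in>I. bad (sn k)) \<in> events"
      using finI by (intro sets.finite_UN; simp)+
    then have U: "U \<in> events" unfolding U_def by simp
    have one: "prob (\<Union>k\<in>I. bad (v k)) \<le> card I * (2 * exp (- c * n))"
      if "\<And>k. v k \<in> borel_measurable borel" "\<And>k y. \<bar>v k y\<bar> \<le> 2" for v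
    proof -
      have "prob (\<Union>k\<in>I. bad (v k)) \<le> (\<Sum>k\<in>I. prob (bad (v k)))"
        using finI that by (intro finite_measure_subadditive_finite) auto
      also have "\<dots> \<le> card I * (2 * exp (- c * n))"
        using that by (intro sum_bounded_above bad_pr) auto
      finally show ?thesis .
    qed
    have cs2: "\<bar>cs k y\<bar> \<le> 2" "\<bar>sn k y\<bar> \<le> 2" for k y
      unfolding cs_def sn_def by (rule order_trans[OF abs_cos_le_one], simp) (rule order_trans[OF abs_sin_le_one], simp)
    have "prob U \<le> prob (bad mo) + prob ((\<Union>k\<in>I. bad (cs k)) \<union> (\<Union>k\<in>I. bad (sn k)))"
      unfolding U_def by (rule measure_Un_le) (use U1 in auto)
    also have "\<dots> \<le> prob (bad mo) + (prob (\<Union>k\<in>I. bad (cs k)) + prob (\<Union>k\<in>I. bad (sn k)))"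
      by (intro add_left_mono measure_Un_le U1)
    also have "\<dots> \<le> 2 * exp (- c * n) + (card I * (2 * exp (- c * n)) + card I * (2 * exp (- c * n)))"
      by (intro add_mono one bad_pr mo_le cs2) auto
    also have "\<dots> = (2 + 4 * real (card I)) * exp (- c * n)" by (simp add: algebra_simps)
    also have "\<dots> \<le> D * (1 + 1 / h) * exp (- c * n)"
    proof (rule mult_right_mono)
      have "0 < 1 / (h * \<delta>)" using h \<delta> by simp
      then have N0: "N \<ge> 0" unfolding N_def by linarith
      have cI: "real (card I) = 2 * real_of_int N + 1" using N0 by (simp add: I_def)
      have "2 * real_of_int \<lceil>r\<rceil> + 1 \<le> 2 * (r + 1) + 1" for r :: real
        by (rule add_right_mono, rule mult_left_mono[OF of_int_ceiling_le_add_one]) simp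
      then have "2 * real_of_int N + 1 \<le> 2 * (1 / (h * \<delta>) + 1) + 1" unfolding N_def .
      then have "2 + 4 * real (card I) \<le> 2 + 4 * (2 * (1 / (h * \<delta>) + 1) + 1)"
        unfolding cI by (intro add_left_mono mult_left_mono) auto
      also have "\<dots> = 14 + 8 * (1 / (h * \<delta>))" by (simp add: algebra_simps)
      also have "8 * (1 / (h * \<delta>)) = 8 / \<delta> * (1 / h)" by simp
      finally have "2 + 4 * real (card I) \<le> 14 + 8 / \<delta> * (1 / h)" .
      also have "\<dots> \<le> D * (1 + 1 / h)"
        using h \<delta> unfolding D_def distrib_left distrib_right by simp
      finally show "2 + 4 * real (card I) \<le> D * (1 + 1 / h)" .
    qed simp
    finally have PU: "prob U \<le> D * (1 + 1 / h) * exp (- c * n)" .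
    show ?thesis
    proof (intro bexI[of _ "space Q - U"] conjI ballI allI impI)
      show "space Q - U \<in> events" using U by auto
      have "space Q - (space Q - U) = U" using U sets.sets_into_space by auto
      then show "prob (space Q - (space Q - U)) \<le> D * (1 + 1 / h) * exp (- c * real n)" using PU by simp
      fix \<omega> t assume \<omega>: "\<omega> \<in> space Q - U" and t: "\<bar>t\<bar> \<le> 1 / h"
      \<comment> \<open>The nearest grid point to the left of \<open>t\<close>; at the left end of
        the interval it may lie below -1/h, which is why the grid extends to the rounded-up
        \<open>N\<close>.\<close>
      define k where "k = \<lfloor>t / \<delta>\<rfloor>"
      define s where "s = of_int k * \<delta>"
      have "of_int k \<le> t / \<delta>" "t / \<delta> < of_int k + 1" unfolding k_def by linarith+
      then have "s \<le> t" "t < s + \<delta>" using \<delta> by (auto simp: s_def field_simps)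
      then have ts: "\<bar>t - s\<bar> \<le> \<delta>" by linarith
      have "k \<in> I"
      proof -
        have td: "t / \<delta> \<le> 1 / (h * \<delta>)" "- (1 / (h * \<delta>)) \<le> t / \<delta>"
          using t \<delta> divide_right_mono[of t "1 / h" \<delta>] divide_right_mono[of "- (1 / h)" t \<delta>] by auto
        have "k \<le> \<lfloor>1 / (h * \<delta>)\<rfloor>" unfolding k_def by (rule floor_mono[OF td(1)])
        also have "\<dots> \<le> N" unfolding N_def by linarith
        finally have "k \<le> N" .
        moreover have "\<lfloor>- (1 / (h * \<delta>))\<rfloor> \<le> k" unfolding k_def by (rule floor_mono[OF td(2)])
        then have "- N \<le> k" unfolding N_def by (simp add: ceiling_def)
        ultimately show ?thesis by (simp add: I_def)
      qed
      then have nb: "\<omega> \<notin> bad mo" "\<omega> \<notin> bad (cs k)" "\<omega> \<notin> bad (sn k)" and sp: "\<omega> \<in> space Q"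
        using \<omega> by (auto simp: U_def)
      have R: "\<bar>Re (dev n \<omega> s)\<bar> < \<eta>" using nb(2) sp unfolding bad_def Re_dev cs_def s_def by simp
      have I: "\<bar>Im (dev n \<omega> s)\<bar> < \<eta>" using nb(3) sp unfolding bad_def Im_dev sn_def s_def by simp
      have M: "(\<Sum>j<n. mo (Z j \<omega>)) / n < 2 * \<eta>" using nb(1) sp mo unfolding bad_def by simp
      have d1: "cmod (dev n \<omega> s) < 2 * \<eta>" using R I cmod_le[of "dev n \<omega> s"] by linarith
      have d2: "cmod (emp_cf n (\<lambda>k. Z k \<omega>) t - emp_cf n (\<lambda>k. Z k \<omega>) s) < 2 * \<eta>"
      proof -
        have "emp_cf n (\<lambda>k. Z k \<omega>) t - emp_cf n (\<lambda>k. Z k \<omega>) s = (1 / of_nat n) * (\<Sum>j<n. iexp (t * Z j \<omega>) - iexp (s * Z j \<omega>))"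
          by (simp only: emp_cf_def right_diff_distrib[symmetric] sum_subtractf[symmetric])
        also have "cmod \<dots> = (1 / n) * cmod (\<Sum>j<n. iexp (t * Z j \<omega>) - iexp (s * Z j \<omega>))"
          by (simp only: norm_mult norm_divide norm_one norm_of_nat)
        also have "\<dots> \<le> (1 / n) * (\<Sum>j<n. mo (Z j \<omega>))"
          by (intro mult_left_mono sum_norm_le iexp_mo ts) simp
        finally show ?thesis using M by simp
      qed
      have d3: "cmod (fourier g t - fourier g s) < \<eta>"
      proof -
        have "fourier g t - fourier g s = (CLINT y|G. iexp (t * y) - iexp (s * y))"
          unfolding fg_char char_def by (rule Bochner_Integration.integral_diff[OF iexp_int iexp_int, symmetric])
        also have "cmod \<dots> \<le> (LINT y|G. mo y)"
          by (rule Bochner_Integration.integral_norm_bound_integral) (use iexp_int mo_int iexp_mo[OF ts] in auto)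
        also note mo
        finally show ?thesis .
      qed
      \<comment> \<open>The deviation at \<open>t\<close> is that at the grid point \<open>s\<close>
        corrected by the increments of both characteristic functions.\<close>
      have "dev n \<omega> t = (emp_cf n (\<lambda>k. Z k \<omega>) t - emp_cf n (\<lambda>k. Z k \<omega>) s) + (dev n \<omega> s - (fourier g t - fourier g s))"
        by (simp add: dev_def)
      then have "cmod (dev n \<omega> t) \<le> cmod (emp_cf n (\<lambda>k. Z k \<omega>) t - emp_cf n (\<lambda>k. Z k \<omega>) s) + (cmod (dev n \<omega> s) + cmod (fourier g t - fourier g s))"
        using norm_triangle_ineq norm_triangle_ineq4 by (metis add_left_mono order_trans)
      then show "cmod (dev n \<omega> t) \<le> \<epsilon>" using d1 d2 d3 \<epsilon> unfolding \<eta>_def by linarith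
    qed
  qed
  moreover have "c > 0" "D > 0" using \<eta> \<delta> by (auto simp: c_def D_def intro: add_pos_pos)
  ultimately show ?thesis by blast
qed

end

section \<open>Asymptotic normality\<close>

text \<open>Clamping is a contraction. If \<open>T\<close> is at most M/2 in modulus,
  \<open>c + T\<close> is itself unaffected by clamping and no error is added; otherwise the extra
  error is at most \<open>|T|\<close>, which is then below \<open>2 * T\<^sup>2 / M\<close>.\<close>

lemma clamp_linearization:
  fixes M c T R y :: real
  assumes M: "M > 0" and c: "\<bar>c\<bar> \<le> M / 2" and y: "\<bar>y - c - T\<bar> \<le> R"
  shows "(max (min M y) (- M) - c - T)\<^sup>2 \<le> 2 * R\<^sup>2 + 8 * T ^ 4 / M\<^sup>2"
proof -
  have "\<bar>max (min M y) (- M) - c - T\<bar> \<le> R + 2 * T\<^sup>2 / M"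
  proof (cases "\<bar>T\<bar> \<le> M / 2")
    case True
    then have "\<bar>max (min M y) (- M) - c - T\<bar> \<le> \<bar>y - c - T\<bar>" using c M by (auto simp: max_def min_def)
    moreover have "0 \<le> 2 * T\<^sup>2 / M" using M by simp
    ultimately show ?thesis using y by linarith
  next
    case False
    then have "\<bar>max (min M y) (- M) - c - T\<bar> \<le> \<bar>y - c - T\<bar> + \<bar>T\<bar>" using c M by (auto simp: max_def min_def)
    moreover have "\<bar>T\<bar> \<le> 2 * T\<^sup>2 / M"
    proof -
      have "M * \<bar>T\<bar> \<le> (2 * \<bar>T\<bar>) * \<bar>T\<bar>" using False by (intro mult_right_mono) auto
      then show ?thesis using M by (simp add: field_simps power2_eq_square)
    qed
    ultimately show ?thesis using y by linarith
  qed
  then have "\<bar>max (min M y) (- M) - c - T\<bar>\<^sup>2 \<le> (R + 2 * T\<^sup>2 / M)\<^sup>2" by (rule power_mono) simp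
  also have "\<dots> \<le> 2 * R\<^sup>2 + 2 * (2 * T\<^sup>2 / M)\<^sup>2"
    using sum_squares_bound[of R "2 * T\<^sup>2 / M"] by (simp only: power2_sum)
  also have "2 * (2 * T\<^sup>2 / M)\<^sup>2 = 8 * T ^ 4 / M\<^sup>2" by (simp add: power_divide power_mult_distrib)
  finally show ?thesis by simp
qed

context decompounding
begin

definition "Vr h = (LINT y|G. (Kf h y - mK h)\<^sup>2)"
text \<open>\<open>sqrt (Vr h / n)\<close> is the standard deviation of the average, so the row sums
  have variance 1.\<close>

definition "\<xi> h n j \<omega> = (Kf h (Z j \<omega>) - mK h) / (n * sqrt (Vr h / n))"

text \<open>The summand bound comes from dividing a supremum of order 1/h by \<open>n\<close> times
  a standard deviation of order at least 1 over the square root of \<open>h * n\<close>; it vanishes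
  precisely when \<open>h * n\<close> tends to infinity.\<close>

lemma \<xi>_facts:
  assumes ok: "ok h" and h1: "h \<le> 1" and v: "v > 0" "v / h \<le> Vr h" and n: "n \<ge> 1"
  shows "indep_vars (\<lambda>_. borel) (\<xi> h n) {..<n}"
    and "\<bar>\<xi> h n j \<omega>\<bar> \<le> ((2 * \<kappa> * C0 + \<kappa> * C0 * J) / sqrt v) / sqrt (h * n)"
    and "expectation (\<xi> h n j) = 0"
    and "expectation (\<lambda>\<omega>. (\<xi> h n j \<omega>)\<^sup>2) = 1 / n"
    and "\<bar>sqrt (Vr h / n) * (\<Sum>j<n. \<xi> h n j \<omega>)\<bar> \<le> 2 * \<kappa> * C0 / h + \<kappa> * C0 * J"
    and "sqrt (Vr h / n) * (\<Sum>j<n. \<xi> h n j \<omega>) = (\<Sum>j<n. (Kf h (Z j \<omega>) - mK h) / n)"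
proof -
  have h: "h > 0" using ok by (simp add: ok_def)
  have Vp: "Vr h > 0" using v h by (meson divide_pos_pos less_le_trans)
  define s where "s = sqrt (Vr h / n)"
  have s: "s > 0" using Vp n by (simp add: s_def)
  note [measurable] = Kf_meas[OF ok]
  show "indep_vars (\<lambda>_. borel) (\<xi> h n) {..<n}"
    unfolding \<xi>_def[abs_def] by (rule Z_indep_fun) simp
  have le: "\<bar>Kf h y - mK h\<bar> \<le> 2 * \<kappa> * C0 / h + \<kappa> * C0 * J" for y
    using Kf_le[OF ok, of y] mK_le[OF ok] by linarith
  \<comment> \<open>\<open>h \<le> 1\<close> lets the bounded mean be absorbed into the 1/h
    term.\<close>
  have Kd: "2 * \<kappa> * C0 / h + \<kappa> * C0 * J \<le> (2 * \<kappa> * C0 + \<kappa> * C0 * J) / h"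
  proof -
    have "\<kappa> * C0 * J * h \<le> \<kappa> * C0 * J * 1"
      using h1 \<kappa>_pos C0_pos J_nonneg by (intro mult_left_mono) auto
    then have "\<kappa> * C0 * J \<le> \<kappa> * C0 * J / h" using h by (simp add: pos_le_divide_eq)
    then show ?thesis unfolding add_divide_distrib by (rule add_left_mono)
  qed
  show "\<bar>\<xi> h n j \<omega>\<bar> \<le> ((2 * \<kappa> * C0 + \<kappa> * C0 * J) / sqrt v) / sqrt (h * n)"
  proof -
    have "sqrt (v / (h * n)) \<le> s"
      unfolding s_def using v h n divide_right_mono[OF v(2), of "real n"] by (intro real_sqrt_le_mono) simp
    then have den: "n * sqrt (v / (h * n)) \<le> n * s" by (intro mult_left_mono) auto
    have "\<bar>\<xi> h n j \<omega>\<bar> = \<bar>Kf h (Z j \<omega>) - mK h\<bar> / (n * s)"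
      unfolding \<xi>_def s_def[symmetric] using s by (simp add: abs_mult)
    also have "\<dots> \<le> ((2 * \<kappa> * C0 + \<kappa> * C0 * J) / h) / (n * sqrt (v / (h * n)))"
      using order_trans[OF le Kd] den v h n \<kappa>_pos C0_pos J_nonneg by (intro frac_le) auto
    also have "\<dots> = ((2 * \<kappa> * C0 + \<kappa> * C0 * J) / sqrt v) / sqrt (h * n)"
    proof -
      have "h * (n * sqrt (v / (h * n))) = sqrt v * sqrt (h * n)"
      proof -
        have "h * (n * sqrt (v / (h * n))) = (sqrt (h * n) * sqrt (h * n)) * (sqrt v / sqrt (h * n))"
          using h by (simp add: real_sqrt_divide)
        also have "\<dots> = sqrt v * sqrt (h * n)"
        proof -
          have "p * p * (r / p) = r * p" if "p \<noteq> 0" for p r :: real using that by simp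
          moreover have "sqrt (h * n) \<noteq> 0" using h n by simp
          ultimately show ?thesis by blast
        qed
        finally show ?thesis .
      qed
      then show ?thesis by (simp only: divide_divide_eq_left)
    qed
    finally show ?thesis .
  qed
  have "expectation (\<xi> h n j) = (LINT y|G. (Kf h y - mK h) / (n * s))"
    unfolding \<xi>_def[abs_def] s_def[symmetric] by (rule Z_integral) simp
  also have "\<dots> = 0" using Kf_int(1)[OF ok] G.prob_space by (simp add: Kf_expectation[OF ok])
  finally show "expectation (\<xi> h n j) = 0" .
  have "expectation (\<lambda>\<omega>. (\<xi> h n j \<omega>)\<^sup>2) = (LINT y|G. ((Kf h y - mK h) / (n * s))\<^sup>2)"
    unfolding \<xi>_def s_def[symmetric] by (rule Z_integral) simp
  also have "\<dots> = Vr h / (n * s)\<^sup>2" by (simp add: Vr_def power_divide)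
  also have "(n * s)\<^sup>2 = n * Vr h"
  proof -
    have "s\<^sup>2 = Vr h / n" unfolding s_def using Vp by (intro real_sqrt_pow2) simp
    then show ?thesis using n by (simp add: power_mult_distrib) (simp add: power2_eq_square)
  qed
  finally show "expectation (\<lambda>\<omega>. (\<xi> h n j \<omega>)\<^sup>2) = 1 / n" using Vp by simp
  show eq: "sqrt (Vr h / n) * (\<Sum>j<n. \<xi> h n j \<omega>) = (\<Sum>j<n. (Kf h (Z j \<omega>) - mK h) / n)"
    unfolding \<xi>_def s_def[symmetric] sum_distrib_left
  proof (rule sum.cong[OF refl])
    fix j
    show "s * ((Kf h (Z j \<omega>) - mK h) / (n * s)) = (Kf h (Z j \<omega>) - mK h) / n"
      using s by simp
  qed
  have "\<bar>\<Sum>j<n. (Kf h (Z j \<omega>) - mK h) / n\<bar> \<le> (\<Sum>j<n. (2 * \<kappa> * C0 / h + \<kappa> * C0 * J) / n)"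
    using le by (intro order_trans[OF sum_abs] sum_mono) (auto simp: divide_right_mono)
  also have "\<dots> = 2 * \<kappa> * C0 / h + \<kappa> * C0 * J" using n by simp
  finally show "\<bar>sqrt (Vr h / n) * (\<Sum>j<n. \<xi> h n j \<omega>)\<bar> \<le> 2 * \<kappa> * C0 / h + \<kappa> * C0 * J" unfolding eq .
qed

text \<open>The three terms are, in this order, the quadratic remainder of the logarithm (32 = 2 * 4
  * 4), the loss by truncation (384 = 8 * 48) and the contribution of the bad event. The last is a
  squared supremum times a probability, divided by a variance of order 1/(nh).\<close>

lemma remainder_bound:
  assumes ok: "ok h" and h1: "h \<le> 1" and v: "v > 0" "v / h \<le> Vr h" "Vr h \<le> V / h" and n: "n \<ge> 1"
    and M: "M > 0" "\<bar>c h\<bar> \<le> M / 2"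
    and small: "((2 * \<kappa> * C0 + \<kappa> * C0 * J) / sqrt v) / sqrt (h * n) \<le> 1"
    and A: "A \<in> events" "prob (space Q - A) \<le> pA"
      "\<And>\<omega> t. \<omega> \<in> A \<Longrightarrow> \<bar>t\<bar> \<le> 1 / h \<Longrightarrow> cmod (dev n \<omega> t) \<le> 1 / (4 * C0)"
  defines "\<sigma> \<equiv> sqrt (Vr h / n)"
  shows "expectation (\<lambda>\<omega>. (f_hat lam w h M n (\<lambda>k. Z k \<omega>) x - c h - \<sigma> * (\<Sum>j<n. \<xi> h n j \<omega>))\<^sup>2) / \<sigma>\<^sup>2
    \<le> (32 * (\<kappa> * C0\<^sup>2)\<^sup>2 * C4 / v) / (h * n) + (384 * exp (exp 1) * V) / (h * n) / M\<^sup>2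
      + (2 * M + 2 * \<kappa> * C0 / h + \<kappa> * C0 * J)\<^sup>2 * pA * (h * n) / v"
proof -
  have h: "h > 0" using ok by (simp add: ok_def)
  note \<xi> = \<xi>_facts[OF ok h1 v(1,2) n]
  have Vp: "Vr h > 0" using v h by (meson divide_pos_pos less_le_trans)
  have \<sigma>2: "\<sigma>\<^sup>2 = Vr h / n" unfolding \<sigma>_def using Vp by simp
  have \<sigma>2p: "\<sigma>\<^sup>2 > 0" unfolding \<sigma>2 using Vp n by simp
  have \<sigma>2l: "v / (h * n) \<le> \<sigma>\<^sup>2" unfolding \<sigma>2 using divide_right_mono[OF v(2), of "real n"] by simp
  have \<sigma>2u: "\<sigma>\<^sup>2 \<le> V / (h * n)" unfolding \<sigma>2 using divide_right_mono[OF v(3), of "real n"] by simp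
  have inv\<sigma>: "1 / \<sigma>\<^sup>2 \<le> h * n / v"
  proof -
    have "1 / \<sigma>\<^sup>2 \<le> 1 / (v / (h * n))" using \<sigma>2l \<sigma>2p v h n by (intro divide_left_mono) auto
    then show ?thesis by simp
  qed
  define T where "T \<omega> = \<sigma> * (\<Sum>j<n. \<xi> h n j \<omega>)" for \<omega>
  define R where "R \<omega> = 2 * \<kappa> * C0\<^sup>2 * (LINT t:{-(1/h)..1/h}|lborel. (cmod (dev n \<omega> t))\<^sup>2)" for \<omega>
  define F where "F \<omega> = f_hat lam w h M n (\<lambda>k. Z k \<omega>) x" for \<omega>
  \<comment> \<open>On the bad event only suprema are available: \<open>F\<close> is at most
    \<open>M\<close>, \<open>c h\<close> at most M/2 and the linear term at most its
    supremum.\<close>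
  define W where "W = 2 * M + 2 * \<kappa> * C0 / h + \<kappa> * C0 * J"
  have T_le: "\<bar>T \<omega>\<bar> \<le> 2 * \<kappa> * C0 / h + \<kappa> * C0 * J" for \<omega> unfolding T_def \<sigma>_def by (rule \<xi>(5))
  have pw: "(F \<omega> - c h - T \<omega>)\<^sup>2 \<le> 2 * (R \<omega>)\<^sup>2 + 8 / M\<^sup>2 * T \<omega> ^ 4 + W\<^sup>2 * indicator (space Q - A) \<omega>"
    if \<omega>: "\<omega> \<in> space Q" for \<omega>
  proof (cases "\<omega> \<in> A")
    case True
    have lt: "Re (of_real \<kappa> * (LINT t:{-(1/h)..1/h}|lborel. b h t * (emp_cf n (\<lambda>k. Z k \<omega>) t - fourier g t))) = T \<omega>"
      unfolding T_def \<sigma>_def \<xi>(6) by (rule linear_term[OF ok n])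
    have "\<bar>f_nh lam w h n (\<lambda>k. Z k \<omega>) x - c h - T \<omega>\<bar> \<le> R \<omega>"
      using f_nh_expansion[OF ok n, of "\<lambda>k. Z k \<omega>"] A(3)[OF True] unfolding lt R_def dev_def by blast
    from clamp_linearization[OF M this] have "(F \<omega> - c h - T \<omega>)\<^sup>2 \<le> 2 * (R \<omega>)\<^sup>2 + 8 * T \<omega> ^ 4 / M\<^sup>2"
      by (simp only: F_def f_hat_def)
    then show ?thesis using True by simp
  next
    case False
    have "\<bar>F \<omega>\<bar> \<le> M" unfolding F_def f_hat_def using M by (auto simp: abs_le_iff)
    then have "\<bar>F \<omega> - c h - T \<omega>\<bar> \<le> W" using T_le[of \<omega>] M unfolding W_def by linarith
    then have "\<bar>F \<omega> - c h - T \<omega>\<bar>\<^sup>2 \<le> W\<^sup>2" by (rule power_mono) simp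
    moreover have "0 \<le> 2 * (R \<omega>)\<^sup>2 + 8 / M\<^sup>2 * T \<omega> ^ 4" by simp
    moreover have "indicator (space Q - A) \<omega> = (1::real)" using False \<omega> by simp
    ultimately show ?thesis by (simp only: mult_1_right power2_abs add_increasing)
  qed
  have \<xi>m: "\<xi> h n j \<in> borel_measurable Q" for j
    using Kf_meas[OF ok] unfolding \<xi>_def[abs_def] by measurable
  have Tm: "T \<in> borel_measurable Q" unfolding T_def[abs_def] using \<xi>m by measurable
  note sq = dev_square_integral[OF n h]
  have R2: "(R \<omega>)\<^sup>2 = 4 * (\<kappa> * C0\<^sup>2)\<^sup>2 * (LINT t:{-(1/h)..1/h}|lborel. (cmod (dev n \<omega> t))\<^sup>2)\<^sup>2" for \<omega>
    unfolding R_def by (simp only: power_mult_distrib) simp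
  have iR: "integrable Q (\<lambda>\<omega>. (R \<omega>)\<^sup>2)" unfolding R2 using sq(1) by (intro integrable_mult_right)
  have ER: "expectation (\<lambda>\<omega>. (R \<omega>)\<^sup>2) \<le> 4 * (\<kappa> * C0\<^sup>2)\<^sup>2 * (4 * C4 / (h * n)\<^sup>2)"
    unfolding R2 integral_mult_right_zero by (intro mult_left_mono sq(2)) simp
  have iT: "integrable Q (\<lambda>\<omega>. T \<omega> ^ 4)"
  proof (rule integrable_const_bound[where B="(2 * \<kappa> * C0 / h + \<kappa> * C0 * J) ^ 4"])
    show "AE \<omega> in Q. norm (T \<omega> ^ 4) \<le> (2 * \<kappa> * C0 / h + \<kappa> * C0 * J) ^ 4"
      unfolding real_norm_def power_abs by (intro AE_I2 power_mono T_le) simp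
  qed (use Tm in measurable)
  \<comment> \<open>The rows have total variance 1 and summands bounded by 1, so the fourth moment
    of the sum is at most \<open>48 * exp (exp 1)\<close>.\<close>
  have ET: "expectation (\<lambda>\<omega>. T \<omega> ^ 4) \<le> (\<sigma>\<^sup>2)\<^sup>2 * (48 * exp (exp 1))"
  proof -
    have "expectation (\<lambda>\<omega>. T \<omega> ^ 4) = (\<sigma>\<^sup>2)\<^sup>2 * expectation (\<lambda>\<omega>. (\<Sum>j<n. \<xi> h n j \<omega>) ^ 4)"
      unfolding T_def power_mult_distrib by simp
    also have "\<dots> \<le> (\<sigma>\<^sup>2)\<^sup>2 * (48 * exp (1 * exp 1))"
    proof (intro mult_left_mono fourth_moment_sum_indep_le[OF _ \<xi>(1)])
      show "\<bar>\<xi> h n i \<omega>\<bar> \<le> 1" for i \<omega> using order_trans[OF \<xi>(2) small] .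
      show "(\<Sum>j<n. expectation (\<lambda>\<omega>. (\<xi> h n j \<omega>)\<^sup>2)) \<le> 1" using n by (simp add: \<xi>(4))
    qed (use \<xi>(3) in auto)
    finally show ?thesis by simp
  qed
  have "expectation (\<lambda>\<omega>. (F \<omega> - c h - T \<omega>)\<^sup>2)
     \<le> expectation (\<lambda>\<omega>. 2 * (R \<omega>)\<^sup>2 + 8 / M\<^sup>2 * T \<omega> ^ 4 + W\<^sup>2 * indicator (space Q - A) \<omega>)"
    by (rule integral_mono') (use iR iT A pw in \<open>auto simp: emeasure_eq_measure\<close>)
  also have "\<dots> = 2 * expectation (\<lambda>\<omega>. (R \<omega>)\<^sup>2) + 8 / M\<^sup>2 * expectation (\<lambda>\<omega>. T \<omega> ^ 4) + W\<^sup>2 * prob (space Q - A)"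
    using iR iT A by (simp add: emeasure_eq_measure Int_absorb2 sets.sets_into_space)
  also have "\<dots> \<le> 2 * (4 * (\<kappa> * C0\<^sup>2)\<^sup>2 * (4 * C4 / (h * n)\<^sup>2)) + 8 / M\<^sup>2 * ((\<sigma>\<^sup>2)\<^sup>2 * (48 * exp (exp 1))) + W\<^sup>2 * pA"
    by (intro add_mono mult_left_mono ER ET A(2)) auto
  finally have "expectation (\<lambda>\<omega>. (F \<omega> - c h - T \<omega>)\<^sup>2) / \<sigma>\<^sup>2
    \<le> (32 * (\<kappa> * C0\<^sup>2)\<^sup>2 * C4 / (h * n)\<^sup>2 + 384 * exp (exp 1) / M\<^sup>2 * (\<sigma>\<^sup>2)\<^sup>2 + W\<^sup>2 * pA) / \<sigma>\<^sup>2"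
    using \<sigma>2p by (intro divide_right_mono) (auto simp: mult_ac)
  also have "\<dots> = 32 * (\<kappa> * C0\<^sup>2)\<^sup>2 * C4 / (h * n)\<^sup>2 * (1 / \<sigma>\<^sup>2) + 384 * exp (exp 1) / M\<^sup>2 * \<sigma>\<^sup>2 + W\<^sup>2 * pA * (1 / \<sigma>\<^sup>2)"
    using \<sigma>2p by (simp add: add_divide_distrib power2_eq_square)
  also have "\<dots> \<le> 32 * (\<kappa> * C0\<^sup>2)\<^sup>2 * C4 / (h * n)\<^sup>2 * (h * n / v) + 384 * exp (exp 1) / M\<^sup>2 * (V / (h * n)) + W\<^sup>2 * pA * (h * n / v)"
  proof -
    have "pA \<ge> 0" using A(2) measure_nonneg[of Q "space Q - A"] by linarith
    then show ?thesis
      by (intro add_mono mult_left_mono inv\<sigma> \<sigma>2u) (auto simp: C4_def)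
  qed
  also have "32 * (\<kappa> * C0\<^sup>2)\<^sup>2 * C4 / (h * n)\<^sup>2 * (h * n / v) = (32 * (\<kappa> * C0\<^sup>2)\<^sup>2 * C4 / v) / (h * n)"
    using h n by (simp add: power2_eq_square)
  also have "384 * exp (exp 1) / M\<^sup>2 * (V / (h * n)) = (384 * exp (exp 1) * V) / (h * n) / M\<^sup>2"
    by simp
  finally show ?thesis unfolding F_def T_def W_def by simp
qed

text \<open>For \<open>n = 0\<close> the empirical characteristic function is 0 by convention, so
  the argument of the logarithm is constantly 1 and nothing depends on the sample.\<close>

lemma f_hat_measurable:
  assumes "n \<ge> 1 \<Longrightarrow> h > 0"
  shows "(\<lambda>\<omega>. f_hat lam w h M n (\<lambda>k. Z k \<omega>) x) \<in> borel_measurable Q"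
proof (cases "n \<ge> 1")
  case True
  have "(\<lambda>\<omega>. f_nh lam w h n (\<lambda>k. Z k \<omega>) x) \<in> borel_measurable Q"
    by (rule measurable_f_nh) (use assms True lam w_C1 w_0 w_supp in auto)
  then show ?thesis unfolding f_hat_def by measurable
next
  case False
  then have "n = 0" by simp
  then have "log_arg lam w h n z = (\<lambda>t. 1)" for z by (simp add: log_arg_def[abs_def] emp_cf_def)
  then show ?thesis unfolding f_hat_def f_nh_def by simp
qed

text \<open>\<open>\<gamma> > 0\<close> makes the bandwidth eventually small enough for the
  linearization, \<open>\<gamma> < 1\<close> makes \<open>h n * n\<close> unbounded, and with
  polynomial truncation the exponential concentration outweighs everything lost on the bad
  event.\<close>

theorem asymptotic_normality:
  fixes h M :: "nat \<Rightarrow> real"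
  assumes pars: "C > 0" "0 < \<gamma>" "\<gamma> < 1" "\<alpha> > 0"
    and h_eq: "\<And>n. n \<ge> 1 \<Longrightarrow> h n = C * real n powr (- \<gamma>)"
    and M_eq: "\<And>n. n \<ge> 1 \<Longrightarrow> M n = real n powr \<alpha>"
  defines "F \<equiv> (\<lambda>n \<omega>. f_hat lam w (h n) (M n) n (\<lambda>k. Z k \<omega>) x)"
  shows "weak_conv_m (\<lambda>n. distr Q borel (\<lambda>\<omega>. (F n \<omega> - expectation (F n)) / sqrt (variance (F n))))
           std_normal_distribution"
proof -
  obtain h1 v V where hv: "h1 > 0" "v > 0" "V > 0"
    and hvV: "\<And>h. 0 < h \<Longrightarrow> h < h1 \<Longrightarrow> ok h \<and> v / h \<le> Vr h \<and> Vr h \<le> V / h"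
    using variance_bounds unfolding Vr_def by blast
  obtain Cc where Cc: "\<And>h. ok h \<Longrightarrow> \<bar>c h\<bar> \<le> Cc" using c_bound by blast
  have "1 / (4 * C0) > 0" using C0_pos by simp
  from sup_concentration[OF this] obtain cc D where cD: "cc > 0" "D > 0"
    and conc: "\<And>h n. h > 0 \<Longrightarrow> n \<ge> 1 \<Longrightarrow> \<exists>A\<in>events.
     prob (space Q - A) \<le> D * (1 + 1 / h) * exp (- cc * real n) \<and>
     (\<forall>\<omega>\<in>A. \<forall>t. \<bar>t\<bar> \<le> 1 / h \<longrightarrow> cmod (dev n \<omega> t) \<le> 1 / (4 * C0))" by blast
  define Kd where "Kd = (2 * \<kappa> * C0 + \<kappa> * C0 * J) / sqrt v"
  have hn_pos: "h n > 0" if "n \<ge> 1" for n using h_eq[OF that] pars that by simp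
  have ev1: "\<forall>\<^sub>F n in sequentially. n \<ge> (1::nat)" by (rule eventually_ge_at_top)
  have h_lim: "h \<longlonglongrightarrow> 0"
  proof (rule Lim_transform_eventually)
    show "(\<lambda>n. C * real n powr (- \<gamma>)) \<longlonglongrightarrow> 0" using pars by real_asymp
    show "\<forall>\<^sub>F n in sequentially. C * real n powr (- \<gamma>) = h n" using ev1 by eventually_elim (simp add: h_eq)
  qed
  have hn_eq: "h n * real n = C * real n powr (1 - \<gamma>)" if "n \<ge> 1" for n
    using that by (simp add: h_eq powr_diff powr_minus field_simps)
  have hn_lim: "filterlim (\<lambda>n. h n * real n) at_top sequentially"
  proof (rule filterlim_cong[THEN iffD1, OF refl refl])
    show "filterlim (\<lambda>n. C * real n powr (1 - \<gamma>)) at_top sequentially" using pars by real_asymp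
    show "\<forall>\<^sub>F n in sequentially. C * real n powr (1 - \<gamma>) = h n * real n" using ev1 by eventually_elim (simp add: hn_eq)
  qed
  have M_lim: "filterlim M at_top sequentially"
  proof (rule filterlim_cong[THEN iffD1, OF refl refl])
    show "filterlim (\<lambda>n. real n powr \<alpha>) at_top sequentially" using pars by real_asymp
    show "\<forall>\<^sub>F n in sequentially. real n powr \<alpha> = M n" using ev1 by eventually_elim (simp add: M_eq)
  qed
  have \<delta>_lim: "(\<lambda>n. Kd / sqrt (h n * n)) \<longlonglongrightarrow> 0"
    by (intro tendsto_divide_0[OF tendsto_const] filterlim_at_top_imp_at_infinity filterlim_compose[OF sqrt_at_top hn_lim])
  \<comment> \<open>The bad-event term, with the concentration bound inserted for its
    probability.\<close>
  define W where "W n = (2 * M n + 2 * \<kappa> * C0 / h n + \<kappa> * C0 * J)\<^sup>2 * (D * (1 + 1 / h n) * exp (- cc * real n)) * (h n * n) / v" for n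
  define bd where "bd n = (32 * (\<kappa> * C0\<^sup>2)\<^sup>2 * C4 / v) / (h n * n) + (384 * exp (exp 1) * V) / (h n * n) / (M n)\<^sup>2 + W n" for n
  have good: "\<forall>\<^sub>F n in sequentially. n \<ge> 1 \<and> h n < h1 \<and> h n \<le> 1 \<and> M n \<ge> 1 \<and> Cc \<le> M n / 2 \<and> Kd / sqrt (h n * n) \<le> 1"
  proof -
    have "\<forall>\<^sub>F n in sequentially. h n < min h1 1" using h_lim hv by (intro order_tendstoD(2)) auto
    moreover have "\<forall>\<^sub>F n in sequentially. max 1 (2 * Cc) \<le> M n"
      using M_lim unfolding filterlim_at_top by blast
    moreover have "\<forall>\<^sub>F n in sequentially. Kd / sqrt (h n * n) < 1" using \<delta>_lim by (intro order_tendstoD(2)) auto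
    ultimately show ?thesis using ev1 by eventually_elim auto
  qed
  define \<sigma> where "\<sigma> n = sqrt (Vr (h n) / n)" for n :: nat
  \<comment> \<open>Set to 0 when \<open>n\<close> is 0 or the bandwidth is not admissible, so that
    every \<open>A n\<close> is measurable; eventually this case does not occur.\<close>
  define A where "A n \<omega> = (if n \<ge> 1 \<and> ok (h n) then \<Sum>j<n. \<xi> (h n) n j \<omega> else 0)" for n \<omega>
  have F_meas: "F n \<in> borel_measurable Q" for n
    unfolding F_def by (rule f_hat_measurable) (rule hn_pos)
  have A_meas: "A n \<in> borel_measurable Q" for n
  proof (cases "ok (h n)")
    case True
    then have "\<xi> (h n) n j \<in> borel_measurable Q" for j
      using Kf_meas[OF True] unfolding \<xi>_def[abs_def] by measurable
    then show ?thesis unfolding A_def[abs_def] by measurable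
  qed (simp add: A_def[abs_def])
  have facts: "\<forall>\<^sub>F n in sequentially. n \<ge> 1 \<and> ok (h n) \<and> h n \<le> 1 \<and> v / h n \<le> Vr (h n) \<and> Vr (h n) \<le> V / h n \<and> M n \<ge> 1 \<and> Cc \<le> M n / 2
      \<and> Kd / sqrt (h n * n) \<le> 1"
    using good by eventually_elim (use hvV hn_pos in blast)
  have A_eq: "A n = (\<lambda>\<omega>. \<Sum>j<n. \<xi> (h n) n j \<omega>)" if "n \<ge> 1" "ok (h n)" for n
    using that by (auto simp: A_def)
  have arr: "\<forall>\<^sub>F n in sequentially. indep_vars (\<lambda>_. borel) (\<xi> (h n) n) {..<n}
     \<and> (\<forall>i<n. (\<forall>\<omega>\<in>space Q. \<bar>\<xi> (h n) n i \<omega>\<bar> \<le> Kd / sqrt (h n * n)) \<and> expectation (\<xi> (h n) n i) = 0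
           \<and> expectation (\<lambda>\<omega>. (\<xi> (h n) n i \<omega>)\<^sup>2) = 1 / n)"
    using facts
  proof eventually_elim
    case (elim n)
    then show ?case using \<xi>_facts(1-4)[of "h n" v n] hv unfolding Kd_def by blast
  qed
  show ?thesis
  proof (rule standardized_weak_conv[where A=A and \<sigma>=\<sigma> and c="\<lambda>n. c (h n)", OF A_meas F_meas])
    show "\<forall>\<^sub>F n in sequentially. integrable Q (\<lambda>\<omega>. (A n \<omega>)\<^sup>2) \<and> expectation (A n) = 0 \<and> expectation (\<lambda>\<omega>. (A n \<omega>)\<^sup>2) = 1"
      using facts
    proof eventually_elim
      case (elim n)
      then have n: "n \<ge> 1" and ok: "ok (h n)" and small: "Kd / sqrt (h n * n) \<le> 1" by auto
      note \<xi> = \<xi>_facts[OF ok _ hv(2) _ n]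
      have \<xi>1: "indep_vars (\<lambda>_. borel) (\<xi> (h n) n) {..<n}" using \<xi>(1) elim by blast
      have \<xi>2: "\<bar>\<xi> (h n) n j \<omega>\<bar> \<le> 1" for j \<omega> using \<xi>(2)[of j \<omega>] small elim unfolding Kd_def by linarith
      have \<xi>3: "expectation (\<xi> (h n) n j) = 0" for j using \<xi>(3) elim by blast
      have \<xi>4: "expectation (\<lambda>\<omega>. (\<xi> (h n) n j \<omega>)\<^sup>2) = 1 / n" for j using \<xi>(4) elim by blast
      have \<xi>m[measurable]: "\<xi> (h n) n j \<in> borel_measurable Q" for j
        using Kf_meas[OF ok] unfolding \<xi>_def[abs_def] by measurable
      have i1: "integrable Q (\<xi> (h n) n j)" for j
        by (rule integrable_const_bound[where B=1]) (use \<xi>2 in auto)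
      have bS: "\<bar>\<Sum>j<n. \<xi> (h n) n j \<omega>\<bar> \<le> n" for \<omega>
        using order_trans[OF sum_abs sum_bounded_above[of "{..<n}" "\<lambda>j. \<bar>\<xi> (h n) n j \<omega>\<bar>" 1]] \<xi>2 by simp
      have "integrable Q (\<lambda>\<omega>. (\<Sum>j<n. \<xi> (h n) n j \<omega>)\<^sup>2)"
      proof (rule integrable_const_bound[where B="(real n)\<^sup>2"])
        have "\<bar>\<Sum>j<n. \<xi> (h n) n j \<omega>\<bar>\<^sup>2 \<le> (real n)\<^sup>2" for \<omega> by (rule power_mono[OF bS]) simp
        then show "AE \<omega> in Q. norm ((\<Sum>j<n. \<xi> (h n) n j \<omega>)\<^sup>2) \<le> (real n)\<^sup>2" by simp
      qed measurable
      moreover have "expectation (\<lambda>\<omega>. \<Sum>j<n. \<xi> (h n) n j \<omega>) = 0" using i1 \<xi>3 by simp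
      moreover have "expectation (\<lambda>\<omega>. (\<Sum>j<n. \<xi> (h n) n j \<omega>)\<^sup>2) = 1"
        using second_moment_sum_indep[OF _ \<xi>1 \<xi>2 \<xi>3] n by (simp add: \<xi>4)
      ultimately show ?case unfolding A_eq[OF n ok] by simp
    qed
    show "(\<lambda>n. char (distr Q borel (A n)) t) \<longlonglongrightarrow> complex_of_real (exp (- (t\<^sup>2) / 2))" for t
    proof (rule Lim_transform_eventually[OF char_sum_iid_tendsto[OF arr \<delta>_lim, of t]])
      show "\<forall>\<^sub>F n in sequentially. char (distr Q borel (\<lambda>\<omega>. \<Sum>i<n. \<xi> (h n) n i \<omega>)) t = char (distr Q borel (A n)) t"
        using facts by eventually_elim (simp add: A_eq)
    qed
    show "\<forall>\<^sub>F n in sequentially. integrable Q (\<lambda>\<omega>. (F n \<omega>)\<^sup>2)"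
      using facts
    proof eventually_elim
      case (elim n)
      have "\<bar>F n \<omega>\<bar> \<le> M n" for \<omega> unfolding F_def f_hat_def using elim by (auto simp: abs_le_iff)
      then have "\<bar>F n \<omega>\<bar>\<^sup>2 \<le> (M n)\<^sup>2" for \<omega> by (intro power_mono) auto
      then show ?case using F_meas[of n] by (intro integrable_const_bound[where B="(M n)\<^sup>2"]) auto
    qed
    show "\<forall>\<^sub>F n in sequentially. 0 < \<sigma> n"
      using facts
    proof eventually_elim
      case (elim n)
      then have "0 < v / h n" using hv hn_pos by simp
      then have "0 < Vr (h n)" using elim by linarith
      then show ?case using elim by (simp add: \<sigma>_def)
    qed
    have upper: "\<forall>\<^sub>F n in sequentially. expectation (\<lambda>\<omega>. (F n \<omega> - c (h n) - \<sigma> n * A n \<omega>)\<^sup>2) / (\<sigma> n)\<^sup>2 \<le> bd n"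
      using facts
    proof eventually_elim
      case (elim n)
      then have n: "n \<ge> 1" and ok: "ok (h n)" and h1: "h n \<le> 1" and vv: "v / h n \<le> Vr (h n)" "Vr (h n) \<le> V / h n"
        and MM: "M n > 0" "Cc \<le> M n / 2" and small: "Kd / sqrt (h n * n) \<le> 1" by auto
      obtain E where E: "E \<in> events" "prob (space Q - E) \<le> D * (1 + 1 / h n) * exp (- cc * real n)"
        "\<And>\<omega> t. \<omega> \<in> E \<Longrightarrow> \<bar>t\<bar> \<le> 1 / h n \<Longrightarrow> cmod (dev n \<omega> t) \<le> 1 / (4 * C0)"
        using conc[OF hn_pos[OF n] n] by blast
      have cM: "\<bar>c (h n)\<bar> \<le> M n / 2" using Cc[OF ok] MM by linarith
      show ?case
        using remainder_bound[OF ok h1 hv(2) vv n MM(1) cM small[unfolded Kd_def] E]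
        unfolding A_eq[OF n ok] F_def \<sigma>_def bd_def W_def .
    qed
    have l1: "(\<lambda>n. (32 * (\<kappa> * C0\<^sup>2)\<^sup>2 * C4 / v) / (h n * n)) \<longlonglongrightarrow> 0"
      by (intro tendsto_divide_0[OF tendsto_const] filterlim_at_top_imp_at_infinity hn_lim)
    have l2: "(\<lambda>n. (384 * exp (exp 1) * V) / (h n * n) / (M n)\<^sup>2) \<longlonglongrightarrow> 0"
    proof (rule Lim_null_comparison)
      show "(\<lambda>n. (384 * exp (exp 1) * V) / (h n * n)) \<longlonglongrightarrow> 0"
        by (intro tendsto_divide_0[OF tendsto_const] filterlim_at_top_imp_at_infinity hn_lim)
      show "\<forall>\<^sub>F n in sequentially. norm ((384 * exp (exp 1) * V) / (h n * n) / (M n)\<^sup>2) \<le> (384 * exp (exp 1) * V) / (h n * n)"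
        using facts
      proof eventually_elim
        case (elim n)
        then have "(M n)\<^sup>2 \<ge> 1" by simp
        moreover have "0 \<le> (384 * exp (exp 1) * V) / (h n * n)" using hv hn_pos[of n] elim by simp
        ultimately have "(384 * exp (exp 1) * V) / (h n * n) / (M n)\<^sup>2 \<le> (384 * exp (exp 1) * V) / (h n * n) / 1"
          by (intro divide_left_mono) auto
        then show ?case using hv hn_pos[of n] elim by simp
      qed
    qed
    have l3: "W \<longlonglongrightarrow> 0"
    proof (rule Lim_null_comparison)
      \<comment> \<open>With this exponent one power of \<open>n\<close> dominates the truncation
        level, 1/h and \<open>h n * n\<close> up to constants, since \<open>\<gamma>\<close> and
        \<open>1 - \<gamma>\<close> are below 1.\<close>
      define p where "p = max 1 \<alpha>"
      define k0 where "k0 = 2 + 2 * \<kappa> * C0 / C + \<kappa> * C0 * J"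
      have p: "p \<ge> 1" "p \<ge> \<alpha>" by (auto simp: p_def)
      show "(\<lambda>n. (k0\<^sup>2 * D * (1 + 1 / C) * C / v) * (real n powr (4 * p) * exp (- cc * real n))) \<longlonglongrightarrow> 0"
      proof -
        have "(\<lambda>n. real n powr (4 * p) * exp (- cc * real n)) \<longlonglongrightarrow> 0" using cD p by real_asymp
        from tendsto_mult_right_zero[OF this] show ?thesis .
      qed
      show "\<forall>\<^sub>F n in sequentially. norm (W n) \<le> (k0\<^sup>2 * D * (1 + 1 / C) * C / v) * (real n powr (4 * p) * exp (- cc * real n))"
        using facts
      proof eventually_elim
        case (elim n)
        then have n: "real n \<ge> 1" "n \<ge> 1" by auto
        define P where "P = real n powr p"
        have P1: "P \<ge> 1" unfolding P_def using n p by (intro ge_one_powr_ge_zero) auto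
        have MP: "M n \<le> P" unfolding P_def M_eq[OF n(2)] using n p by (intro powr_mono) auto
        have hi: "1 / h n \<le> P / C"
        proof -
          have "1 / h n = real n powr \<gamma> / C" unfolding h_eq[OF n(2)] by (simp add: powr_minus field_simps)
          also have "\<dots> \<le> P / C" unfolding P_def using n p pars by (intro divide_right_mono powr_mono) auto
          finally show ?thesis .
        qed
        have hnP: "h n * n \<le> C * P"
          unfolding hn_eq[OF n(2)] P_def using n p pars by (intro mult_left_mono powr_mono) auto
        have kc: "\<kappa> * C0 \<ge> 0" "\<kappa> * C0 * J \<ge> 0" using \<kappa>_pos C0_pos J_nonneg by auto
        have "2 * M n + 2 * \<kappa> * C0 / h n + \<kappa> * C0 * J \<le> 2 * P + 2 * (\<kappa> * C0) * (P / C) + \<kappa> * C0 * J * P"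
        proof (intro add_mono)
          show "2 * \<kappa> * C0 / h n \<le> 2 * (\<kappa> * C0) * (P / C)"
            using mult_left_mono[OF hi, of "2 * (\<kappa> * C0)"] kc by (simp add: mult.assoc)
          show "\<kappa> * C0 * J \<le> \<kappa> * C0 * J * P" using mult_left_mono[OF P1 kc(2)] by simp
        qed (use MP in simp)
        also have "\<dots> = k0 * P" by (simp add: k0_def algebra_simps)
        finally have s1: "2 * M n + 2 * \<kappa> * C0 / h n + \<kappa> * C0 * J \<le> k0 * P" .
        have s0: "0 \<le> 2 * M n + 2 * \<kappa> * C0 / h n + \<kappa> * C0 * J"
          using kc hn_pos[OF n(2)] elim by (intro add_nonneg_nonneg) (auto simp: mult.assoc)
        have s2: "1 + 1 / h n \<le> (1 + 1 / C) * P" using hi P1 by (simp add: distrib_right)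
        have hp: "h n > 0" by (rule hn_pos[OF n(2)])
        have q1: "(2 * M n + 2 * \<kappa> * C0 / h n + \<kappa> * C0 * J)\<^sup>2 \<le> (k0 * P)\<^sup>2" by (rule power_mono[OF s1 s0])
        have q2: "(2 * M n + 2 * \<kappa> * C0 / h n + \<kappa> * C0 * J)\<^sup>2 * (1 + 1 / h n) \<le> (k0 * P)\<^sup>2 * ((1 + 1 / C) * P)"
          by (rule mult_mono[OF q1 s2]) (use hp in auto)
        have q3: "(2 * M n + 2 * \<kappa> * C0 / h n + \<kappa> * C0 * J)\<^sup>2 * (1 + 1 / h n) * (h n * n) \<le> (k0 * P)\<^sup>2 * ((1 + 1 / C) * P) * (C * P)"
          by (rule mult_mono[OF q2 hnP]) (use hp P1 pars in auto)
        have "W n = ((2 * M n + 2 * \<kappa> * C0 / h n + \<kappa> * C0 * J)\<^sup>2 * (1 + 1 / h n) * (h n * n)) * (D * exp (- cc * real n) / v)"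
          by (simp add: W_def)
        also have "\<dots> \<le> ((k0 * P)\<^sup>2 * ((1 + 1 / C) * P) * (C * P)) * (D * exp (- cc * real n) / v)"
          by (rule mult_right_mono[OF q3]) (use cD hv in simp)
        \<comment> \<open>Four factors \<open>P\<close>: two from the square, one from
          \<open>1 + 1 / h n\<close> and one from \<open>h n * n\<close>.\<close>
        also have "\<dots> = (k0\<^sup>2 * D * (1 + 1 / C) * C / v) * (P ^ 4 * exp (- cc * real n))"
          by (simp add: power_mult_distrib power4_eq_xxxx power2_eq_square)
        also have "P ^ 4 = real n powr (4 * p)"
          unfolding P_def using n by (simp add: powr_power mult.commute)
        finally have "W n \<le> (k0\<^sup>2 * D * (1 + 1 / C) * C / v) * (real n powr (4 * p) * exp (- cc * real n))" .
        moreover have "0 \<le> W n" unfolding W_def using cD hv hp by simp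
        ultimately show ?case by simp
      qed
    qed
    have bd: "bd \<longlonglongrightarrow> 0" unfolding bd_def[abs_def] using tendsto_add[OF tendsto_add[OF l1 l2] l3] by simp
    show "(\<lambda>n. expectation (\<lambda>\<omega>. (F n \<omega> - c (h n) - \<sigma> n * A n \<omega>)\<^sup>2) / (\<sigma> n)\<^sup>2) \<longlonglongrightarrow> 0"
      by (rule tendsto_sandwich[OF _ upper tendsto_const bd]) simp
  qed
qed

end

section \<open>From the observation model to the analytic setting\<close>

theorem theorem2p2:
  fixes P :: "'p measure" and N :: "'p \<Rightarrow> nat" and Y :: "nat \<Rightarrow> 'p \<Rightarrow> real"
    and Q :: "'q measure" and X :: "nat \<Rightarrow> 'q \<Rightarrow> real"
    and f g w :: "real \<Rightarrow> real"
    and h M :: "nat \<Rightarrow> real"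
    and lam \<beta> L1 L2 C \<gamma> \<alpha> x :: real and l :: nat
    and F :: "nat \<Rightarrow> 'q \<Rightarrow> real"
  assumes pos: "lam > 0" "\<beta> > 0" "L1 > 0" "L2 > 0"
    and l_eq: "l = nat \<lfloor>\<beta>\<rfloor>"
    \<comment> \<open>the model; \<open>N\<close> is viewed as a real random variable to join the independent family\<close>
    and P: "prob_space P"
    and N_meas: "N \<in> measurable P (count_space UNIV)"
    and N_poisson: "distr P (count_space UNIV) N = measure_pmf (poisson_pmf lam)"
    and f_nonneg: "\<And>y. f y \<ge> 0"
    and Y_density: "\<And>j. distributed P lborel (Y j) (\<lambda>y. ennreal (f y))"
    and NY_indep: "prob_space.indep_vars P (\<lambda>_. borel)
                     (case_option (\<lambda>\<omega>. real (N \<omega>)) Y) (UNIV :: nat option set)"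
    and g_cont: "continuous_on UNIV g"
    and g_nonneg: "\<And>y. g y \<ge> 0"
    and g_density: "distributed (uniform_measure P {\<omega> \<in> space P. N \<omega> > 0}) lborel
                      (compound_sum N Y) (\<lambda>y. ennreal (g y))"
    \<comment> \<open>the observations: independent copies of the compound sum\<close>
    and Q: "prob_space Q"
    and X_indep: "prob_space.indep_vars Q (\<lambda>_. borel) X UNIV"
    and X_copy: "\<And>i. distr Q borel (X i) = distr P borel (compound_sum N Y)"
    \<comment> \<open>condition (F)\<close>
    and f_class: "f \<in> holder_class \<beta> L1 \<inter> nikolskii_class \<beta> L2"
    and f_fourier: "integrable lborel (\<lambda>t. complex_of_real (\<bar>t\<bar> powr \<beta>) * fourier f t)"
    and f_derivs: "\<And>k. k \<in> {1..l} \<Longrightarrow> integrable lborel ((deriv ^^ k) f)"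
    \<comment> \<open>condition (W)\<close>
    and w_kernel: "kernel_of_order l w"
    and w_bounded: "bounded (range w)"
    and w_symmetric: "\<And>u. w (- u) = w u"
    and w_supp: "closure {t. fourier w t \<noteq> 0} \<subseteq> {-1..1}"
    and w_C1: "fourier w C1_differentiable_on UNIV"
    and w_moment: "integrable lborel (\<lambda>u. \<bar>u\<bar> powr \<beta> * \<bar>w u\<bar>)"
    and w_decay: "((\<lambda>u. \<bar>u * w u\<bar>) \<longlongrightarrow> 0) at_infinity"
    \<comment> \<open>conditions (H) and (M)\<close>
    and h_pars: "C > 0" "0 < \<gamma>" "\<gamma> < 1"
    and h_eq: "\<And>n. n \<ge> 1 \<Longrightarrow> h n = C * real n powr (- \<gamma>)"
    and M_par: "\<alpha> > 0"
    and M_eq: "\<And>n. n \<ge> 1 \<Longrightarrow> M n = real n powr \<alpha>"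
    and h_fast: "(\<lambda>n. real n * h n powr (1 + 4 * \<beta>)) \<longlonglongrightarrow> 0"
    and g_x: "g x \<noteq> 0"
    and F_eq: "\<And>n \<omega>. F n \<omega> = f_hat lam w (h n) (M n) n (\<lambda>k. nonzero_obs X k \<omega>) x"
  shows "weak_conv_m
           (\<lambda>n. distr Q borel
                  (\<lambda>\<omega>. (F n \<omega> - prob_space.expectation Q (F n)) / sqrt (prob_space.variance Q (F n))))
           std_normal_distribution"
proof -
  interpret P: prob_space P by fact
  interpret Q: prob_space Q by fact
  \<comment> \<open>The law of one observation, with an atom of mass \<open>exp (- lam)\<close> at 0
    coming from \<open>N = 0\<close>.\<close>
  define \<mu> where "\<mu> = distr P borel (compound_sum N Y)"
  have Y_meas: "Y j \<in> borel_measurable P" for j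
    using Y_density[of j] unfolding distributed_def by (simp add: measurable_lborel1)
  note law = compound_poisson_law[OF P pos(1) N_meas N_poisson Y_meas g_nonneg g_density, folded \<mu>_def]
  have q: "measure \<mu> {0} < 1" unfolding law(3) using pos by simp
  have X_dist: "distr Q borel (X i) = \<mu>" for i unfolding \<mu>_def by (rule X_copy)
  note iid = Q.nonzero_obs_iid[OF X_indep X_dist q]
  have g_meas[measurable]: "g \<in> borel_measurable borel"
    using g_cont by (rule borel_measurable_continuous_onI)
  have Z_meas: "nonzero_obs X k \<in> borel_measurable Q" for k
    using iid(1) unfolding Q.indep_vars_def by auto
  \<comment> \<open>The nonzero observations follow \<open>\<mu>\<close> conditioned on being
    nonzero, which is the law given \<open>N > 0\<close>.\<close>
  have Z_distr: "distr Q borel (nonzero_obs X k) = density lborel (\<lambda>y. ennreal (g y))" for k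
  proof (rule measure_eqI)
    fix A assume A: "A \<in> sets (distr Q borel (nonzero_obs X k))"
    interpret Zk: prob_space "distr Q borel (nonzero_obs X k)" using Z_meas by (rule Q.prob_space_distr)
    have one: "(\<integral>\<^sup>+y. ennreal (g y) \<partial>lborel) = 1"
      using nn_integral_eq_integral[OF law(1)] g_nonneg law(2) by simp
    interpret D: prob_space "density lborel (\<lambda>y. ennreal (g y))"
      by (rule prob_spaceI) (simp add: emeasure_density one)
    show "emeasure (distr Q borel (nonzero_obs X k)) A = emeasure (density lborel (\<lambda>y. ennreal (g y))) A"
      unfolding Zk.emeasure_eq_measure D.emeasure_eq_measure using A iid(2)[of A k] law(4)[of A] by simp
  qed simp
  have f_meas[measurable]: "f \<in> borel_measurable borel"
    using distributed_real_measurable[OF _ Y_density[of 0]] f_nonneg by auto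
  define Df where "Df = density lborel (\<lambda>y. ennreal (f y))"
  have "distr P borel (Y 0) = Df"
    using Y_density[of 0] unfolding distributed_def Df_def
    by (metis distr_cong sets_lborel)
  then interpret Df: real_distribution Df
    using P.real_distribution_distr[OF Y_meas[of 0]] by simp
  have ff: "fourier f = char Df"
    unfolding char_def Df_def by (rule ext, rule fourier_eq_integral_density) (use f_nonneg in auto)
  have ff_cont: "continuous_on UNIV (fourier f)"
    unfolding ff by (auto intro!: continuous_at_imp_continuous_on Df.isCont_char)
  have ff_le: "cmod (fourier f t) \<le> 1" for t unfolding ff by (rule Df.cmod_char_le_1)
  \<comment> \<open>On [-1,1] the transform is bounded by 1; outside, the weight
    \<open>|t| powr \<beta>\<close> is at least 1, so the weighted integrability in condition (F)
    dominates.\<close>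
  have ff_int: "integrable lborel (fourier f)"
  proof (rule Bochner_Integration.integrable_bound)
    show "integrable lborel (\<lambda>t. indicator {-1..1} t + cmod (complex_of_real (\<bar>t\<bar> powr \<beta>) * fourier f t))"
      using f_fourier by auto
    show "fourier f \<in> borel_measurable lborel"
      using borel_measurable_continuous_onI[OF ff_cont] by simp
    show "AE t in lborel. cmod (fourier f t) \<le> norm (indicator {-1..1} t + cmod (complex_of_real (\<bar>t\<bar> powr \<beta>) * fourier f t))"
    proof (rule AE_I2)
      fix t :: real
      show "cmod (fourier f t) \<le> norm (indicator {-1..1} t + cmod (complex_of_real (\<bar>t\<bar> powr \<beta>) * fourier f t))"
      proof (cases "\<bar>t\<bar> \<le> 1")
        case True
        then show ?thesis using ff_le[of t] by (simp add: norm_mult abs_le_iff add_increasing2)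
      next
        case False
        then have "1 \<le> \<bar>t\<bar> powr \<beta>" using pos by (intro ge_one_powr_ge_zero) auto
        then have "1 * cmod (fourier f t) \<le> \<bar>t\<bar> powr \<beta> * cmod (fourier f t)" by (intro mult_right_mono) auto
        moreover have "0 \<le> indicat_real {-1..1} t" by simp
        moreover have "norm (indicator {-1..1} t + cmod (complex_of_real (\<bar>t\<bar> powr \<beta>) * fourier f t))
            = indicat_real {-1..1} t + \<bar>t\<bar> powr \<beta> * cmod (fourier f t)"
          by (simp add: norm_mult)
        ultimately show ?thesis by linarith
      qed
    qed
  qed
  have w_int: "integrable lborel w" and w_one: "(LINT u|lborel. w u) = 1"
    using w_kernel unfolding kernel_of_order_def by (auto dest!: bspec[of _ _ 0])
  have w_0: "fourier w 0 = 1"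
    unfolding fourier_def using w_one by simp
  have w_supp': "fourier w t = 0" if "\<bar>t\<bar> > 1" for t
    using w_supp that closure_subset[of "{t. fourier w t \<noteq> 0}"] by force
  have w_le: "cmod (fourier w t) \<le> (LINT u|lborel. \<bar>w u\<bar>)" for t
    unfolding fourier_def by (rule order_trans[OF integral_norm_bound]) (simp add: norm_mult)
  \<comment> \<open>The imaginary part is the integral of an odd function, as \<open>w\<close> is
    symmetric.\<close>
  have w_real: "Im (fourier w t) = 0" for t
  proof -
    have i: "integrable lborel (\<lambda>u. iexp (t * u) * complex_of_real (w u))"
      using w_int by (rule Bochner_Integration.integrable_bound) (use w_int in \<open>auto simp: norm_mult\<close>)
    have "Im (fourier w t) = (LINT u|lborel. Im (iexp (t * u) * complex_of_real (w u)))"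
      unfolding fourier_def by (rule integral_Im[OF i, symmetric])
    also have "\<dots> = (LINT u|lborel. sin (t * u) * w u)" by (simp add: Im_exp)
    finally have s: "Im (fourier w t) = (LINT u|lborel. sin (t * u) * w u)" .
    have "(LINT u|lborel. sin (t * u) * w u) = (LINT u|lborel. sin (t * (0 + (-1) * u)) * w (0 + (-1) * u))"
      by (subst lborel_integral_real_affine[of "-1" _ 0]) auto
    also have "\<dots> = - (LINT u|lborel. sin (t * u) * w u)" by (simp add: w_symmetric)
    finally show ?thesis using s by simp
  qed
  \<comment> \<open>The uniform bound on \<open>fourier w\<close> is taken to be the L1 norm of
    \<open>w\<close>.\<close>
  interpret decompounding Q "nonzero_obs X" f g w lam x "LINT u|lborel. \<bar>w u\<bar>"
  proof (unfold_locales)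
    show "Q.indep_vars (\<lambda>_. borel) (nonzero_obs X) UNIV" by (rule iid(1))
    show "distr Q borel (nonzero_obs X k) = density lborel (\<lambda>y. ennreal (g y))" for k by (rule Z_distr)
    show "of_real (exp lam - 1) * fourier g t + 1 = exp (of_real lam * fourier f t)" for t
      by (rule fourier_conditional_density[OF P pos(1) N_meas N_poisson f_nonneg Y_density NY_indep g_nonneg g_density])
  qed (fact pos(1) g_cont g_nonneg law(1) g_x ff_cont ff_le ff_int w_C1 w_0 w_supp' w_real w_le)+
  have F: "F = (\<lambda>n \<omega>. f_hat lam w (h n) (M n) n (\<lambda>k. nonzero_obs X k \<omega>) x)"
    by (intro ext F_eq)
  show ?thesis
    unfolding F by (rule asymptotic_normality[OF h_pars M_par h_eq M_eq])
qed

end
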